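(* Unless the OMv Hypothesis fails, there is no algorithm for incremental (respectively, decremental) transitive closure with predictions with arbitrary polynomial preprocessing time, worst-case $O(n^{1-\varepsilon})$ edge insertion (respectively, deletion) time, and $O(\eta_\infty^{2-\varepsilon})$ query time, for any $\varepsilon>0$. This already holds with respect to amortized time bounds per operation.
   Context: Incremental transitive closure with predictions: on a directed graph with vertex set $V$, $|V|=n$, the algorithm first receives (offline) a predicted sequence $\hat e_1,\dots,\hat e_m$ of distinct edges, may preprocess it, and then, starting from the empty graph, receives online an interleaved sequence of edge insertions $e_1,\dots,e_m$ (the same edges in some order) and reachability queries $(s,t)$, each of which must be answered by whether $t$ is reachable from $s$ in the current graph. In the decremental version, the initial graph has edge set $\{\hat e_1,\dots,\hat e_m\}$, the predicted sequence is the predicted deletion order, and the online updates are edge deletions $e_1,\dots,e_m$ interleaved with queries. With $t(e)=i$ if $e=e_i$ and $\hat t(e)=j$ if $e=\hat e_j$, $\eta_\infty=\max_e|t(e)-\hat t(e)|$. OMv problem: given $M\in\{0,1\}^{n\times n}$ for preprocessing, answer $n$ online queries $v_1,\dots,v_n\in\{0,1\}^n$ with the Boolean product $Mv_i$ before seeing $v_{i+1}$. The OMv Hypothesis states that for every $\varepsilon>0$ there is no algorithm solving OMv in $O(n^{3-\varepsilon})$ total time (even allowing polynomial preprocessing of $M$). *)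

theory Defs
  imports Complex_Main
begin

section \<open>Word RAM\<close>

text \<open>
  Algorithms are deterministic word RAM programs with structured control flow. There is a single
  random-access memory, a read-only random-access input and an append-only output. Program
  variables are memory cells with constant addresses. The parameter \<open>W\<close> below bounds the machine
  words: every intermediate value has to be less than \<open>W\<close>, otherwise evaluation fails and the
  program has no execution. Without such a bound, unit-cost arithmetic on large numbers would make
  the OMv problem easy. (Arithmetic modulo the word range is available through \<open>Rem\<close> in words of
  twice the length.)
\<close>

datatype binop = Add | Sub | Mul | Quot | Rem | Band | Bor | Bxor | Shl | Shr | Lt | Eq

fun binop_val :: "binop \<Rightarrow> nat \<Rightarrow> nat \<Rightarrow> nat" where
  "binop_val Add x y = x + y"
| "binop_val Sub x y = x - y"
| "binop_val Mul x y = x * y"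
| "binop_val Quot x y = x div y"
| "binop_val Rem x y = x mod y"
| "binop_val Band x y = Bit_Operations.and x y"
| "binop_val Bor x y = Bit_Operations.or x y"
| "binop_val Bxor x y = Bit_Operations.xor x y"
| "binop_val Shl x y = push_bit y x"
| "binop_val Shr x y = drop_bit y x"
| "binop_val Lt x y = of_bool (x < y)"
| "binop_val Eq x y = of_bool (x = y)"

datatype expr = Const nat | Load expr | Input expr | Bin binop expr expr

type_synonym memory = "nat \<Rightarrow> nat"

definition word :: "nat \<Rightarrow> nat \<Rightarrow> nat option" where
  "word W x = (if x < W then Some x else None)"

fun eval :: "nat \<Rightarrow> nat list \<Rightarrow> memory \<Rightarrow> expr \<Rightarrow> nat option" where
  "eval W inp \<mu> (Const k) = word W k"
| "eval W inp \<mu> (Load a) =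
     (case eval W inp \<mu> a of None \<Rightarrow> None | Some x \<Rightarrow> word W (\<mu> x))"
| "eval W inp \<mu> (Input a) =
     (case eval W inp \<mu> a of None \<Rightarrow> None
      | Some x \<Rightarrow> if x < length inp then word W (inp ! x) else None)"
| "eval W inp \<mu> (Bin f a b) =
     (case (eval W inp \<mu> a, eval W inp \<mu> b) of
        (Some x, Some y) \<Rightarrow> word W (binop_val f x y)
      | _ \<Rightarrow> None)"

datatype com = Skip | Store expr expr | Emit expr | Seq com com | Cond expr com com | While expr com

text \<open>
  \<open>exec W inp c \<mu> \<tau> \<mu>' out\<close>: on input \<open>inp\<close> and memory \<open>\<mu>\<close>, program \<open>c\<close> halts after \<open>\<tau>\<close> steps
  with memory \<open>\<mu>'\<close> and output \<open>out\<close>. Each elementary command and each test counts as one step; as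
  the expressions of a fixed program have bounded size, this is the usual unit cost up to a constant
  factor.
\<close>

inductive exec ::
  "nat \<Rightarrow> nat list \<Rightarrow> com \<Rightarrow> memory \<Rightarrow> nat \<Rightarrow> memory \<Rightarrow> nat list \<Rightarrow> bool"
  for W :: nat and inp :: "nat list"
where
  Skip: "exec W inp Skip \<mu> 1 \<mu> []"
| Store: "eval W inp \<mu> a = Some x \<Longrightarrow> eval W inp \<mu> b = Some y \<Longrightarrow>
    exec W inp (Store a b) \<mu> 1 (\<mu>(x := y)) []"
| Emit: "eval W inp \<mu> a = Some x \<Longrightarrow> exec W inp (Emit a) \<mu> 1 \<mu> [x]"
| Seq: "exec W inp c1 \<mu> \<tau>1 \<mu>1 out1 \<Longrightarrow> exec W inp c2 \<mu>1 \<tau>2 \<mu>2 out2 \<Longrightarrow>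
    exec W inp (Seq c1 c2) \<mu> (\<tau>1 + \<tau>2) \<mu>2 (out1 @ out2)"
| Cond_True: "eval W inp \<mu> a = Some x \<Longrightarrow> x \<noteq> 0 \<Longrightarrow> exec W inp c1 \<mu> \<tau> \<mu>' out \<Longrightarrow>
    exec W inp (Cond a c1 c2) \<mu> (1 + \<tau>) \<mu>' out"
| Cond_False: "eval W inp \<mu> a = Some 0 \<Longrightarrow> exec W inp c2 \<mu> \<tau> \<mu>' out \<Longrightarrow>
    exec W inp (Cond a c1 c2) \<mu> (1 + \<tau>) \<mu>' out"
| While_False: "eval W inp \<mu> a = Some 0 \<Longrightarrow> exec W inp (While a c) \<mu> 1 \<mu> []"
| While_True: "eval W inp \<mu> a = Some x \<Longrightarrow> x \<noteq> 0 \<Longrightarrow>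
    exec W inp c \<mu> \<tau>1 \<mu>1 out1 \<Longrightarrow> exec W inp (While a c) \<mu>1 \<tau>2 \<mu>2 out2 \<Longrightarrow>
    exec W inp (While a c) \<mu> (1 + \<tau>1 + \<tau>2) \<mu>2 (out1 @ out2)"

inductive_cases exec_SkipE: "exec W inp Skip \<mu> \<tau> \<mu>' out"
inductive_cases exec_StoreE: "exec W inp (Store a b) \<mu> \<tau> \<mu>' out"
inductive_cases exec_EmitE: "exec W inp (Emit a) \<mu> \<tau> \<mu>' out"
inductive_cases exec_SeqE: "exec W inp (Seq c1 c2) \<mu> \<tau> \<mu>' out"
inductive_cases exec_CondE: "exec W inp (Cond a c1 c2) \<mu> \<tau> \<mu>' out"
inductive_cases exec_WhileE: "exec W inp (While a c) \<mu> \<tau> \<mu>' out"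

lemma exec_deterministic:
  "exec W inp c \<mu> \<tau> \<mu>' out \<Longrightarrow> exec W inp c \<mu> \<tau>' \<mu>'' out' \<Longrightarrow>
     \<tau>' = \<tau> \<and> \<mu>'' = \<mu>' \<and> out' = out"
proof (induction arbitrary: \<tau>' \<mu>'' out' rule: exec.induct)
  case Skip
  then show ?case by (auto elim: exec_SkipE)
next
  case Store
  then show ?case by (auto elim!: exec_StoreE)
next
  case Emit
  then show ?case by (auto elim!: exec_EmitE)
next
  case (Seq c1 \<mu> \<tau>1 \<mu>1 out1 c2 \<tau>2 \<mu>2 out2)
  from Seq.prems obtain \<sigma>1 \<nu>1 o1 \<sigma>2 o2 where
    "exec W inp c1 \<mu> \<sigma>1 \<nu>1 o1" "exec W inp c2 \<nu>1 \<sigma>2 \<mu>'' o2" "\<tau>' = \<sigma>1 + \<sigma>2" "out' = o1 @ o2"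
    by (rule exec_SeqE)
  with Seq.IH(1)[OF this(1)] Seq.IH(2) show ?case by blast
next
  case (Cond_True \<mu> a x c1 \<tau> \<mu>' out c2)
  from Cond_True.prems show ?case
  proof (rule exec_CondE)
    fix y \<sigma> assume "exec W inp c1 \<mu> \<sigma> \<mu>'' out'" "\<tau>' = Suc \<sigma>"
    then show ?case using Cond_True.IH by simp
  qed (use Cond_True.hyps in simp)
next
  case (Cond_False \<mu> a c2 \<tau> \<mu>' out c1)
  from Cond_False.prems show ?case
  proof (rule exec_CondE)
    fix \<sigma> assume "exec W inp c2 \<mu> \<sigma> \<mu>'' out'" "\<tau>' = Suc \<sigma>"
    then show ?case using Cond_False.IH by simp
  qed (use Cond_False.hyps in simp)
next
  case (While_False \<mu> a c)
  from While_False.prems show ?case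
    by (rule exec_WhileE) (use While_False.hyps in simp_all)
next
  case (While_True \<mu> a x c \<tau>1 \<mu>1 out1 \<tau>2 \<mu>2 out2)
  from While_True.prems show ?case
  proof (rule exec_WhileE)
    fix y \<sigma>1 \<nu>1 o1 \<sigma>2 o2
    assume "exec W inp c \<mu> \<sigma>1 \<nu>1 o1" "exec W inp (While a c) \<nu>1 \<sigma>2 \<mu>'' o2"
      "\<tau>' = Suc (\<sigma>1 + \<sigma>2)" "out' = o1 @ o2"
    with While_True.IH(1)[OF this(1)] While_True.IH(2) show ?case by simp
  qed (use While_True.hyps in simp)
qed

text \<open>
  Online service of a sequence of requests: each request consists of the program that handles it
  and its input; the memory persists between requests. The result is the list of running times and
  outputs.
\<close>

inductive serve ::
  "nat \<Rightarrow> memory \<Rightarrow> (com \<times> nat list) list \<Rightarrow> (nat \<times> nat list) list \<Rightarrow> bool"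
  for W :: nat
where
  Nil: "serve W \<mu> [] []"
| Cons: "exec W inp c \<mu> \<tau> \<mu>' out \<Longrightarrow> serve W \<mu>' reqs res \<Longrightarrow>
    serve W \<mu> ((c, inp) # reqs) ((\<tau>, out) # res)"


section \<open>The OMv problem\<close>

definition bool_mult_vec :: "nat \<Rightarrow> (nat \<Rightarrow> nat \<Rightarrow> bool) \<Rightarrow> (nat \<Rightarrow> bool) \<Rightarrow> nat \<Rightarrow> bool" where
  "bool_mult_vec n M v i \<longleftrightarrow> (\<exists>j<n. M i j \<and> v j)"

definition encode_vec :: "nat \<Rightarrow> (nat \<Rightarrow> bool) \<Rightarrow> nat list" where
  "encode_vec n v = map (\<lambda>i. of_bool (v i)) [0..<n]"

definition encode_mat :: "nat \<Rightarrow> (nat \<Rightarrow> nat \<Rightarrow> bool) \<Rightarrow> nat list" where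
  "encode_mat n M = n # concat (map (\<lambda>i. encode_vec n (M i)) [0..<n])"

text \<open>
  \<open>P\<close> preprocesses the matrix in polynomial time, \<open>Q\<close> answers a single vector query; the total time
  of the \<open>n\<close> queries is \<open>O(n^(3-\<epsilon>))\<close>. Words have \<open>O(log n)\<close> bits, that is, their range is
  polynomial in \<open>n\<close>.
\<close>

definition solves_OMv :: "real \<Rightarrow> com \<Rightarrow> com \<Rightarrow> bool" where
  "solves_OMv \<epsilon> P Q \<longleftrightarrow>
    (\<exists>\<kappa> d :: nat. \<exists>C :: real. \<forall>n\<ge>1. \<forall>M vs. length vs = n \<longrightarrow>
      (\<exists>\<tau> \<mu> out res.
         exec ((n + 2) ^ \<kappa>) (encode_mat n M) P (\<lambda>_. 0) \<tau> \<mu> out \<and>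
         serve ((n + 2) ^ \<kappa>) \<mu> (map (\<lambda>v. (Q, encode_vec n v)) vs) res \<and>
         map snd res = map (\<lambda>v. encode_vec n (bool_mult_vec n M v)) vs \<and>
         real \<tau> \<le> C * real n ^ d \<and>
         real (sum_list (map fst res)) \<le> C * real n powr (3 - \<epsilon>)))"

definition OMv_hypothesis :: bool where
  "OMv_hypothesis \<longleftrightarrow> (\<forall>\<epsilon>>0. \<not> (\<exists>P Q. solves_OMv \<epsilon> P Q))"


section \<open>Partially dynamic transitive closure with predictions\<close>

text \<open>The vertex set is \<open>{..<n}\<close>.\<close>

type_synonym edge = "nat \<times> nat"

datatype operation = Update edge | Query nat nat

fun updates :: "operation list \<Rightarrow> edge list" where
  "updates [] = []"
| "updates (Update e # ops) = e # updates ops"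
| "updates (Query s t # ops) = updates ops"

definition tc_instance :: "nat \<Rightarrow> edge list \<Rightarrow> operation list \<Rightarrow> bool" where
  "tc_instance n ehat ops \<longleftrightarrow>
     distinct ehat \<and> set ehat \<subseteq> {..<n} \<times> {..<n} \<and>
     distinct (updates ops) \<and> set (updates ops) = set ehat \<and>
     (\<forall>s t. Query s t \<in> set ops \<longrightarrow> s < n \<and> t < n)"

text \<open>The current graph, given the predicted sequence and the operations performed so far.\<close>

definition incremental_graph :: "edge list \<Rightarrow> operation list \<Rightarrow> edge set" where
  "incremental_graph ehat ops = set (updates ops)"

definition decremental_graph :: "edge list \<Rightarrow> operation list \<Rightarrow> edge set" where
  "decremental_graph ehat ops = set ehat - set (updates ops)"

definition position :: "'a list \<Rightarrow> 'a \<Rightarrow> nat" where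
  "position xs x = (THE i. i < length xs \<and> xs ! i = x)"

text \<open>Inserting \<open>0\<close> only matters for the empty sequence.\<close>

definition eta_inf :: "edge list \<Rightarrow> edge list \<Rightarrow> nat" where
  "eta_inf ehat es =
     Max (insert 0 ((\<lambda>e. nat \<bar>int (position es e) - int (position ehat e)\<bar>) ` set es))"

definition encode_prediction :: "nat \<Rightarrow> edge list \<Rightarrow> nat list" where
  "encode_prediction n ehat = n # length ehat # concat (map (\<lambda>(u, v). [u, v]) ehat)"

fun request :: "com \<Rightarrow> com \<Rightarrow> operation \<Rightarrow> com \<times> nat list" where
  "request U Q (Update (u, v)) = (U, [u, v])"
| "request U Q (Query s t) = (Q, [s, t])"

definition correct_answers ::
  "(edge list \<Rightarrow> operation list \<Rightarrow> edge set) \<Rightarrow> edge list \<Rightarrow> operation list \<Rightarrow> nat list list \<Rightarrow> bool"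
where
  "correct_answers G ehat ops outs \<longleftrightarrow>
     (\<forall>i s t. i < length ops \<and> ops ! i = Query s t \<longrightarrow>
        outs ! i = [of_bool ((s, t) \<in> (G ehat (take i ops))\<^sup>*)])"

text \<open>
  The query bound \<open>O(\<eta>^(2-\<epsilon>))\<close> is read as \<open>O(1)\<close> for \<open>\<eta> = 0\<close>: literally it would be zero, which no
  algorithm attains.
\<close>

fun operation_bound :: "real \<Rightarrow> nat \<Rightarrow> nat \<Rightarrow> operation \<Rightarrow> real" where
  "operation_bound \<epsilon> n \<eta> (Update e) = real n powr (1 - \<epsilon>)"
| "operation_bound \<epsilon> n \<eta> (Query s t) = real (max 1 \<eta>) powr (2 - \<epsilon>)"

definition worst_case_bound :: "real \<Rightarrow> nat \<Rightarrow> nat \<Rightarrow> real \<Rightarrow> operation list \<Rightarrow> nat list \<Rightarrow> bool" where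
  "worst_case_bound \<epsilon> n \<eta> C ops ts \<longleftrightarrow>
     (\<forall>i<length ops. real (ts ! i) \<le> C * operation_bound \<epsilon> n \<eta> (ops ! i))"

definition amortized_bound :: "real \<Rightarrow> nat \<Rightarrow> nat \<Rightarrow> real \<Rightarrow> operation list \<Rightarrow> nat list \<Rightarrow> bool" where
  "amortized_bound \<epsilon> n \<eta> C ops ts \<longleftrightarrow>
     real (sum_list ts) \<le> C * sum_list (map (operation_bound \<epsilon> n \<eta>) ops)"

text \<open>
  \<open>P\<close> preprocesses the prediction in polynomial time, \<open>U\<close> handles a single update and \<open>Q\<close> a single
  query. \<open>G\<close> selects the incremental or decremental problem, \<open>T\<close> worst-case or amortized time.
\<close>

definition solves_TC ::
  "(edge list \<Rightarrow> operation list \<Rightarrow> edge set) \<Rightarrow>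
   (nat \<Rightarrow> nat \<Rightarrow> real \<Rightarrow> operation list \<Rightarrow> nat list \<Rightarrow> bool) \<Rightarrow> com \<Rightarrow> com \<Rightarrow> com \<Rightarrow> bool"
where
  "solves_TC G T P U Q \<longleftrightarrow>
    (\<exists>\<kappa> d :: nat. \<exists>C :: real. \<forall>n\<ge>1. \<forall>ehat ops. tc_instance n ehat ops \<longrightarrow>
      (\<exists>\<tau> \<mu> out res.
         exec ((n + 2) ^ \<kappa>) (encode_prediction n ehat) P (\<lambda>_. 0) \<tau> \<mu> out \<and>
         serve ((n + 2) ^ \<kappa>) \<mu> (map (request U Q) ops) res \<and>
         correct_answers G ehat ops (map snd res) \<and>
         real \<tau> \<le> C * real n ^ d \<and>
         T n (eta_inf ehat (updates ops)) C ops (map fst res)))"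

end

theory Submission
  imports Defs
begin

text \<open>
  Let \<open>k\<close> be the integer part of the cube root of \<open>n\<close> and cut the matrix into \<open>k \<times> k\<close> blocks. For a
  vector \<open>v\<close> the blocks are visited row by row; at each block one asks whether some row that is not
  yet known to be hit is hit through this block. If the answer is no, nothing changes. If it is yes,
  the block is searched by brute force in time \<open>O(k\<^sup>2)\<close>, which is paid for by a newly found row and
  hence happens \<open>O(n)\<close> times per vector.

  A block question is a reachability query from \<open>s\<^sub>t\<close> to \<open>t\<^sub>t\<close> in a graph on \<open>5 k\<close> vertices that
  contains the block as a bipartite graph, with edges from \<open>s\<^sub>t\<close> to the unknown rows and from the
  columns in \<open>v\<close> to \<open>t\<^sub>t\<close>. One instance serves \<open>k\<close> questions with fresh sources and sinks. The
  prediction lists the edges round by round; in the incremental problem a round inserts the wanted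
  edges, queries, and then inserts the others, whereas in the decremental problem it deletes the
  unwanted ones, queries, and deletes the rest. So every edge is displaced only within its round,
  the error is at most \<open>2 k\<close>, and \<open>k\<close> rounds cost \<open>O(k\<^bsup>3-\<epsilon>\<^esup>)\<close>. With \<open>O((n/k)\<^sup>3)\<close> instances, all
  preprocessed in advance, the total is \<open>O(n\<^sup>3 k\<^bsup>-\<epsilon>\<^esup> + n\<^sup>2 k\<^sup>2 + n\<^sup>3/k)\<close>.

  The operations of every instance are determined by the matrix and the vectors, so their memory
  contents and running times can be fixed before the simulating program is analysed.
\<close>

text \<open>The size of \<open>k\<close> balances the two costs per vector outside the dynamic
  algorithm: (n/k)^2 blocks with about k steps of bookkeeping each cost n^2/k, and the searches cost
  n k^2. Both are n^(5/3) when k is the cube root of n. A saving of k^\<epsilon> then becomes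
  n^(\<epsilon>/3), the exponent in the result. The obstacle is that preprocessing knows the matrix
  but no vector. So a round always contains all \<open>2 * k\<close> edges at its source and sink,
  and only their order relative to the query carries information. The requests look adaptive, since
  the rows known to be hit come from earlier answers. But correct answers are a function of matrix
  and vectors, so being known is defined by these alone. Each operation sequence is thus a closed
  expression, to which the assumption on the dynamic algorithm applies as a whole. An amortised
  bound constrains complete sequences only, and the simulation may stop early; a prefix is charged
  with its whole sequence. A copy computes with words below a bound \<open>S\<close>, so all its
  addresses fit into \<open>S\<close> cells.\<close>

lemma updates_append [simp]: "updates (xs @ ys) = updates xs @ updates ys"
  by (induction xs rule: updates.induct) auto

lemma updates_map_Update [simp]: "updates (map Update es) = es"
  by (induction es) auto

lemma updates_concat: "updates (concat xss) = concat (map updates xss)"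
  by (induction xss) auto

lemma distinct_concat_upt:
  assumes "\<And>i. i < n \<Longrightarrow> distinct (f i)"
    and "\<And>i j. i < n \<Longrightarrow> j < n \<Longrightarrow> i \<noteq> j \<Longrightarrow> set (f i) \<inter> set (f j) = {}"
  shows "distinct (concat (map f [0..<n]))"
  using assms
proof (induction n)
  case (Suc n)
  have "set (f i) \<inter> set (f n) = {}" if "i < n" for i
    using Suc.prems(2)[of i n] that by simp
  then have "set (concat (map f [0..<n])) \<inter> set (f n) = {}" by fastforce
  moreover have "distinct (concat (map f [0..<n]))" by (rule Suc.IH) (use Suc.prems in auto)
  ultimately show ?case using Suc.prems(1)[of n] by (simp add: Int_commute)
qed simp

lemma concat_map_upt_split:
  "j < n \<Longrightarrow> concat (map f [0..<n]) = concat (map f [0..<j]) @ f j @ concat (map f [Suc j..<n])"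
  using upt_add_eq_append[of 0 j "n - j"] by (simp add: upt_rec[of j n])

lemma grid_index: "i < a \<Longrightarrow> j < k \<Longrightarrow> i * k + j < a * k" for i j a k :: nat
  using mult_le_mono1[of "Suc i" a k] by simp

section \<open>Displacement between two orderings of the same edges\<close>

lemma position_nth:
  assumes "distinct xs" "i < length xs"
  shows "position xs (xs ! i) = i"
  unfolding position_def by (rule the_equality) (use assms nth_eq_iff_index_eq in auto)

text \<open>Quantifying over pairs of indices with equal entries, instead of using
  \<open>position\<close>, makes the notion compatible with appending, so that it can be checked
  round by round.\<close>

definition near :: "nat \<Rightarrow> 'a list \<Rightarrow> 'a list \<Rightarrow> bool" where
  "near d xs ys \<longleftrightarrow> length xs = length ys \<and>
     (\<forall>a<length xs. \<forall>b<length ys. xs ! a = ys ! b \<longrightarrow> a \<le> b + d \<and> b \<le> a + d)"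

lemma near_length: "length xs = length ys \<Longrightarrow> length xs \<le> d \<Longrightarrow> near d xs ys"
  unfolding near_def by auto

lemma near_refl: "distinct xs \<Longrightarrow> near d xs xs"
  unfolding near_def by (auto simp: nth_eq_iff_index_eq)

lemma near_append:
  assumes "near d xs ys" "near d xs' ys'" "set xs \<inter> set ys' = {}" "set xs' \<inter> set ys = {}"
  shows "near d (xs @ xs') (ys @ ys')"
  unfolding near_def
proof (intro conjI allI impI)
  have l: "length xs = length ys" "length xs' = length ys'" using assms unfolding near_def by auto
  then show "length (xs @ xs') = length (ys @ ys')" by simp
  fix a b assume a: "a < length (xs @ xs')" and b: "b < length (ys @ ys')"
    and e: "(xs @ xs') ! a = (ys @ ys') ! b"
  have "a \<le> b + d \<and> b \<le> a + d"
  proof (cases "a < length xs"; cases "b < length ys")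
    assume "a < length xs" "b < length ys"
    then show ?thesis using assms(1) e unfolding near_def by (simp add: nth_append)
  next
    assume h: "a < length xs" "\<not> b < length ys"
    then have "xs ! a = ys' ! (b - length ys)" "b - length ys < length ys'"
      using e b by (auto simp: nth_append)
    then show ?thesis using assms(3) h by (metis disjoint_iff nth_mem)
  next
    assume h: "\<not> a < length xs" "b < length ys"
    then have "xs' ! (a - length xs) = ys ! b" "a - length xs < length xs'"
      using e a by (auto simp: nth_append)
    then show ?thesis using assms(4) h by (metis disjoint_iff nth_mem)
  next
    assume h: "\<not> a < length xs" "\<not> b < length ys"
    then have "xs' ! (a - length xs) = ys' ! (b - length ys)" "a - length xs < length xs'"
      "b - length ys < length ys'"
      using e a b by (auto simp: nth_append)
    then have "a - length xs \<le> (b - length ys) + d" "b - length ys \<le> (a - length xs) + d"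
      using assms(2) unfolding near_def by blast+
    then show ?thesis using h l by linarith
  qed
  then show "a \<le> b + d" "b \<le> a + d" by auto
qed

lemma near_concat_upt:
  assumes "\<And>i. i < n \<Longrightarrow> near d (f i) (g i)"
    and "\<And>i. i < n \<Longrightarrow> set (f i) = set (g i)"
    and "\<And>i j. i < n \<Longrightarrow> j < n \<Longrightarrow> i \<noteq> j \<Longrightarrow> set (f i) \<inter> set (f j) = {}"
  shows "near d (concat (map f [0..<n])) (concat (map g [0..<n]))"
  using assms
proof (induction n)
  case 0
  show ?case by (simp add: near_def)
next
  case (Suc n)
  have s: "set (g i) = set (f i)" if "i \<le> n" for i using Suc.prems(2)[of i] that by simp
  have 1: "near d (concat (map f [0..<n])) (concat (map g [0..<n]))"
    by (rule Suc.IH) (use Suc.prems in auto)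
  have dj: "set (f i) \<inter> set (f n) = {}" if "i < n" for i
    using Suc.prems(3)[of i n] that by simp
  have "near d (concat (map f [0..<n]) @ f n) (concat (map g [0..<n]) @ g n)"
    by (rule near_append[OF 1 Suc.prems(1)]) (use dj s in fastforce)+
  then show ?case by simp
qed

lemma eta_inf_le_near:
  assumes "near d ehat es" "distinct ehat" "distinct es" "set es = set ehat"
  shows "eta_inf ehat es \<le> d"
proof -
  have "nat \<bar>int (position es e) - int (position ehat e)\<bar> \<le> d" if e: "e \<in> set es" for e
  proof -
    obtain a where a: "a < length es" "es ! a = e" using e by (meson in_set_conv_nth)
    obtain b where b: "b < length ehat" "ehat ! b = e"
      using e assms(4) by (metis in_set_conv_nth)
    have "position es e = a" "position ehat e = b"
      using position_nth assms a b by metis+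
    moreover have "a \<le> b + d" "b \<le> a + d" using assms(1) a b unfolding near_def by auto
    ultimately show ?thesis by simp
  qed
  then show ?thesis unfolding eta_inf_def by simp
qed

section \<open>The gadget\<close>

text \<open>
  Vertices: rows \<open>i\<close>, columns \<open>k + j\<close>, dummies \<open>2 * k + j\<close>, sources \<open>3 * k + t\<close> and sinks
  \<open>4 * k + t\<close>. A zero entry of the block \<open>mb\<close> becomes an edge to a dummy, so that the length of the
  prediction does not depend on the block. In round \<open>t\<close> the query concerns the rows \<open>i\<close> with
  \<open>\<not> x t i\<close> and the columns \<open>j\<close> with \<open>w t j\<close>.
\<close>

type_synonym bool_matrix = "nat \<Rightarrow> nat \<Rightarrow> bool"

definition medge :: "nat \<Rightarrow> bool_matrix \<Rightarrow> nat \<Rightarrow> nat \<Rightarrow> edge" where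
  "medge k mb i j = (i, if mb i j then k + j else 2 * k + j)"

definition medges :: "nat \<Rightarrow> bool_matrix \<Rightarrow> edge list" where
  "medges k mb = concat (map (\<lambda>i. concat (map (\<lambda>j. [medge k mb i j]) [0..<k])) [0..<k])"

definition redge :: "nat \<Rightarrow> nat \<Rightarrow> nat \<Rightarrow> edge list" where
  "redge k t j = [(3 * k + t, j), (k + j, 4 * k + t)]"

definition redges :: "nat \<Rightarrow> edge list" where
  "redges k = concat (map (\<lambda>t. concat (map (redge k t) [0..<k])) [0..<k])"

text \<open>\<open>x\<close> marks rows to leave out and \<open>w\<close> columns to include, hence
  the opposite signs. With \<open>b\<close> false the step yields the edges wanted by the query,
  with \<open>b\<close> true the unwanted ones.\<close>

definition gstep :: "nat \<Rightarrow> bool_matrix \<Rightarrow> bool_matrix \<Rightarrow> nat \<Rightarrow> bool \<Rightarrow> nat \<Rightarrow> edge list" where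
  "gstep k x w t b j = (if x t j = b then [(3 * k + t, j)] else []) @
     (if w t j \<noteq> b then [(k + j, 4 * k + t)] else [])"

definition gpass :: "nat \<Rightarrow> bool_matrix \<Rightarrow> bool_matrix \<Rightarrow> nat \<Rightarrow> bool \<Rightarrow> edge list" where
  "gpass k x w t b = concat (map (gstep k x w t b) [0..<k])"

definition ground :: "bool \<Rightarrow> nat \<Rightarrow> bool_matrix \<Rightarrow> bool_matrix \<Rightarrow> nat \<Rightarrow> operation list" where
  "ground inc k x w t = map Update (gpass k x w t (\<not> inc)) @ Query (3 * k + t) (4 * k + t) #
     map Update (gpass k x w t inc)"

text \<open>The block edges are inserted first or deleted last, so that they are all present at
  every query. Nothing here depends on a vector.\<close>

definition gehat :: "bool \<Rightarrow> nat \<Rightarrow> bool_matrix \<Rightarrow> edge list" where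
  "gehat inc k mb = (if inc then medges k mb @ redges k else redges k @ medges k mb)"

definition ginit :: "bool \<Rightarrow> nat \<Rightarrow> bool_matrix \<Rightarrow> operation list" where
  "ginit inc k mb = (if inc then map Update (medges k mb) else [])"

definition gops :: "bool \<Rightarrow> nat \<Rightarrow> bool_matrix \<Rightarrow> bool_matrix \<Rightarrow> bool_matrix \<Rightarrow> operation list" where
  "gops inc k mb x w = ginit inc k mb @ concat (map (ground inc k x w) [0..<k]) @
     (if inc then [] else map Update (medges k mb))"

definition tc_graph :: "bool \<Rightarrow> edge list \<Rightarrow> operation list \<Rightarrow> edge set" where
  "tc_graph inc = (if inc then incremental_graph else decremental_graph)"

lemma set_medges: "set (medges k mb) = {medge k mb i j |i j. i < k \<and> j < k}"
  unfolding medges_def by fastforce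

lemma distinct_medges: "distinct (medges k mb)"
  unfolding medges_def
  by (intro distinct_concat_upt) (auto simp: medge_def)

lemma length_medges: "length (medges k mb) = k * k"
  unfolding medges_def by (simp add: length_concat comp_def sum_list_triv)

lemma set_redges_round: "set (concat (map (redge k t) [0..<k])) =
    {(3 * k + t, j) |j. j < k} \<union> {(k + j, 4 * k + t) |j. j < k}"
  by (auto simp: redge_def)

lemma distinct_redges_round: "t < k \<Longrightarrow> distinct (concat (map (redge k t) [0..<k]))"
  by (intro distinct_concat_upt) (auto simp: redge_def)

lemma length_redges_round: "length (concat (map (redge k t) [0..<k])) = 2 * k"
  by (simp add: length_concat comp_def redge_def sum_list_triv)

lemma set_gpass: "set (gpass k x w t b) =
    {(3 * k + t, j) |j. j < k \<and> x t j = b} \<union> {(k + j, 4 * k + t) |j. j < k \<and> w t j \<noteq> b}"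
  unfolding gpass_def gstep_def by (auto split: if_splits)

lemma distinct_gpass: "t < k \<Longrightarrow> distinct (gpass k x w t b)"
  unfolding gpass_def by (intro distinct_concat_upt) (auto simp: gstep_def)

lemma updates_ground: "updates (ground inc k x w t) = gpass k x w t (\<not> inc) @ gpass k x w t inc"
  unfolding ground_def by simp

lemma set_updates_ground:
  "set (updates (ground inc k x w t)) = set (concat (map (redge k t) [0..<k]))"
  unfolding updates_ground set_append set_gpass set_redges_round by auto

lemma distinct_updates_ground: "t < k \<Longrightarrow> distinct (updates (ground inc k x w t))"
  unfolding updates_ground by (auto simp: distinct_gpass set_gpass)

text \<open>A round permutes the predicted edges of that round, so its length follows from equality
  of the sets; the two complementary passes need not be counted separately.\<close>

lemma length_updates_ground: "t < k \<Longrightarrow> length (updates (ground inc k x w t)) = 2 * k"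
  using distinct_card[OF distinct_updates_ground] distinct_card[OF distinct_redges_round]
    set_updates_ground length_redges_round by metis

lemma redges_round_disjoint: "t < k \<Longrightarrow> t' < k \<Longrightarrow> t \<noteq> t' \<Longrightarrow>
    set (concat (map (redge k t) [0..<k])) \<inter> set (concat (map (redge k t') [0..<k])) = {}"
  unfolding set_redges_round by auto

lemma medges_redges_disjoint: "set (medges k mb) \<inter> set (redges k) = {}"
  unfolding set_medges redges_def by (auto simp: medge_def redge_def split: if_splits)

lemma distinct_redges: "distinct (redges k)"
  unfolding redges_def
  by (intro distinct_concat_upt distinct_redges_round redges_round_disjoint)

lemma length_redges: "length (redges k) = 2 * k * k"
  unfolding redges_def by (simp add: length_concat comp_def redge_def sum_list_triv)

lemma length_gehat: "length (gehat inc k mb) = 3 * k * k"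
  unfolding gehat_def by (simp add: length_medges length_redges)

definition grounds_updates :: "bool \<Rightarrow> nat \<Rightarrow> bool_matrix \<Rightarrow> bool_matrix \<Rightarrow> edge list" where
  "grounds_updates inc k x w = concat (map (\<lambda>t. updates (ground inc k x w t)) [0..<k])"

lemma updates_gops: "updates (gops inc k mb x w) =
    (if inc then medges k mb @ grounds_updates inc k x w else grounds_updates inc k x w @ medges k mb)"
  unfolding gops_def ginit_def grounds_updates_def by (simp add: updates_concat comp_def)

lemma set_grounds_updates: "set (grounds_updates inc k x w) = set (redges k)"
proof -
  have "set (grounds_updates inc k x w) = (\<Union>t<k. set (updates (ground inc k x w t)))"
    unfolding grounds_updates_def by auto
  also have "\<dots> = (\<Union>t<k. set (concat (map (redge k t) [0..<k])))"
    by (simp only: set_updates_ground)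
  also have "\<dots> = set (redges k)" unfolding redges_def by auto
  finally show ?thesis .
qed

lemma distinct_grounds_updates: "distinct (grounds_updates inc k x w)"
  unfolding grounds_updates_def
proof (rule distinct_concat_upt)
  fix i j assume "i < k" "j < k" "i \<noteq> j"
  then show "set (updates (ground inc k x w i)) \<inter> set (updates (ground inc k x w j)) = {}"
    unfolding set_updates_ground by (rule redges_round_disjoint)
qed (rule distinct_updates_ground)

text \<open>Order inside a round is arbitrary, but rounds have equal length and stay aligned. The
  displacement is therefore at most the length \<open>2 * k\<close> of a round.\<close>

lemma near_rounds: "near (2 * k) (redges k) (grounds_updates inc k x w)"
  unfolding grounds_updates_def redges_def
proof (rule near_concat_upt)
  fix t assume "t < k"
  then show "near (2 * k) (concat (map (redge k t) [0..<k])) (updates (ground inc k x w t))"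
    by (intro near_length) (simp_all only: length_redges_round length_updates_ground)
qed (simp_all only: set_updates_ground redges_round_disjoint not_False_eq_True)

lemma gops_eta: "eta_inf (gehat inc k mb) (updates (gops inc k mb x w)) \<le> 2 * k"
  unfolding gehat_def updates_gops
  by (intro eta_inf_le_near)
     (use medges_redges_disjoint[of k mb] in \<open>auto simp: set_grounds_updates distinct_grounds_updates
        distinct_medges distinct_redges intro!: near_append near_rounds near_refl\<close>)

lemma gops_queries: "Query s t \<in> set (gops inc k mb x w) \<Longrightarrow> \<exists>r<k. s = 3 * k + r \<and> t = 4 * k + r"
  unfolding gops_def ginit_def ground_def by (auto split: if_splits)

lemma gops_instance: "tc_instance (5 * k) (gehat inc k mb) (gops inc k mb x w)"
  unfolding tc_instance_def
proof (intro conjI allI impI)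
  show "distinct (gehat inc k mb)"
    using medges_redges_disjoint[of k mb] by (auto simp: gehat_def distinct_medges distinct_redges)
  show "distinct (updates (gops inc k mb x w))"
    using medges_redges_disjoint[of k mb]
    by (auto simp: updates_gops distinct_medges distinct_grounds_updates set_grounds_updates)
  show "set (updates (gops inc k mb x w)) = set (gehat inc k mb)"
    by (auto simp: updates_gops gehat_def set_grounds_updates)
  have "set (medges k mb) \<subseteq> {..<5 * k} \<times> {..<5 * k}" by (auto simp: set_medges medge_def)
  moreover have "set (redges k) \<subseteq> {..<5 * k} \<times> {..<5 * k}" by (auto simp: redges_def redge_def)
  ultimately show "set (gehat inc k mb) \<subseteq> {..<5 * k} \<times> {..<5 * k}" by (auto simp: gehat_def)
qed (drule gops_queries, force)+

lemma gadget_reach: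
  assumes t: "t < k" and X: "X \<subseteq> {(a, b). \<exists>t'<k. \<exists>j<k. t' \<noteq> t \<and> (a, b) \<in> set (redge k t' j)}"
    and G: "G = set (medges k mb) \<union> X \<union> {(3 * k + t, j) |j. j < k \<and> u j} \<union> {(k + j, 4 * k + t) |j. j < k \<and> w j}"
  shows "(3 * k + t, 4 * k + t) \<in> G\<^sup>* \<longleftrightarrow> (\<exists>i<k. \<exists>j<k. u i \<and> mb i j \<and> w j)"
proof
  assume "\<exists>i<k. \<exists>j<k. u i \<and> mb i j \<and> w j"
  then obtain i j where ij: "i < k" "j < k" "u i" "mb i j" "w j" by blast
  have "(3 * k + t, i) \<in> G" "(k + j, 4 * k + t) \<in> G" using ij G by auto
  moreover have "(i, k + j) \<in> set (medges k mb)"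
    unfolding set_medges using ij by (force simp: medge_def)
  ultimately show "(3 * k + t, 4 * k + t) \<in> G\<^sup>*" using G by (meson UnI1 converse_rtrancl_into_rtrancl r_into_rtrancl)
next
  assume "(3 * k + t, 4 * k + t) \<in> G\<^sup>*"
  define R where "R y \<longleftrightarrow> y = 3 * k + t \<or> (y < k \<and> u y) \<or> (\<exists>j<k. y = k + j \<and> (\<exists>i<k. u i \<and> mb i j))
     \<or> (2 * k \<le> y \<and> y < 3 * k) \<or> (4 * k \<le> y \<and> (y = 4 * k + t \<longrightarrow> (\<exists>i<k. \<exists>j<k. u i \<and> mb i j \<and> w j)))" for y
  have step: "R z" if R: "R y" and e: "(y, z) \<in> G" for y z
  proof -
    consider (m) i j where "i < k" "j < k" "(y, z) = medge k mb i j"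
      | (x) t' j where "t' < k" "j < k" "t' \<noteq> t" "(y, z) \<in> set (redge k t' j)"
      | (u) j where "j < k" "u j" "y = 3 * k + t" "z = j"
      | (w) j where "j < k" "w j" "y = k + j" "z = 4 * k + t"
      using e X unfolding G set_medges by blast
    then show ?thesis
    proof cases
      case m
      then have "y = i" "u i" using R t by (auto simp: R_def medge_def)
      then show ?thesis using m by (auto simp: R_def medge_def)
    next
      case x
      then show ?thesis using R t by (auto simp: R_def redge_def)
    next
      case u
      then show ?thesis by (auto simp: R_def)
    next
      case w
      then have "\<exists>i<k. u i \<and> mb i j" using R t by (auto simp: R_def)
      then show ?thesis using w by (auto simp: R_def)
    qed
  qed
  have "R (3 * k + t)" by (simp add: R_def)
  with \<open>(3 * k + t, 4 * k + t) \<in> G\<^sup>*\<close> have "R (4 * k + t)"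
    by (induction rule: rtrancl_induct) (auto intro: step)
  then show "\<exists>i<k. \<exists>j<k. u i \<and> mb i j \<and> w j" using t by (auto simp: R_def)
qed

section \<open>The graph at the time of a query\<close>

definition gprefix :: "bool \<Rightarrow> nat \<Rightarrow> bool_matrix \<Rightarrow> bool_matrix \<Rightarrow> bool_matrix \<Rightarrow> nat \<Rightarrow> operation list" where
  "gprefix inc k mb x w t = ginit inc k mb @ concat (map (ground inc k x w) [0..<t])"

lemma gprefix_Suc: "gprefix inc k mb x w (Suc t) = gprefix inc k mb x w t @ ground inc k x w t"
  unfolding gprefix_def by simp

lemma gops_split: "t < k \<Longrightarrow> \<exists>suf. gops inc k mb x w = gprefix inc k mb x w t @ ground inc k x w t @ suf"
  unfolding gops_def gprefix_def by (subst concat_map_upt_split[of t]) auto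

text \<open>Roles: \<open>p\<close> past rounds, \<open>c\<close> the current one, \<open>x\<close>
  future ones, \<open>m\<close> block edges, \<open>g\<close> the pass just made.\<close>

lemma diff_partition:
  assumes "c \<inter> p = {}" "x \<inter> p = {}" "x \<inter> g = {}" "m \<inter> p = {}" "m \<inter> g = {}"
  shows "(p \<union> c \<union> x \<union> m) - (p \<union> g) = m \<union> x \<union> (c - g)"
  using assms by auto

text \<open>For insertions the foreign edges are those of past rounds, already complete; for
  deletions those of future rounds, still untouched. In both cases the first pass leaves exactly the
  wanted edges of round \<open>t\<close>, either inserted or spared, so one lemma about reachability
  settles both problems.\<close>

lemma gadget_graph:
  assumes t: "t < k"
  shows "(3 * k + t, 4 * k + t) \<in> (tc_graph inc (gehat inc k mb)
      (gprefix inc k mb x w t @ map Update (gpass k x w t (\<not> inc))))\<^sup>*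
    \<longleftrightarrow> (\<exists>i<k. \<exists>j<k. \<not> x t i \<and> mb i j \<and> w t j)"
proof -
  have pre: "set (concat (map (\<lambda>t. updates (ground inc k x w t)) [0..<t])) = (\<Union>t'<t. set (concat (map (redge k t') [0..<k])))"
  proof -
    have "set (concat (map (\<lambda>t. updates (ground inc k x w t)) [0..<t])) = (\<Union>t'<t. set (updates (ground inc k x w t')))"
      by auto
    then show ?thesis by (simp only: set_updates_ground)
  qed
  have all: "set (redges k) = (\<Union>t'<k. set (concat (map (redge k t') [0..<k])))"
    by (auto simp: redges_def)
  show ?thesis
  proof (cases inc)
    case True
    show ?thesis
    proof (rule gadget_reach[OF t])
      show "(\<Union>t'<t. set (concat (map (redge k t') [0..<k]))) \<subseteq>
          {(a, b). \<exists>t'<k. \<exists>j<k. t' \<noteq> t \<and> (a, b) \<in> set (redge k t' j)}"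
        using t by (auto simp: Bex_def) (metis less_imp_neq less_trans nat_neq_iff)+
      show "tc_graph inc (gehat inc k mb) (gprefix inc k mb x w t @ map Update (gpass k x w t (\<not> inc)))
        = set (medges k mb) \<union> (\<Union>t'<t. set (concat (map (redge k t') [0..<k]))) \<union>
          {(3 * k + t, j) |j. j < k \<and> \<not> x t j} \<union> {(k + j, 4 * k + t) |j. j < k \<and> w t j}"
        using True
        by (simp add: tc_graph_def incremental_graph_def gprefix_def ginit_def updates_concat comp_def
            set_gpass pre[simplified True] Un_assoc del: set_concat)
    qed
  next
    case False
    let ?X = "\<Union>t'\<in>{t<..<k}. set (concat (map (redge k t') [0..<k]))"
    have *: "set (redges k) = (\<Union>t'<t. set (concat (map (redge k t') [0..<k]))) \<union>
        set (concat (map (redge k t) [0..<k])) \<union> ?X"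
    proof -
      have "{..<k} = {..<t} \<union> {t} \<union> {t<..<k}" using t by auto
      then show ?thesis unfolding all by (simp add: Un_ac)
    qed
    have dj: "set (concat (map (redge k t) [0..<k])) \<inter> (\<Union>t'<t. set (concat (map (redge k t') [0..<k]))) = {}"
      unfolding set_redges_round using t by auto
    have dj2: "?X \<inter> (\<Union>t'<t. set (concat (map (redge k t') [0..<k]))) = {}"
      unfolding set_redges_round using t by auto
    have dj3: "?X \<inter> set (gpass k x w t (\<not> inc)) = {}"
      unfolding set_redges_round set_gpass using t by auto
    have dj4: "set (medges k mb) \<inter> (\<Union>t'<t. set (concat (map (redge k t') [0..<k]))) = {}"
      "set (medges k mb) \<inter> set (gpass k x w t (\<not> inc)) = {}"
      unfolding set_redges_round set_gpass set_medges medge_def using t by (auto split: if_splits)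
    have split: "set (concat (map (redge k t) [0..<k])) - set (gpass k x w t (\<not> inc)) =
       {(3 * k + t, j) |j. j < k \<and> \<not> x t j} \<union> {(k + j, 4 * k + t) |j. j < k \<and> w t j}"
      unfolding set_redges_round set_gpass using t False by auto
    show ?thesis
    proof (rule gadget_reach[OF t])
      show "?X \<subseteq> {(a, b). \<exists>t'<k. \<exists>j<k. t' \<noteq> t \<and> (a, b) \<in> set (redge k t' j)}"
        using t by (auto simp: Bex_def) (metis less_imp_neq less_trans nat_neq_iff)+
      have "tc_graph inc (gehat inc k mb) (gprefix inc k mb x w t @ map Update (gpass k x w t (\<not> inc)))
        = (set (redges k) \<union> set (medges k mb)) - ((\<Union>t'<t. set (concat (map (redge k t') [0..<k]))) \<union> set (gpass k x w t (\<not> inc)))"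
        using False pre
        by (simp add: tc_graph_def decremental_graph_def gprefix_def ginit_def updates_concat comp_def gehat_def)
      also have "\<dots> = set (medges k mb) \<union> ?X \<union> (set (concat (map (redge k t) [0..<k])) - set (gpass k x w t (\<not> inc)))"
        unfolding * by (rule diff_partition[OF dj dj2 dj3 dj4])
      finally show "tc_graph inc (gehat inc k mb) (gprefix inc k mb x w t @ map Update (gpass k x w t (\<not> inc)))
        = set (medges k mb) \<union> ?X \<union>
          {(3 * k + t, j) |j. j < k \<and> \<not> x t j} \<union> {(k + j, 4 * k + t) |j. j < k \<and> w t j}"
        unfolding split by (simp only: Un_assoc)
    qed
  qed
qed

section \<open>The cost of one gadget sequence\<close>

lemma sum_list_operation_bound_updates:
  "sum_list (map (operation_bound \<epsilon> n \<eta>) ops) = real (length (updates ops)) * real n powr (1 - \<epsilon>)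
     + real (length ops - length (updates ops)) * real (max 1 \<eta>) powr (2 - \<epsilon>)"
proof (induction ops rule: updates.induct)
  case (3 s t ops)
  have "length (updates ops) \<le> length ops" by (induction ops rule: updates.induct) auto
  then show ?case using 3 by (simp add: algebra_simps Suc_diff_le)
qed (auto simp: algebra_simps)

lemma length_gops: "length (gops inc k mb x w) = 3 * k * k + k"
proof -
  have r: "length (ground inc k x w t) = 2 * k + 1" if "t < k" for t
    using length_updates_ground[OF that, of inc x w] unfolding updates_ground ground_def by simp
  have "length (concat (map (ground inc k x w) [0..<k])) = sum_list (map (\<lambda>t. length (ground inc k x w t)) [0..<k])"
    by (simp add: length_concat comp_def)
  also have "\<dots> = sum_list (map (\<lambda>t. 2 * k + 1) [0..<k])"
    by (rule arg_cong[where f = sum_list], rule map_cong) (auto simp: r)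
  finally show ?thesis
    by (simp add: gops_def ginit_def length_medges sum_list_triv algebra_simps)
qed

text \<open>There are \<open>3 * k * k\<close> updates on \<open>5 * k\<close> vertices, giving 15
  k^(3-\<epsilon>), and \<open>k\<close> queries at error at most \<open>2 * k\<close>, giving 4
  k^(3-\<epsilon>). The bounds for the two kinds of operations thus have the same order.\<close>

lemma gops_bound:
  assumes "0 < \<epsilon>" "\<epsilon> \<le> 1" "1 \<le> k"
  shows "sum_list (map (operation_bound \<epsilon> (5 * k) (eta_inf (gehat inc k mb) (updates (gops inc k mb x w)))) (gops inc k mb x w))
    \<le> 19 * real k powr (3 - \<epsilon>)"
proof -
  let ?\<eta> = "eta_inf (gehat inc k mb) (updates (gops inc k mb x w))"
  have lu: "length (updates (gops inc k mb x w)) = 3 * k * k"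
    using gops_instance[of k inc mb x w] length_gehat[of inc k mb] unfolding tc_instance_def
    by (metis distinct_card)
  have k0: "real k > 0" using assms by simp
  have 1: "real (5 * k) powr (1 - \<epsilon>) \<le> 5 * real k powr (1 - \<epsilon>)"
  proof -
    have "(5::real) powr (1 - \<epsilon>) \<le> 5 powr 1" using assms by (intro powr_mono) auto
    then show ?thesis using k0 by (simp add: powr_mult mult_right_mono)
  qed
  have 2: "real (max 1 ?\<eta>) powr (2 - \<epsilon>) \<le> 4 * real k powr (2 - \<epsilon>)"
  proof -
    have "real (max 1 ?\<eta>) powr (2 - \<epsilon>) \<le> real (2 * k) powr (2 - \<epsilon>)"
      using gops_eta[of inc k mb x w] assms by (intro powr_mono2) auto
    also have "\<dots> = 2 powr (2 - \<epsilon>) * real k powr (2 - \<epsilon>)" using k0 by (simp add: powr_mult)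
    also have "(2::real) powr (2 - \<epsilon>) \<le> 2 powr 2" using assms by (intro powr_mono) auto
    finally show ?thesis using k0 by (simp add: mult_right_mono)
  qed
  have e1: "real k * real k * real k powr (1 - \<epsilon>) = real k powr (3 - \<epsilon>)"
    using k0 by (simp add: powr_diff powr_numeral power3_eq_cube field_simps)
  have e2: "real k * real k powr (2 - \<epsilon>) = real k powr (3 - \<epsilon>)"
    using k0 by (simp add: powr_diff powr_numeral power3_eq_cube power2_eq_square field_simps)
  have "sum_list (map (operation_bound \<epsilon> (5 * k) ?\<eta>) (gops inc k mb x w))
     = real (3 * k * k) * real (5 * k) powr (1 - \<epsilon>) + real k * real (max 1 ?\<eta>) powr (2 - \<epsilon>)"
    unfolding sum_list_operation_bound_updates lu length_gops by simp
  also have "\<dots> \<le> real (3 * k * k) * (5 * real k powr (1 - \<epsilon>)) + real k * (4 * real k powr (2 - \<epsilon>))"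
    by (intro add_mono mult_left_mono 1 2) auto
  also have "\<dots> = 15 * (real k * real k * real k powr (1 - \<epsilon>)) + 4 * (real k * real k powr (2 - \<epsilon>))" by simp
  also have "\<dots> = 19 * real k powr (3 - \<epsilon>)" unfolding e1 e2 by simp
  finally show ?thesis .
qed

section \<open>Memory layout and weakest preconditions\<close>

text \<open>Eight arrays interleaved by residue modulo 8: none needs a size in advance, and writing
  one leaves the others unchanged as functions, so frame conditions become equations between values
  of \<open>arr\<close>.\<close>

definition addr :: "nat \<Rightarrow> nat \<Rightarrow> nat" where
  "addr t i = 8 * i + t"

definition arr :: "memory \<Rightarrow> nat \<Rightarrow> nat \<Rightarrow> nat" where
  "arr \<mu> t i = \<mu> (addr t i)"

lemma arr_upd_same [simp]: "arr (\<mu>(addr t i := y)) t = (arr \<mu> t)(i := y)"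
  by (auto simp: arr_def addr_def fun_eq_iff)

lemma addr_mod: "t < 8 \<Longrightarrow> addr t i mod 8 = t"
  by (simp add: addr_def)

lemma arr_upd_other [simp]: "t < 8 \<Longrightarrow> t' < 8 \<Longrightarrow> t \<noteq> t' \<Longrightarrow> arr (\<mu>(addr t i := y)) t' = arr \<mu> t'"
  by (auto simp: arr_def fun_eq_iff dest: arg_cong[where f = "\<lambda>x. x mod 8"] simp: addr_mod)

definition AddrX :: "nat \<Rightarrow> expr \<Rightarrow> expr" where
  "AddrX t e = Bin Add (Bin Mul (Const 8) e) (Const t)"

definition LoadX :: "nat \<Rightarrow> expr \<Rightarrow> expr" where
  "LoadX t e = Load (AddrX t e)"

definition LoadL :: "nat \<Rightarrow> nat \<Rightarrow> expr" where
  "LoadL t i = Load (Const (addr t i))"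

definition SetL :: "nat \<Rightarrow> nat \<Rightarrow> expr \<Rightarrow> com" where
  "SetL t i e = Store (Const (addr t i)) e"

definition SetX :: "nat \<Rightarrow> expr \<Rightarrow> expr \<Rightarrow> com" where
  "SetX t i e = Store (AddrX t i) e"

text \<open>The counter is a variable in array 0, the limit a parameter in array 6 that is read
  again at every test.\<close>

definition For :: "nat \<Rightarrow> nat \<Rightarrow> com \<Rightarrow> com" where
  "For x y c = Seq (SetL 0 x (Const 0))
     (While (Bin Lt (LoadL 0 x) (LoadL 6 y)) (Seq c (SetL 0 x (Bin Add (LoadL 0 x) (Const 1)))))"

text \<open>The clock \<open>a\<close> is threaded through like a state component, so that time bounds become
  invariants and amortisation is expressed by potentials. Only silent executions are described.\<close>

definition wp :: "nat \<Rightarrow> nat list \<Rightarrow> com \<Rightarrow> (memory \<Rightarrow> nat \<Rightarrow> bool) \<Rightarrow> memory \<Rightarrow> nat \<Rightarrow> bool" where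
  "wp W inp c \<Phi> \<mu> a \<longleftrightarrow> (\<exists>\<tau> \<mu>'. exec W inp c \<mu> \<tau> \<mu>' [] \<and> \<Phi> \<mu>' (a + \<tau>))"

lemma wp_mono: "wp W inp c \<Phi> \<mu> a \<Longrightarrow> (\<And>\<mu> a. \<Phi> \<mu> a \<Longrightarrow> \<Psi> \<mu> a) \<Longrightarrow> wp W inp c \<Psi> \<mu> a"
  unfolding wp_def by blast

lemma wp_Skip: "\<Phi> \<mu> (a + 1) \<Longrightarrow> wp W inp Skip \<Phi> \<mu> a"
  unfolding wp_def by (blast intro: exec.Skip)

lemma wp_Store: "eval W inp \<mu> e = Some x \<Longrightarrow> eval W inp \<mu> e' = Some y \<Longrightarrow>
    \<Phi> (\<mu>(x := y)) (a + 1) \<Longrightarrow> wp W inp (Store e e') \<Phi> \<mu> a"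
  unfolding wp_def by (blast intro: exec.Store)

lemma wp_Seq: "wp W inp c1 (wp W inp c2 \<Phi>) \<mu> a \<Longrightarrow> wp W inp (Seq c1 c2) \<Phi> \<mu> a"
  unfolding wp_def by (force simp: add.assoc dest: exec.Seq)

lemma wp_Seq': "wp W inp c1 \<Psi> \<mu> a \<Longrightarrow> (\<And>\<mu> a. \<Psi> \<mu> a \<Longrightarrow> wp W inp c2 \<Phi> \<mu> a) \<Longrightarrow> wp W inp (Seq c1 c2) \<Phi> \<mu> a"
  by (rule wp_Seq) (rule wp_mono)

lemma wp_Cond: "eval W inp \<mu> e = Some x \<Longrightarrow> (x \<noteq> 0 \<Longrightarrow> wp W inp c1 \<Phi> \<mu> (a + 1)) \<Longrightarrow>
    (x = 0 \<Longrightarrow> wp W inp c2 \<Phi> \<mu> (a + 1)) \<Longrightarrow> wp W inp (Cond e c1 c2) \<Phi> \<mu> a"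
  unfolding wp_def
  by (cases "x = 0") (fastforce simp: add.assoc dest: exec.Cond_True exec.Cond_False)+

lemma eval_LoadL: "addr t i < W \<Longrightarrow> arr \<mu> t i = x \<Longrightarrow> x < W \<Longrightarrow> eval W inp \<mu> (LoadL t i) = Some x"
  by (simp add: LoadL_def word_def arr_def)

lemma eval_Const: "x < W \<Longrightarrow> eval W inp \<mu> (Const x) = Some x"
  by (simp add: word_def)

lemma eval_Bin: "eval W inp \<mu> e = Some x \<Longrightarrow> eval W inp \<mu> e' = Some y \<Longrightarrow> binop_val f x y < W \<Longrightarrow>
    eval W inp \<mu> (Bin f e e') = Some (binop_val f x y)"
  by (simp add: word_def)

lemma eval_AddrX: "eval W inp \<mu> e = Some x \<Longrightarrow> t < 8 \<Longrightarrow> addr t x < W \<Longrightarrow> 8 < W \<Longrightarrow>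
    eval W inp \<mu> (AddrX t e) = Some (addr t x)"
  by (simp add: AddrX_def word_def addr_def)

lemma eval_LoadX: "eval W inp \<mu> e = Some x \<Longrightarrow> t < 8 \<Longrightarrow> addr t x < W \<Longrightarrow> 8 < W \<Longrightarrow> arr \<mu> t x = y \<Longrightarrow> y < W \<Longrightarrow>
    eval W inp \<mu> (LoadX t e) = Some y"
  by (simp add: LoadX_def eval_AddrX word_def arr_def)

lemma wp_SetL: "addr t i < W \<Longrightarrow> eval W inp \<mu> e = Some y \<Longrightarrow> \<Phi> (\<mu>(addr t i := y)) (a + 1) \<Longrightarrow>
    wp W inp (SetL t i e) \<Phi> \<mu> a"
  unfolding SetL_def by (rule wp_Store[OF eval_Const])

lemma wp_SetX: "eval W inp \<mu> i = Some x \<Longrightarrow> t < 8 \<Longrightarrow> addr t x < W \<Longrightarrow> 8 < W \<Longrightarrow>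
    eval W inp \<mu> e = Some y \<Longrightarrow> \<Phi> (\<mu>(addr t x := y)) (a + 1) \<Longrightarrow> wp W inp (SetX t i e) \<Phi> \<mu> a"
  unfolding SetX_def by (rule wp_Store[OF eval_AddrX])

text \<open>The invariant describes the state just before a test. The clock offsets count the test
  before the body and the increment after it, plus initialisation and final test: \<open>m\<close>
  iterations add \<open>2 * m + 2\<close> steps.\<close>

lemma wp_For:
  assumes init: "I 0 (\<mu>(addr 0 x := 0)) (a + 1)"
    and step: "\<And>i \<mu> a. i < m \<Longrightarrow> I i \<mu> a \<Longrightarrow> arr \<mu> 0 x = i \<Longrightarrow>
      wp W inp c (\<lambda>\<mu>' a'. arr \<mu>' 0 x = i \<and> I (Suc i) (\<mu>'(addr 0 x := Suc i)) (a' + 1)) \<mu> (a + 1)"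
    and bound: "\<And>i \<mu> a. i \<le> m \<Longrightarrow> I i \<mu> a \<Longrightarrow> arr \<mu> 6 y = m"
    and final: "\<And>\<mu> a. I m \<mu> a \<Longrightarrow> \<Phi> \<mu> (a + 1)"
    and W: "m < W" "addr 0 x < W" "addr 6 y < W" "1 < W"
  shows "wp W inp (For x y c) \<Phi> \<mu> a"
proof -
  let ?w = "While (Bin Lt (LoadL 0 x) (LoadL 6 y)) (Seq c (SetL 0 x (Bin Add (LoadL 0 x) (Const 1))))"
  have loop: "wp W inp ?w \<Phi> \<mu> a" if "i \<le> m" "I i \<mu> a" "arr \<mu> 0 x = i" for i \<mu> a
    using that
  proof (induction "m - i" arbitrary: i \<mu> a)
    case 0
    then have "i = m" by simp
    have "eval W inp \<mu> (Bin Lt (LoadL 0 x) (LoadL 6 y)) = Some (binop_val Lt i m)"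
      by (intro eval_Bin eval_LoadL) (use 0 W bound in auto)
    then have "exec W inp ?w \<mu> 1 \<mu> []" using \<open>i = m\<close> by (intro exec.While_False) auto
    moreover have "\<Phi> \<mu> (a + 1)" using final 0 \<open>i = m\<close> by simp
    ultimately show ?case unfolding wp_def by blast
  next
    case (Suc d)
    then have im: "i < m" by simp
    have e: "eval W inp \<mu> (Bin Lt (LoadL 0 x) (LoadL 6 y)) = Some (binop_val Lt i m)"
      by (intro eval_Bin eval_LoadL) (use Suc.prems W bound in auto)
    obtain \<tau>1 \<mu>1 where 1: "exec W inp c \<mu> \<tau>1 \<mu>1 []" "arr \<mu>1 0 x = i"
      "I (Suc i) (\<mu>1(addr 0 x := Suc i)) (a + 1 + \<tau>1 + 1)"
      using step[OF im Suc.prems(2,3)] unfolding wp_def by auto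
    have 2: "exec W inp (SetL 0 x (Bin Add (LoadL 0 x) (Const 1))) \<mu>1 1 (\<mu>1(addr 0 x := Suc i)) []"
      unfolding SetL_def
    proof (rule exec.Store)
      have "eval W inp \<mu>1 (Bin Add (LoadL 0 x) (Const 1)) = Some (binop_val Add i 1)"
        by (intro eval_Bin eval_LoadL eval_Const) (use 1 W im in auto)
      then show "eval W inp \<mu>1 (Bin Add (LoadL 0 x) (Const 1)) = Some (Suc i)" by simp
    qed (use W in \<open>simp add: word_def\<close>)
    have "wp W inp ?w \<Phi> (\<mu>1(addr 0 x := Suc i)) (a + 1 + \<tau>1 + 1)"
      by (rule Suc.hyps(1)[of "Suc i"]) (use Suc im 1 in auto)
    then obtain \<tau>2 \<mu>2 where 3: "exec W inp ?w (\<mu>1(addr 0 x := Suc i)) \<tau>2 \<mu>2 []"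
      "\<Phi> \<mu>2 (a + 1 + \<tau>1 + 1 + \<tau>2)" unfolding wp_def by blast
    have "exec W inp ?w \<mu> (1 + (\<tau>1 + 1) + \<tau>2) \<mu>2 ([] @ [])"
      by (rule exec.While_True[OF e _ _ 3(1)]) (use im exec.Seq[OF 1(1) 2] in auto)
    then show ?case using 3(2) unfolding wp_def by (auto simp: ac_simps intro!: exI)
  qed
  have "wp W inp ?w \<Phi> (\<mu>(addr 0 x := 0)) (a + 1)" by (rule loop[of 0]) (use init in auto)
  then show ?thesis
    unfolding For_def using W by (intro wp_Seq wp_SetL[where y = 0]) (auto simp: word_def)
qed

section \<open>Simulating a program inside a memory region\<close>

text \<open>The offset of the current copy is read from variable 10 at run time, so one compiled
  program serves all copies.\<close>

fun simE :: "expr \<Rightarrow> expr" where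
  "simE (Const c) = Const c"
| "simE (Load e) = LoadX 5 (Bin Add (LoadL 0 10) (simE e))"
| "simE (Input e) = LoadX 4 (simE e)"
| "simE (Bin f e e') = Bin f (simE e) (simE e')"

text \<open>Commands correspond one to one, so running times are preserved exactly. Only the last
  emitted word is kept: a correct query emits a single word, and the output of the other programs is
  never consulted.\<close>

fun sim :: "com \<Rightarrow> com" where
  "sim Skip = Skip"
| "sim (Store e e') = SetX 5 (Bin Add (LoadL 0 10) (simE e)) (simE e')"
| "sim (Emit e) = SetL 7 0 (simE e)"
| "sim (Seq c c') = Seq (sim c) (sim c')"
| "sim (Cond e c c') = Cond (simE e) (sim c) (sim c')"
| "sim (While e c) = While (simE e) (sim c)"

text \<open>Copy \<open>c\<close> owns the cells from \<open>c * S\<close> on. A program whose words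
  are below \<open>S\<close> cannot form an address outside its \<open>S\<close> cells;
  \<open>R\<close> describes the rest of the array.\<close>

definition region :: "nat \<Rightarrow> nat \<Rightarrow> memory \<Rightarrow> (nat \<Rightarrow> nat) \<Rightarrow> nat \<Rightarrow> nat" where
  "region S c \<nu> R z = (if z div S = c then \<nu> (z mod S) else R z)"

lemma region_at: "x < S \<Longrightarrow> region S c \<nu> R (c * S + x) = \<nu> x"
  by (simp add: region_def)

lemma region_upd: "x < S \<Longrightarrow> (region S c \<nu> R)(c * S + x := y) = region S c (\<nu>(x := y)) R"
  by (auto simp: region_def fun_eq_iff)

text \<open>\<open>F\<close> freezes the arrays the simulation must not touch. Array 4 may hold
  leftovers beyond the input, but the simulated run exists, so it never reads past
  \<open>inp\<close>.\<close>

locale sim_setup =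
  fixes W S c :: nat and inp inp' :: "nat list" and F :: "nat \<Rightarrow> nat \<Rightarrow> nat" and R :: "nat \<Rightarrow> nat"
  assumes base: "F 0 10 = c * S"
    and input: "\<And>i. i < length inp \<Longrightarrow> F 4 i = inp ! i"
    and W: "8 * ((c + 1) * S) + 100 \<le> W"
begin

definition rel :: "memory \<Rightarrow> memory \<Rightarrow> bool" where
  "rel \<mu> \<nu> \<longleftrightarrow> arr \<mu> 5 = region S c \<nu> R \<and> (\<forall>t<8. t \<noteq> 5 \<and> t \<noteq> 7 \<longrightarrow> arr \<mu> t = F t)"

lemma word_S: "x < S \<Longrightarrow> x < W" "x < S \<Longrightarrow> addr 4 x < W" "x < S \<Longrightarrow> addr 5 (c * S + x) < W"
  "x < S \<Longrightarrow> c * S + x < W"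
  "addr 7 0 < W" "addr 0 10 < W" "8 < W"
  using W by (auto simp: addr_def)

lemma eval_base: "rel \<mu> \<nu> \<Longrightarrow> eval W inp' \<mu> (LoadL 0 10) = Some (c * S)"
  by (rule eval_LoadL) (use W base in \<open>auto simp: rel_def addr_def\<close>)

text \<open>The bound \<open>x < S\<close> is carried through the induction because it keeps
  computed addresses within the region of the copy.\<close>

lemma eval_simE: "rel \<mu> \<nu> \<Longrightarrow> eval S inp \<nu> e = Some x \<Longrightarrow> eval W inp' \<mu> (simE e) = Some x \<and> x < S"
proof (induction e arbitrary: x)
  case (Const k)
  then show ?case using word_S by (auto simp: word_def split: if_splits)
next
  case (Load e)
  then obtain z where z: "eval S inp \<nu> e = Some z" "x = \<nu> z" "x < S"
    by (auto simp: word_def split: option.splits if_splits)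
  then have z': "eval W inp' \<mu> (simE e) = Some z" "z < S" using Load by auto
  have "eval W inp' \<mu> (Bin Add (LoadL 0 10) (simE e)) = Some (binop_val Add (c * S) z)"
    by (intro eval_Bin eval_base z') (use Load z' word_S in auto)
  then have "eval W inp' \<mu> (simE (Load e)) = Some x"
    unfolding simE.simps by (intro eval_LoadX[where x = "c * S + z"])
      (use Load.prems z z' word_S in \<open>auto simp: rel_def region_at\<close>)
  then show ?case using z by simp
next
  case (Input e)
  then obtain z where z: "eval S inp \<nu> e = Some z" "z < length inp" "x = inp ! z" "x < S"
    by (auto simp: word_def split: option.splits if_splits)
  then have z': "eval W inp' \<mu> (simE e) = Some z" "z < S" using Input by auto
  have "eval W inp' \<mu> (simE (Input e)) = Some x"
    unfolding simE.simps by (intro eval_LoadX[where x = z])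
      (use Input.prems z z' word_S input in \<open>auto simp: rel_def\<close>)
  then show ?case using z by simp
next
  case (Bin f e e')
  then obtain y z where yz: "eval S inp \<nu> e = Some y" "eval S inp \<nu> e' = Some z" "x = binop_val f y z" "x < S"
    by (auto simp: word_def split: option.splits if_splits)
  then have "eval W inp' \<mu> (simE (Bin f e e')) = Some (binop_val f y z)"
    unfolding simE.simps by (intro eval_Bin) (use Bin word_S in auto)
  then show ?case using yz by simp
qed

lemma rel_Store: "rel \<mu> \<nu> \<Longrightarrow> x < S \<Longrightarrow> rel (\<mu>(addr 5 (c * S + x) := y)) (\<nu>(x := y))"
  by (auto simp: rel_def region_upd)

lemma exec_sim: "exec S inp p \<nu> \<tau> \<nu>' out \<Longrightarrow> rel \<mu> \<nu> \<Longrightarrow>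
  \<exists>\<mu>'. exec W inp' (sim p) \<mu> \<tau> \<mu>' [] \<and> rel \<mu>' \<nu>' \<and> arr \<mu>' 7 0 = (if out = [] then arr \<mu> 7 0 else last out)"
proof (induction arbitrary: \<mu> rule: exec.induct)
  case (Skip \<nu>)
  then show ?case using exec.Skip by fastforce
next
  case (Store \<nu> e x e' y)
  have x: "eval W inp' \<mu> (simE e) = Some x" "x < S" and y: "eval W inp' \<mu> (simE e') = Some y"
    using eval_simE Store by blast+
  have "eval W inp' \<mu> (Bin Add (LoadL 0 10) (simE e)) = Some (binop_val Add (c * S) x)"
    by (intro eval_Bin eval_base x) (use Store x word_S in auto)
  then have "eval W inp' \<mu> (AddrX 5 (Bin Add (LoadL 0 10) (simE e))) = Some (addr 5 (c * S + x))"
    by (intro eval_AddrX) (use x word_S in auto)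
  then have "exec W inp' (sim (Store e e')) \<mu> 1 (\<mu>(addr 5 (c * S + x) := y)) []"
    unfolding sim.simps SetX_def using y by (rule exec.Store)
  then show ?case using rel_Store[OF Store.prems x(2)]
    by (intro exI[of _ "\<mu>(addr 5 (c * S + x) := y)"] conjI) (simp_all del: fun_upd_apply)
next
  case (Emit \<nu> e x)
  have x: "eval W inp' \<mu> (simE e) = Some x" using eval_simE Emit by blast
  have "exec W inp' (sim (Emit e)) \<mu> 1 (\<mu>(addr 7 0 := x)) []"
    unfolding sim.simps SetL_def by (rule exec.Store) (use x word_S in \<open>auto simp: word_def\<close>)
  moreover have "rel (\<mu>(addr 7 0 := x)) \<nu>" using Emit.prems by (auto simp: rel_def)
  ultimately show ?case by (intro exI[of _ "\<mu>(addr 7 0 := x)"] conjI) (simp_all del: fun_upd_apply add: fun_upd_same)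
next
  case (Seq c1 \<nu> \<tau>1 \<nu>1 out1 c2 \<tau>2 \<nu>2 out2)
  obtain \<mu>1 where 1: "exec W inp' (sim c1) \<mu> \<tau>1 \<mu>1 []" "rel \<mu>1 \<nu>1"
    "arr \<mu>1 7 0 = (if out1 = [] then arr \<mu> 7 0 else last out1)" using Seq by blast
  obtain \<mu>2 where 2: "exec W inp' (sim c2) \<mu>1 \<tau>2 \<mu>2 []" "rel \<mu>2 \<nu>2"
    "arr \<mu>2 7 0 = (if out2 = [] then arr \<mu>1 7 0 else last out2)" using Seq.IH(2)[OF 1(2)] by blast
  show ?case using exec.Seq[OF 1(1) 2(1)] 1 2 by (auto intro!: exI[of _ \<mu>2])
next
  case (Cond_True \<nu> e x c1 \<tau> \<nu>' out c2)
  then show ?case using eval_simE[OF Cond_True.prems Cond_True.hyps(1)]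
    by (fastforce intro: exec.Cond_True[simplified])
next
  case (Cond_False \<nu> e c2 \<tau> \<nu>' out c1)
  then show ?case using eval_simE[OF Cond_False.prems Cond_False.hyps(1)]
    by (fastforce intro: exec.Cond_False[simplified])
next
  case (While_False \<nu> e c)
  then show ?case using eval_simE[OF While_False.prems While_False.hyps(1)]
    by (fastforce intro: exec.While_False[simplified])
next
  case (While_True \<nu> e x c1 \<tau>1 \<nu>1 out1 \<tau>2 \<nu>2 out2)
  obtain \<mu>1 where 1: "exec W inp' (sim c1) \<mu> \<tau>1 \<mu>1 []" "rel \<mu>1 \<nu>1"
    "arr \<mu>1 7 0 = (if out1 = [] then arr \<mu> 7 0 else last out1)" using While_True by blast
  obtain \<mu>2 where 2: "exec W inp' (sim (While e c1)) \<mu>1 \<tau>2 \<mu>2 []" "rel \<mu>2 \<nu>2"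
    "arr \<mu>2 7 0 = (if out2 = [] then arr \<mu>1 7 0 else last out2)" using While_True.IH(2)[OF 1(2)] by blast
  have e: "eval W inp' \<mu> (simE e) = Some x" using eval_simE While_True by blast
  have "exec W inp' (sim (While e c1)) \<mu> (1 + \<tau>1 + \<tau>2) \<mu>2 []"
    using exec.While_True[OF e While_True.hyps(2) 1(1), of \<tau>2 \<mu>2 "[]"] 2(1) by simp
  then show ?case using 1 2 by (auto intro!: exI[of _ \<mu>2])
qed

end

lemma wp_sim:
  assumes ex: "exec S inp p \<nu> \<tau> \<nu>' out"
    and base: "arr \<mu> 0 10 = c * S"
    and input: "\<And>i. i < length inp \<Longrightarrow> arr \<mu> 4 i = inp ! i"
    and W: "8 * ((c + 1) * S) + 100 \<le> W"
    and reg: "arr \<mu> 5 = region S c \<nu> R"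
    and post: "\<And>\<mu>'. arr \<mu>' 5 = region S c \<nu>' R \<Longrightarrow> (\<And>t. t < 8 \<Longrightarrow> t \<noteq> 5 \<Longrightarrow> t \<noteq> 7 \<Longrightarrow> arr \<mu>' t = arr \<mu> t) \<Longrightarrow>
      (out \<noteq> [] \<Longrightarrow> arr \<mu>' 7 0 = last out) \<Longrightarrow> \<Phi> \<mu>' (a + \<tau>)"
  shows "wp W inp' (sim p) \<Phi> \<mu> a"
proof -
  interpret sim_setup W S c inp inp' "arr \<mu>" R
    using base input W by unfold_locales auto
  have "rel \<mu> \<nu>" using reg by (simp add: rel_def)
  from exec_sim[OF ex this] obtain \<mu>' where "exec W inp' (sim p) \<mu> \<tau> \<mu>' []" "rel \<mu>' \<nu>'"
    "arr \<mu>' 7 0 = (if out = [] then arr \<mu> 7 0 else last out)" by blast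
  then show ?thesis unfolding wp_def using post[of \<mu>'] by (auto simp: rel_def)
qed

text \<open>Cuts a service into single executions with named intermediate memories. The simulation
  can then suspend a copy after any request, work on other copies and resume.\<close>

lemma serve_trace:
  "serve W \<mu> reqs res \<Longrightarrow> length res = length reqs \<and>
     (\<exists>ms. ms 0 = \<mu> \<and> (\<forall>i<length reqs. exec W (snd (reqs ! i)) (fst (reqs ! i)) (ms i) (fst (res ! i)) (ms (Suc i)) (snd (res ! i))))"
proof (induction rule: serve.induct)
  case (Cons inp c \<mu> \<tau> \<mu>' out reqs res)
  then obtain ms where ms: "ms 0 = \<mu>'" "\<forall>i<length reqs. exec W (snd (reqs ! i)) (fst (reqs ! i)) (ms i) (fst (res ! i)) (ms (Suc i)) (snd (res ! i))"
    by blast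
  have "\<forall>i<length ((c, inp) # reqs). exec W (snd (((c, inp) # reqs) ! i)) (fst (((c, inp) # reqs) ! i))
     ((case_nat \<mu> ms) i) (fst (((\<tau>, out) # res) ! i)) (case_nat \<mu> ms (Suc i)) (snd (((\<tau>, out) # res) ! i))"
    using ms Cons.hyps by (auto simp: less_Suc_eq_0_disj)
  then show ?case using Cons by (auto intro!: exI[of _ "case_nat \<mu> ms"])
qed (auto)

section \<open>The programs\<close>

text \<open>
  Arrays: 0 variables, 1 padded matrix, 2 padded vector, 3 result, 4 input of the simulated program,
  5 memories of all copies, 6 the parameters \<open>n\<close>, \<open>k\<close>, \<open>B\<close>, \<open>D\<close>, \<open>S\<close>, 7 last output of the simulated
  program. Variables: 2 to 4 index the copy (group of \<open>k\<close> vectors, block row, block column),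
  5 and 6 run over a block, 7 is the length of the input, 8 the round, 9 the number of vectors so
  far, 10 the offset of the current copy, 11 the answer of the last query.
\<close>

abbreviation addE :: "expr \<Rightarrow> expr \<Rightarrow> expr" (infixl "\<oplus>" 65) where "e \<oplus> e' \<equiv> Bin Add e e'"
abbreviation mulE :: "expr \<Rightarrow> expr \<Rightarrow> expr" (infixl "\<otimes>" 70) where "e \<otimes> e' \<equiv> Bin Mul e e'"

fun powE :: "expr \<Rightarrow> nat \<Rightarrow> expr" where
  "powE e 0 = Const 1"
| "powE e (Suc j) = e \<otimes> powE e j"

abbreviation nE where "nE \<equiv> LoadL 6 0"
abbreviation kE where "kE \<equiv> LoadL 6 1"
abbreviation BE where "BE \<equiv> LoadL 6 2"
abbreviation DE where "DE \<equiv> LoadL 6 3"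
abbreviation SE where "SE \<equiv> LoadL 6 4"
abbreviation var where "var x \<equiv> LoadL 0 x"

definition baseE :: expr where
  "baseE = ((var 2 \<otimes> BE \<oplus> var 3) \<otimes> BE \<oplus> var 4) \<otimes> SE"

definition matE :: expr where
  "matE = LoadX 1 ((var 3 \<otimes> kE \<oplus> var 5) \<otimes> DE \<oplus> (var 4 \<otimes> kE \<oplus> var 6))"

text \<open>Subtracting the entry times \<open>k\<close> from \<open>2 * k + j\<close> selects
  column or dummy without a branch.\<close>

definition tgtE :: expr where
  "tgtE = Bin Sub (Const 2 \<otimes> kE \<oplus> var 6) (matE \<otimes> kE)"

definition Push :: "expr \<Rightarrow> com" where
  "Push e = Seq (SetX 4 (var 7) e) (SetL 0 7 (var 7 \<oplus> Const 1))"

definition DoOp :: "com \<Rightarrow> expr \<Rightarrow> expr \<Rightarrow> com" where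
  "DoOp c e e' = Seq (SetL 4 0 e) (Seq (SetL 4 1 e') (sim c))"

definition PushM :: com where
  "PushM = For 5 1 (For 6 1 (Seq (Push (var 5)) (Push tgtE)))"

definition PushR :: com where
  "PushR = For 5 1 (For 6 1 (Seq (Push (Const 3 \<otimes> kE \<oplus> var 5)) (Seq (Push (var 6))
     (Seq (Push (kE \<oplus> var 6)) (Push (Const 4 \<otimes> kE \<oplus> var 5))))))"

text \<open>The pushes follow the order of \<open>gehat\<close>. For insertions the block edges are
  inserted here as well; for deletions they would follow the last round, and that suffix is never
  executed.\<close>

definition InitCopy :: "bool \<Rightarrow> com \<Rightarrow> com \<Rightarrow> com" where
  "InitCopy inc P U = Seq (SetL 0 10 baseE) (Seq (SetL 0 7 (Const 0))
     (Seq (Push (Const 5 \<otimes> kE)) (Seq (Push (Const 3 \<otimes> kE \<otimes> kE))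
     (Seq (if inc then Seq PushM PushR else Seq PushR PushM)
     (Seq (sim P) (if inc then For 5 1 (For 6 1 (DoOp U (var 5) tgtE)) else Skip))))))"

text \<open>The successor on the right expresses \<le> through the strict comparison of the
  machine.\<close>

definition cube_test :: expr where
  "cube_test = Bin Lt ((kE \<oplus> Const 1) \<otimes> (kE \<oplus> Const 1) \<otimes> (kE \<oplus> Const 1)) (nE \<oplus> Const 1)"

definition FindK_step :: com where
  "FindK_step = Cond cube_test (SetL 6 1 (kE \<oplus> Const 1)) Skip"

definition FindK :: com where
  "FindK = For 0 0 FindK_step"

definition copy_entry :: com where
  "copy_entry = SetX 1 (var 0 \<otimes> DE \<oplus> var 1) (Input (Const 1 \<oplus> (var 0 \<otimes> nE \<oplus> var 1)))"

definition OMv_prep :: "bool \<Rightarrow> nat \<Rightarrow> com \<Rightarrow> com \<Rightarrow> com" where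
  "OMv_prep inc \<kappa> P U = Seq (SetL 6 0 (Input (Const 0))) (Seq FindK
     (Seq (SetL 6 2 (Bin Quot nE kE \<oplus> Const 1)) (Seq (SetL 6 3 (BE \<otimes> kE))
     (Seq (SetL 6 4 (powE (Const 5 \<otimes> kE \<oplus> Const 2) \<kappa>))
     (Seq (For 0 0 (For 1 0 copy_entry))
       (For 2 2 (For 3 2 (For 4 2 (InitCopy inc P U)))))))))"

definition row_test :: "bool \<Rightarrow> expr" where
  "row_test b = Bin Eq (LoadX 3 (var 3 \<otimes> kE \<oplus> var 6)) (Const (of_bool b))"

definition col_test :: "bool \<Rightarrow> expr" where
  "col_test b = Bin Eq (LoadX 2 (var 4 \<otimes> kE \<oplus> var 6)) (Const (of_bool (\<not> b)))"

definition row_op :: "com \<Rightarrow> bool \<Rightarrow> com" where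
  "row_op U b = Cond (row_test b) (DoOp U (Const 3 \<otimes> kE \<oplus> var 8) (var 6)) Skip"

definition col_op :: "com \<Rightarrow> bool \<Rightarrow> com" where
  "col_op U b = Cond (col_test b) (DoOp U (kE \<oplus> var 6) (Const 4 \<otimes> kE \<oplus> var 8)) Skip"

definition Pass :: "com \<Rightarrow> bool \<Rightarrow> com" where
  "Pass U b = For 6 1 (Seq (row_op U b) (col_op U b))"

definition hit_test :: expr where
  "hit_test = matE \<otimes> LoadX 2 (var 4 \<otimes> kE \<oplus> var 6)"

definition brute_step :: com where
  "brute_step = Cond hit_test (SetX 3 (var 3 \<otimes> kE \<oplus> var 5) (Const 1)) Skip"

definition Brute :: com where
  "Brute = For 5 1 (For 6 1 brute_step)"

text \<open>The answer is saved in variable 11, because simulated updates may overwrite the output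
  cell. The search comes after the second pass, because it changes the result array, by which both
  passes choose their edges.\<close>

definition Block :: "bool \<Rightarrow> com \<Rightarrow> com \<Rightarrow> com" where
  "Block inc U Q = Seq (SetL 0 10 baseE) (Seq (Pass U (\<not> inc))
     (Seq (DoOp Q (Const 3 \<otimes> kE \<oplus> var 8) (Const 4 \<otimes> kE \<oplus> var 8)) (Seq (SetL 0 11 (LoadL 7 0))
     (Seq (Pass U inc) (Cond (var 11) Brute Skip)))))"

text \<open>Only the first \<open>n\<close> cells of array 2 are rewritten; those beyond keep the
  zeros of the initial memory and serve as padding.\<close>

definition OMv_body :: "bool \<Rightarrow> com \<Rightarrow> com \<Rightarrow> com" where
  "OMv_body inc U Q = Seq (For 0 0 (SetX 2 (var 0) (Input (var 0)))) (Seq (For 0 3 (SetX 3 (var 0) (Const 0)))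
     (Seq (SetL 0 2 (Bin Quot (var 9) kE)) (Seq (SetL 0 8 (Bin Rem (var 9) kE)) (Seq (SetL 0 9 (var 9 \<oplus> Const 1))
     (For 3 2 (For 4 2 (Block inc U Q)))))))"

text \<open>The output loop is split off because \<open>wp\<close> describes silent
  executions.\<close>

definition OMv_query :: "bool \<Rightarrow> com \<Rightarrow> com \<Rightarrow> com" where
  "OMv_query inc U Q = Seq (OMv_body inc U Q) (For 0 0 (Emit (LoadX 3 (var 0))))"

section \<open>Word bounds\<close>

lemma cube_root_exists: "\<exists>k::nat. k ^ 3 \<le> n \<and> n < (k + 1) ^ 3"
proof (induction n)
  case 0
  show ?case by (rule exI[of _ 0]) simp
next
  case (Suc n)
  then obtain k where k: "k ^ 3 \<le> n" "n < (k + 1) ^ 3" by blast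
  show ?case
  proof (cases "Suc n < (k + 1) ^ 3")
    case True
    then show ?thesis using k by (intro exI[of _ k]) auto
  next
    case False
    moreover have "(k + 1) ^ 3 < (k + 1 + 1) ^ 3" by (intro power_strict_mono) auto
    ultimately show ?thesis using k by (intro exI[of _ "k + 1"]) auto
  qed
qed

locale params =
  fixes \<kappa> n k :: nat
  assumes n1: "1 \<le> n" and k_le: "k ^ 3 \<le> n" and k_gt: "n < (k + 1) ^ 3"
begin

text \<open>Rounding up even when \<open>k\<close> divides \<open>n\<close> gives
  \<open>n < B * k\<close>. The same \<open>B\<close> counts block rows, block columns and groups of
  \<open>k\<close> vectors, so there are \<open>B * B * B\<close> copies.\<close>

definition "B = n div k + 1"
definition "D = B * k"
definition "S = (5 * k + 2) ^ \<kappa>"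
definition "H = n + 2"
text \<open>All sizes are measured as powers of \<open>H\<close>. The part
  \<open>3 * \<kappa>\<close> comes from the word bound \<open>S\<close> of the copies; 60 is
  generous room for copy numbers, constants and address computations.\<close>

definition "K = 3 * \<kappa> + 60"
definition "W = H ^ K"

lemma k1: "1 \<le> k" using k_gt n1 by (cases k) auto

lemma k_le_n: "k \<le> n"
  using k_le self_le_power[OF k1, of 3] by simp

lemma B_le: "B \<le> n + 1" unfolding B_def by simp

lemma Bk: "B * k \<le> 2 * n"
  using k_le_n by (simp add: B_def algebra_simps) (metis add_le_mono div_times_less_eq_dividend mult.commute mult_2)

lemma n_lt_D: "n < D"
proof -
  have "n < k + (n div k) * k" using k1 by (intro dividend_less_div_times) simp
  then show ?thesis by (simp add: D_def B_def algebra_simps)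
qed

lemma B1: "1 \<le> B" by (simp add: B_def)

lemma H3: "3 \<le> H" using n1 by (simp add: H_def)

lemma H_pow_ge: "3 ^ p \<le> H ^ p" using H3 by (rule power_mono) simp

lemma S_lt: "S < H ^ (3 * \<kappa> + 1)"
proof -
  have "5 * k + 2 \<le> 5 * n + 2" using k_le_n by simp
  also have "\<dots> \<le> (n + 2) * ((n + 2) * (n + 2))" by (simp add: algebra_simps)
  finally have "5 * k + 2 \<le> H ^ 3" by (simp add: H_def power3_eq_cube algebra_simps)
  then have "S \<le> (H ^ 3) ^ \<kappa>" unfolding S_def by (rule power_mono) simp
  also have "\<dots> < H ^ (3 * \<kappa> + 1)" using H3 by (simp add: power_mult)
  finally show ?thesis .
qed

lemma D_lt: "D < H ^ 2"
  using Bk by (simp add: D_def H_def power2_eq_square algebra_simps)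

lemma less_W: "x < H ^ p \<Longrightarrow> p \<le> K \<Longrightarrow> x < W"
  unfolding W_def using power_increasing[of p K H] H3 by (meson le_trans less_le_trans one_le_numeral)

text \<open>The limit 243 is 3^5, the smallest possible value of \<open>H ^ 5\<close>; hence
  constants count with exponent 5.\<close>

lemma const_W: "x < 243 \<Longrightarrow> x < W"
proof (rule less_W[of _ 5])
  assume "x < 243"
  then show "x < H ^ 5" using H_pow_ge[of 5] by simp
qed (simp add: K_def)

lemma add_bound: "x < H ^ p \<Longrightarrow> y < H ^ q \<Longrightarrow> x + y < H ^ (p + q + 1)"
proof -
  assume "x < H ^ p" "y < H ^ q"
  moreover have "H ^ p \<le> H ^ (p + q)" "H ^ q \<le> H ^ (p + q)" using H3 by (auto intro!: power_increasing)
  ultimately have "x + y < 2 * H ^ (p + q)" by linarith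
  also have "\<dots> \<le> H * H ^ (p + q)" using H3 by simp
  finally show ?thesis by simp
qed

lemma mul_bound: "x < H ^ p \<Longrightarrow> y < H ^ q \<Longrightarrow> x * y < H ^ (p + q)"
  unfolding power_add by (rule mult_strict_mono) (use H3 in auto)

lemma addr_bound: "x < H ^ p \<Longrightarrow> t < 8 \<Longrightarrow> p + 5 \<le> K \<Longrightarrow> addr t x < W"
proof -
  assume "x < H ^ p" and t: "t < 8" and p: "p + 5 \<le> K"
  then have "addr t x < 8 * (x + 1)" by (simp add: addr_def)
  also have "\<dots> \<le> 8 * H ^ p" using \<open>x < H ^ p\<close> by simp
  also have "\<dots> \<le> H ^ 5 * H ^ p" using H_pow_ge[of 5] by (intro mult_right_mono) auto
  finally have "addr t x < H ^ (p + 5)" by (simp add: power_add mult.commute)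
  then show ?thesis using p by (rule less_W)
qed

lemma region_W: "c < B * B * B \<Longrightarrow> 8 * ((c + 1) * S) + 100 \<le> W"
proof -
  assume c: "c < B * B * B"
  have "B \<le> H" using B_le by (simp add: H_def)
  then have "c + 1 \<le> H * H * H" using c mult_le_mono[OF mult_le_mono, of B H B H B H] by linarith
  then have "(c + 1) * S \<le> H ^ 3 * H ^ (3 * \<kappa> + 1)" using S_lt
    by (intro mult_le_mono) (auto simp: power3_eq_cube)
  then have "8 * ((c + 1) * S) \<le> H ^ 5 * (H ^ 3 * H ^ (3 * \<kappa> + 1))" using H_pow_ge[of 5]
    by (intro mult_le_mono[of 8 "H ^ 5"]) auto
  also have "\<dots> = H ^ (3 * \<kappa> + 9)"
  proof -
    have "5 + (3 + (3 * \<kappa> + 1)) = 3 * \<kappa> + 9" by simp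
    then show ?thesis by (simp only: power_add[symmetric])
  qed
  also have "\<dots> < H ^ (3 * \<kappa> + 10)" using H3 by (intro power_strict_increasing) auto
  finally have 1: "8 * ((c + 1) * S) < H ^ (3 * \<kappa> + 10)" .
  have 2: "100 < H ^ 5" using H_pow_ge[of 5] by simp
  show ?thesis using less_W[OF add_bound[OF 1 2]] by (simp add: K_def)
qed

text \<open>Evaluation together with a size exponent. Exponents add up along the syntax of an
  expression, which turns every overflow check into a numerical comparison with
  \<open>K\<close>.\<close>

definition evb :: "nat list \<Rightarrow> memory \<Rightarrow> expr \<Rightarrow> nat \<Rightarrow> nat \<Rightarrow> bool" where
  "evb inp \<mu> e x p \<longleftrightarrow> eval W inp \<mu> e = Some x \<and> x < H ^ p"

lemma evalI: "evb inp \<mu> e x p \<Longrightarrow> eval W inp \<mu> e = Some x"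
  unfolding evb_def by simp

lemma addr_const: "t < 8 \<Longrightarrow> i < 20 \<Longrightarrow> addr t i < W"
  by (rule const_W) (simp add: addr_def)

lemma evb_D: "arr \<mu> 6 3 = D \<Longrightarrow> evb inp \<mu> (LoadL 6 3) D 2"
  unfolding evb_def by (auto intro!: eval_LoadL addr_const less_W[OF D_lt] D_lt simp: K_def)

lemma evb_S: "arr \<mu> 6 4 = S \<Longrightarrow> evb inp \<mu> (LoadL 6 4) S (3 * \<kappa> + 1)"
  unfolding evb_def by (auto intro!: eval_LoadL addr_const less_W[OF S_lt] S_lt[simplified] simp: K_def)

lemma evb_LoadL: "arr \<mu> t i = x \<Longrightarrow> x \<le> n + 1 \<Longrightarrow> t < 8 \<Longrightarrow> i < 20 \<Longrightarrow> evb inp \<mu> (LoadL t i) x 1"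
  unfolding evb_def using less_W[of x 1] addr_const[of t i] by (auto intro!: eval_LoadL simp: K_def H_def)

lemma evb_Const: "x < 243 \<Longrightarrow> evb inp \<mu> (Const x) x 5"
  unfolding evb_def using const_W[of x] H_pow_ge[of 5] by (simp add: word_def)

lemma evb_Add: "evb inp \<mu> e x p \<Longrightarrow> evb inp \<mu> e' y q \<Longrightarrow> p + q + 1 \<le> K \<Longrightarrow> evb inp \<mu> (e \<oplus> e') (x + y) (p + q + 1)"
  unfolding evb_def using less_W[OF add_bound, of x p y q] add_bound[of x p y q] by (auto simp: word_def)

lemma evb_Mul: "evb inp \<mu> e x p \<Longrightarrow> evb inp \<mu> e' y q \<Longrightarrow> p + q \<le> K \<Longrightarrow> evb inp \<mu> (e \<otimes> e') (x * y) (p + q)"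
  unfolding evb_def using less_W[OF mul_bound, of x p y q] mul_bound[of x p y q] by (auto simp: word_def)

lemma evb_le: "evb inp \<mu> e x p \<Longrightarrow> evb inp \<mu> e' y q \<Longrightarrow> binop_val f x y \<le> x \<Longrightarrow> p \<le> K \<Longrightarrow> evb inp \<mu> (Bin f e e') (binop_val f x y) p"
  unfolding evb_def using less_W[of x p] by (simp add: word_def)

lemma evb_Sub: "evb inp \<mu> e x p \<Longrightarrow> evb inp \<mu> e' y q \<Longrightarrow> p \<le> K \<Longrightarrow> evb inp \<mu> (Bin Sub e e') (x - y) p"
  using evb_le[of inp \<mu> e x p e' y q Sub] by simp

lemma evb_Quot: "evb inp \<mu> e x p \<Longrightarrow> evb inp \<mu> e' y q \<Longrightarrow> p \<le> K \<Longrightarrow> evb inp \<mu> (Bin Quot e e') (x div y) p"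
  using evb_le[of inp \<mu> e x p e' y q Quot] by simp

lemma evb_Rem: "evb inp \<mu> e x p \<Longrightarrow> evb inp \<mu> e' y q \<Longrightarrow> p \<le> K \<Longrightarrow> evb inp \<mu> (Bin Rem e e') (x mod y) p"
  using evb_le[of inp \<mu> e x p e' y q Rem] by simp

lemma evb_Eq: "evb inp \<mu> e x p \<Longrightarrow> evb inp \<mu> e' y q \<Longrightarrow> evb inp \<mu> (Bin Eq e e') (of_bool (x = y)) 1"
  unfolding evb_def using const_W[of 1] const_W[of 0] H3 by (simp add: word_def)

lemma evb_Lt: "evb inp \<mu> e x p \<Longrightarrow> evb inp \<mu> e' y q \<Longrightarrow> evb inp \<mu> (Bin Lt e e') (of_bool (x < y)) 1"
  unfolding evb_def using const_W[of 1] const_W[of 0] H3 by (simp add: word_def)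

lemma evb_LoadX: "evb inp \<mu> e x p \<Longrightarrow> t < 8 \<Longrightarrow> p + 5 \<le> K \<Longrightarrow> arr \<mu> t x = y \<Longrightarrow> y \<le> 1 \<Longrightarrow> evb inp \<mu> (LoadX t e) y 1"
  unfolding evb_def using H3 addr_bound[of x p t] const_W[of 8] const_W[of y]
  by (auto intro!: eval_LoadX)

text \<open>The rules for loading \<open>D\<close> and \<open>S\<close> precede the general one,
  since these values may exceed its limit \<open>n + 1\<close>.\<close>

lemmas evb_rules = evb_D evb_S evb_Add evb_Mul evb_Sub evb_Quot evb_Rem evb_Eq evb_Lt evb_LoadX evb_LoadL evb_Const

lemma wp_SetL': "evb inp \<mu> e y p \<Longrightarrow> t < 8 \<Longrightarrow> i < 20 \<Longrightarrow> \<Phi> (\<mu>(addr t i := y)) (a + 1) \<Longrightarrow>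
    wp W inp (SetL t i e) \<Phi> \<mu> a"
  by (rule wp_SetL[OF addr_const evalI])

lemma wp_SetX': "evb inp \<mu> i x p \<Longrightarrow> t < 8 \<Longrightarrow> p + 5 \<le> K \<Longrightarrow> evb inp \<mu> e y q \<Longrightarrow>
    \<Phi> (\<mu>(addr t x := y)) (a + 1) \<Longrightarrow> wp W inp (SetX t i e) \<Phi> \<mu> a"
  by (rule wp_SetX[OF evalI _ addr_bound _ evalI]) (auto simp: evb_def const_W)

lemma wp_Cond': "evb inp \<mu> e x p \<Longrightarrow> (x \<noteq> 0 \<Longrightarrow> wp W inp c1 \<Phi> \<mu> (a + 1)) \<Longrightarrow>
    (x = 0 \<Longrightarrow> wp W inp c2 \<Phi> \<mu> (a + 1)) \<Longrightarrow> wp W inp (Cond e c1 c2) \<Phi> \<mu> a"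
  by (rule wp_Cond[OF evalI])

lemma wp_For':
  assumes "I 0 (\<mu>(addr 0 x := 0)) (a + 1)"
    and "\<And>i \<mu> a. i < m \<Longrightarrow> I i \<mu> a \<Longrightarrow> arr \<mu> 0 x = i \<Longrightarrow>
      wp W inp c (\<lambda>\<mu>' a'. arr \<mu>' 0 x = i \<and> I (Suc i) (\<mu>'(addr 0 x := Suc i)) (a' + 1)) \<mu> (a + 1)"
    and "\<And>i \<mu> a. I i \<mu> a \<Longrightarrow> arr \<mu> 6 y = m"
    and "\<And>\<mu> a. I m \<mu> a \<Longrightarrow> \<Phi> \<mu> (a + 1)"
    and "m \<le> D" "x < 20" "y < 20"
  shows "wp W inp (For x y c) \<Phi> \<mu> a"
proof (rule wp_For[where I = I and m = m])
  show "m < W" using less_W[OF D_lt] assms(5) by (simp add: K_def)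
qed (use assms addr_const const_W in auto)

lemma k_le_D: "k \<le> D" "B \<le> D" "n \<le> D"
  using B1 k1 n_lt_D by (auto simp: D_def)

definition par :: "nat \<Rightarrow> nat" where
  "par = (\<lambda>_. 0)(0 := n, 1 := k, 2 := B, 3 := D, 4 := S)"

lemma par_simps [simp]: "par 0 = n" "par (Suc 0) = k" "par 1 = k" "par 2 = B" "par 3 = D" "par 4 = S"
  by (auto simp: par_def)

end

section \<open>Copies of the dynamic algorithm and their recorded runs\<close>

locale reduction = params \<kappa> n k for \<kappa> n k :: nat +
  fixes inc :: bool and P U Q :: com and M :: "nat \<Rightarrow> nat \<Rightarrow> bool" and vs :: "(nat \<Rightarrow> bool) list"
begin

definition "Mpad i j \<longleftrightarrow> i < n \<and> j < n \<and> M i j"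
definition "vpad r j \<longleftrightarrow> r < n \<and> j < n \<and> (vs ! r) j"

definition "cq c = c div (B * B)"
definition "ci c = c div B mod B"
definition "cj c = c mod B"

definition "mb c i j \<longleftrightarrow> Mpad (ci c * k + i) (cj c * k + j)"
text \<open>Known means hit by a column left of the current block. This depends on matrix and vector
  only and is shown later to agree with the result array when the block is visited; it is what makes
  \<open>ops\<close> independent of the simulation.\<close>

definition "row_known c t i \<longleftrightarrow> (\<exists>j<cj c * k. Mpad (ci c * k + i) j \<and> vpad (cq c * k + t) j)"
definition "vec_bit c t j \<longleftrightarrow> vpad (cq c * k + t) (cj c * k + j)"

definition "ehat c = gehat inc k (mb c)"
definition "ops c = gops inc k (mb c) (row_known c) (vec_bit c)"
definition copy_run :: "nat \<Rightarrow> nat \<Rightarrow> (nat \<Rightarrow> memory) \<Rightarrow> (nat \<Rightarrow> nat) \<Rightarrow> bool" where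
  "copy_run c \<tau> ms ts \<longleftrightarrow>
      (\<exists>out. exec S (encode_prediction (5 * k) (ehat c)) P (\<lambda>_. 0) \<tau> (ms 0) out) \<and>
      (\<forall>i<length (ops c). \<exists>out. exec S (snd (request U Q (ops c ! i))) (fst (request U Q (ops c ! i))) (ms i) (ts i) (ms (Suc i)) out \<and>
        (\<forall>s t. ops c ! i = Query s t \<longrightarrow> out = [of_bool ((s, t) \<in> (tc_graph inc (ehat c) (take i (ops c)))\<^sup>*)]))"

abbreviation "pass_step c t b \<equiv> gstep k (row_known c) (vec_bit c) t b"
abbreviation "pass_edges c t b \<equiv> gpass k (row_known c) (vec_bit c) t b"

definition "served c t = gprefix inc k (mb c) (row_known c) (vec_bit c) t"

lemma copy_id:
  assumes "bi < B" "bj < B"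
  shows "cq ((q * B + bi) * B + bj) = q" "ci ((q * B + bi) * B + bj) = bi" "cj ((q * B + bi) * B + bj) = bj"
  using assms unfolding cq_def ci_def cj_def by (simp_all add: div_mult2_eq)

lemma copy_lt:
  assumes "q < B" "bi < B" "bj < B"
  shows "(q * B + bi) * B + bj < B * B * B"
  using assms by (intro grid_index)

end

locale reduction_runs = reduction \<kappa> n k inc P U Q M vs for \<kappa> n k inc P U Q M vs +
  fixes ms :: "nat \<Rightarrow> nat \<Rightarrow> memory" and ts :: "nat \<Rightarrow> nat \<Rightarrow> nat" and tp :: "nat \<Rightarrow> nat"
  assumes runs: "\<And>c. c < B * B * B \<Longrightarrow> copy_run c (tp c) (ms c) (ts c)"
begin

text \<open>\<open>prog c\<close> is \<open>0\<close> before copy \<open>c\<close> is preprocessed, and \<open>Suc i\<close> once \<open>i\<close> operations have been served.\<close>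

definition copy_mem :: "nat \<Rightarrow> nat \<Rightarrow> memory" where
  "copy_mem c p = (case p of 0 \<Rightarrow> (\<lambda>_. 0) | Suc i \<Rightarrow> ms c i)"

text \<open>The whole contents of array 5, determined by how far each copy has progressed.\<close>

definition reg_of :: "(nat \<Rightarrow> nat) \<Rightarrow> nat \<Rightarrow> nat" where
  "reg_of prog z = copy_mem (z div S) (prog (z div S)) (z mod S)"

definition copy_time :: "nat \<Rightarrow> nat \<Rightarrow> nat" where
  "copy_time c p = (case p of 0 \<Rightarrow> 0 | Suc i \<Rightarrow> tp c + (\<Sum>j<i. ts c j))"

text \<open>Total simulated time spent so far. Bounding the clock relative to \<open>pot\<close>
  separates overhead from the time of the dynamic algorithm, and these bounds telescope over all
  vectors.\<close>

definition pot :: "(nat \<Rightarrow> nat) \<Rightarrow> nat" where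
  "pot prog = (\<Sum>c<B * B * B. copy_time c (prog c))"

lemma region_reg_of: "region S c (copy_mem c p) (reg_of prog) = reg_of (prog(c := p))"
  by (auto simp: region_def reg_of_def fun_eq_iff)

text \<open>Additive form, to avoid truncated subtraction; the time bounds below follow the same
  pattern.\<close>

lemma pot_upd: "c < B * B * B \<Longrightarrow> pot (prog(c := p)) + copy_time c p' = pot (prog(c := p')) + copy_time c p"
  unfolding pot_def by (simp add: sum.remove[of "{..<B * B * B}" c])

lemma pot_step: "c < B * B * B \<Longrightarrow> pot (prog(c := Suc (Suc i))) = pot (prog(c := Suc i)) + ts c i"
  using pot_upd[of c prog "Suc (Suc i)" "Suc i"] by (simp add: copy_time_def)

definition mat_of :: "nat \<Rightarrow> nat" where
  "mat_of z = of_bool (Mpad (z div D) (z mod D))"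

text \<open>Indexed by the list of served operations rather than its length, so that the next
  operation can be read off a decomposition of \<open>ops c\<close>.\<close>

definition adv :: "(nat \<Rightarrow> nat) \<Rightarrow> nat \<Rightarrow> operation list \<Rightarrow> nat \<Rightarrow> nat" where
  "adv prog c l = prog(c := Suc (length l))"

lemma pot_adv: "c < B * B * B \<Longrightarrow> pot (adv prog c (l @ [x])) = pot (adv prog c l) + ts c (length l)"
  unfolding adv_def using pot_step by simp

definition inv :: "memory \<Rightarrow> (nat \<Rightarrow> nat) \<Rightarrow> bool" where
  "inv \<mu> prog \<longleftrightarrow> arr \<mu> 6 = par \<and> arr \<mu> 1 = mat_of \<and> arr \<mu> 5 = reg_of prog"

text \<open>The second argument is evaluated after the first has been stored in array 4, hence its
  quantification over memories that agree elsewhere. Beyond the two stores the step costs exactly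
  the recorded time.\<close>

lemma wp_DoOp:
  assumes c: "c < B * B * B" and ops: "ops c = l @ x # suf" and base: "arr \<mu> 0 10 = c * S"
    and inv: "inv \<mu> (adv prog c l)"
    and req: "request U Q x = (p, [y, z])"
    and y: "evb inp \<mu> e y py" and z: "\<And>\<mu>'. (\<And>t. t < 8 \<Longrightarrow> t \<noteq> 4 \<Longrightarrow> arr \<mu>' t = arr \<mu> t) \<Longrightarrow> evb inp \<mu>' e' z pz"
    and post: "\<And>\<mu>'. inv \<mu>' (adv prog c (l @ [x])) \<Longrightarrow>
      (\<And>t. t < 8 \<Longrightarrow> t \<noteq> 4 \<Longrightarrow> t \<noteq> 5 \<Longrightarrow> t \<noteq> 7 \<Longrightarrow> arr \<mu>' t = arr \<mu> t) \<Longrightarrow>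
      (\<And>s t. x = Query s t \<Longrightarrow> arr \<mu>' 7 0 = of_bool ((s, t) \<in> (tc_graph inc (ehat c) l)\<^sup>*)) \<Longrightarrow>
      \<Phi> \<mu>' (a + 2 + ts c (length l))"
  shows "wp W inp (DoOp p e e') \<Phi> \<mu> a"
proof -
  obtain out where ex: "exec S [y, z] p (ms c (length l)) (ts c (length l)) (ms c (Suc (length l))) out"
    and out: "\<And>s t. x = Query s t \<Longrightarrow> out = [of_bool ((s, t) \<in> (tc_graph inc (ehat c) l)\<^sup>*)]"
    using runs[OF c, unfolded copy_run_def, THEN conjunct2, rule_format, of "length l"] ops req
    by (auto simp: nth_append)
  let ?\<mu> = "\<mu>(addr 4 0 := y, addr 4 1 := z)"
  show ?thesis
    unfolding DoOp_def
  proof (rule wp_Seq, rule wp_SetL'[OF y], simp, simp, rule wp_Seq, rule wp_SetL'[OF z])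
    show "wp W inp (sim p) \<Phi> ?\<mu> (a + 1 + 1)"
    proof (rule wp_sim[OF ex])
      show "arr ?\<mu> 0 10 = c * S" using base by simp
      show "8 * ((c + 1) * S) + 100 \<le> W" by (rule region_W[OF c])
      show "arr ?\<mu> 4 i = [y, z] ! i" if "i < length [y, z]" for i
        using that by (auto simp: less_Suc_eq_0_disj)
      \<comment> \<open>A trivial update, which exposes the memory of copy \<open>c\<close> inside
        \<open>reg_of\<close>.\<close>
      have "adv prog c l = (adv prog c l)(c := Suc (length l))" by (simp add: adv_def)
      then show "arr ?\<mu> 5 = region S c (ms c (length l)) (reg_of (adv prog c l))"
        using inv region_reg_of[of c "Suc (length l)" "adv prog c l"] by (simp add: inv_def copy_mem_def)
    next
      fix \<mu>' assume h: "arr \<mu>' 5 = region S c (ms c (Suc (length l))) (reg_of (adv prog c l))"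
        "\<And>t. t < 8 \<Longrightarrow> t \<noteq> 5 \<Longrightarrow> t \<noteq> 7 \<Longrightarrow> arr \<mu>' t = arr ?\<mu> t"
        "out \<noteq> [] \<Longrightarrow> arr \<mu>' 7 0 = last out"
      have "arr \<mu>' 5 = reg_of (adv prog c (l @ [x]))"
        using h(1) region_reg_of[of c "Suc (Suc (length l))" "adv prog c l"] by (simp add: copy_mem_def adv_def)
      then have "inv \<mu>' (adv prog c (l @ [x]))" using inv h(2) by (simp add: inv_def)
      then have "\<Phi> \<mu>' (a + 2 + ts c (length l))"
        by (rule post) (use h out in auto)
      then show "\<Phi> \<mu>' (a + 1 + 1 + ts c (length l))" by simp
    qed
  qed auto
qed

text \<open>The 3 covers the test and the two argument stores; the branch without update takes only
  two steps.\<close>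

lemma wp_cond_update:
  assumes c: "c < B * B * B" and ops: "ops c = l @ map Update (if b then [(y, z)] else []) @ suf"
    and base: "arr \<mu> 0 10 = c * S" and inv: "inv \<mu> (adv prog c l)"
    and b: "evb inp \<mu> E (of_bool b) pE"
    and y: "evb inp \<mu> e y py" and z: "\<And>\<mu>'. (\<And>t. t < 8 \<Longrightarrow> t \<noteq> 4 \<Longrightarrow> arr \<mu>' t = arr \<mu> t) \<Longrightarrow> evb inp \<mu>' e' z pz"
    and post: "\<And>\<mu>' a'. inv \<mu>' (adv prog c (l @ map Update (if b then [(y, z)] else []))) \<Longrightarrow>
      (\<And>t. t < 8 \<Longrightarrow> t \<noteq> 4 \<Longrightarrow> t \<noteq> 5 \<Longrightarrow> t \<noteq> 7 \<Longrightarrow> arr \<mu>' t = arr \<mu> t) \<Longrightarrow>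
      a' + pot (adv prog c l) \<le> a + 3 + pot (adv prog c (l @ map Update (if b then [(y, z)] else []))) \<Longrightarrow> \<Phi> \<mu>' a'"
  shows "wp W inp (Cond E (DoOp U e e') Skip) \<Phi> \<mu> a"
proof (rule wp_Cond'[OF b])
  assume "of_bool b \<noteq> (0 :: nat)"
  then have b: b by (cases b) auto
  show "wp W inp (DoOp U e e') \<Phi> \<mu> (a + 1)"
  proof (rule wp_DoOp[OF c _ base inv _ y z])
    show "ops c = l @ Update (y, z) # suf" using ops b by simp
    fix \<mu>' assume "inv \<mu>' (adv prog c (l @ [Update (y, z)]))"
      "\<And>t. t < 8 \<Longrightarrow> t \<noteq> 4 \<Longrightarrow> t \<noteq> 5 \<Longrightarrow> t \<noteq> 7 \<Longrightarrow> arr \<mu>' t = arr \<mu> t"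
    then show "\<Phi> \<mu>' (a + 1 + 2 + ts c (length l))"
      using b pot_adv[OF c, of prog l "Update (y, z)"] by (intro post) auto
  qed auto
next
  assume "of_bool b = (0 :: nat)"
  then have b: "\<not> b" by (cases b) auto
  show "wp W inp Skip \<Phi> \<mu> (a + 1)"
    by (rule wp_Skip, rule post) (use inv b in auto)
qed

section \<open>Executing the edge passes of a round\<close>

definition at_block :: "memory \<Rightarrow> nat \<Rightarrow> nat \<Rightarrow> nat \<Rightarrow> nat \<Rightarrow> bool" where
  "at_block \<mu> q t bi bj \<longleftrightarrow> arr \<mu> 0 2 = q \<and> arr \<mu> 0 8 = t \<and> arr \<mu> 0 3 = bi \<and> arr \<mu> 0 4 = bj"

text \<open>Per index the cost is two conditional updates at 3 steps plus test and increment, hence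
  the factor 8. The premises on arrays 2 and 3 say that the stored bits agree with the predicates
  that define \<open>ops\<close>.\<close>

lemma wp_Pass:
  fixes q t bi bj
  defines "c \<equiv> (q * B + bi) * B + bj"
  assumes q: "q < B" and t: "t < k" and bi: "bi < B" and bj: "bj < B"
    and ops: "ops c = l @ map Update (pass_edges c t b) @ suf"
    and base: "arr \<mu>0 0 10 = c * S" and inv: "inv \<mu>0 (adv prog c l)" and ab: "at_block \<mu>0 q t bi bj"
    and res: "\<And>i. i < k \<Longrightarrow> arr \<mu>0 3 (bi * k + i) = of_bool (row_known c t i)"
    and vec: "\<And>i. i < k \<Longrightarrow> arr \<mu>0 2 (bj * k + i) = of_bool (vec_bit c t i)"
    and post: "\<And>\<mu> a. inv \<mu> (adv prog c (l @ map Update (pass_edges c t b))) \<Longrightarrow>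
      arr \<mu> 2 = arr \<mu>0 2 \<Longrightarrow> arr \<mu> 3 = arr \<mu>0 3 \<Longrightarrow> (\<And>v. v \<noteq> 6 \<Longrightarrow> arr \<mu> 0 v = arr \<mu>0 0 v) \<Longrightarrow>
      a + pot (adv prog c l) \<le> a0 + 8 * k + 2 + pot (adv prog c (l @ map Update (pass_edges c t b))) \<Longrightarrow> \<Phi> \<mu> a"
  shows "wp W inp (Pass U b) \<Phi> \<mu>0 a0"
proof -
  have c: "c < B * B * B" unfolding c_def using q bi bj by (rule copy_lt)
  let ?l = "\<lambda>j. l @ map Update (concat (map (pass_step c t b) [0..<j]))"
  let ?I = "\<lambda>j \<mu> a. inv \<mu> (adv prog c (?l j)) \<and> arr \<mu> 2 = arr \<mu>0 2 \<and> arr \<mu> 3 = arr \<mu>0 3 \<and>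
    (\<forall>v. v \<noteq> 6 \<longrightarrow> arr \<mu> 0 v = arr \<mu>0 0 v) \<and> a + pot (adv prog c l) \<le> a0 + 8 * j + 1 + pot (adv prog c (?l j))"
  show ?thesis
    unfolding Pass_def
  proof (rule wp_For'[where I = ?I and m = k])
    show "?I 0 (\<mu>0(addr 0 6 := 0)) (a0 + 1)" using inv by (auto simp: inv_def)
    show "arr \<mu> 6 1 = k" if "?I j \<mu> a" for j \<mu> a using that by (simp add: inv_def)
    show "\<Phi> \<mu> (a + 1)" if "?I k \<mu> a" for \<mu> a
      using that by (intro post) (auto simp: gpass_def)
  next
    fix j \<mu> a assume j: "j < k" and I: "?I j \<mu> a" and v6: "arr \<mu> 0 6 = j"
    have aI: "a + pot (adv prog c l) \<le> a0 + 8 * j + 1 + pot (adv prog c (?l j))" using I by blast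
    have sum_le: "a2 + p + 1 \<le> a0 + 8 * Suc j + 1 + p2"
      if "a + p \<le> a0 + 8 * j + 1 + p0" "a1 + p0 \<le> a + 1 + 3 + p1" "a2 + p1 \<le> a1 + 3 + p2" for a1 a2 p p0 p1 p2 :: nat
      using that by simp
    let ?b1 = "row_known c t j = b" and ?b2 = "vec_bit c t j \<noteq> b"
    let ?l1 = "?l j @ map Update (if ?b1 then [(3 * k + t, j)] else [])"
    have split: "pass_edges c t b = concat (map (pass_step c t b) [0..<j]) @
        pass_step c t b j @ concat (map (pass_step c t b) [Suc j..<k])"
      unfolding gpass_def by (rule concat_map_upt_split[OF j])
    have vars: "arr \<mu>' 0 6 = j" "arr \<mu>' 0 3 = bi" "arr \<mu>' 0 4 = bj" "arr \<mu>' 0 8 = t" "arr \<mu>' 6 = par"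
      if "arr \<mu>' 0 = arr \<mu> 0" "arr \<mu>' 6 = arr \<mu> 6" for \<mu>'
      using that v6 I ab by (auto simp: at_block_def inv_def)
    have le: "k \<le> Suc n" "B \<le> Suc n" "j \<le> Suc n" "bi \<le> Suc n" "bj \<le> Suc n" "t \<le> Suc n"
      using k_le_n B_le j bi bj t by auto
    show "wp W inp (Seq (row_op U b) (col_op U b))
      (\<lambda>\<mu>' a'. arr \<mu>' 0 6 = j \<and> ?I (Suc j) (\<mu>'(addr 0 6 := Suc j)) (a' + 1)) \<mu> (a + 1)"
    proof (rule wp_Seq, unfold row_op_def, rule wp_cond_update[OF c, where l = "?l j" and b = ?b1])
      show "ops c = ?l j @ map Update (if ?b1 then [(3 * k + t, j)] else []) @
          map Update (if ?b2 then [(k + j, 4 * k + t)] else []) @ map Update (concat (map (pass_step c t b) [Suc j..<k])) @ suf"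
        unfolding ops split by (simp add: gstep_def)
      show "arr \<mu> 0 10 = c * S" "inv \<mu> (adv prog c (?l j))" using I base by auto
      have "of_bool ?b1 = (of_bool ((of_bool (row_known c t j) :: nat) = of_bool b) :: nat)" by simp
      also have "evb inp \<mu> (row_test b) \<dots> 1"
        unfolding row_test_def by (rule evb_rules | use vars[of \<mu>] le j I res in \<open>simp add: K_def\<close>)+
      finally show "evb inp \<mu> (row_test b) (of_bool ?b1) 1" .
      \<comment> \<open>The exponent is an unevaluated sum because it has to unify with the shape
        built up by \<open>evb_rules\<close>.\<close>
      show "evb inp \<mu> (Const 3 \<otimes> kE \<oplus> var 8) (3 * k + t) (5 + 1 + 1 + 1)"
        by (rule evb_rules | use vars[of \<mu>] le in \<open>simp add: K_def\<close>)+
      show "evb inp \<mu>' (var 6) j 1" if "\<And>t. t < 8 \<Longrightarrow> t \<noteq> 4 \<Longrightarrow> arr \<mu>' t = arr \<mu> t" for \<mu>'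
        by (rule evb_rules | use that vars[of \<mu>'] le in \<open>simp add: K_def\<close>)+
      fix \<mu>1 a1 assume inv1: "inv \<mu>1 (adv prog c ?l1)" and
        fr1: "\<And>t. t < 8 \<Longrightarrow> t \<noteq> 4 \<Longrightarrow> t \<noteq> 5 \<Longrightarrow> t \<noteq> 7 \<Longrightarrow> arr \<mu>1 t = arr \<mu> t" and
        a1: "a1 + pot (adv prog c (?l j)) \<le> a + 1 + 3 + pot (adv prog c ?l1)"
      show "wp W inp (col_op U b)
         (\<lambda>\<mu>' a'. arr \<mu>' 0 6 = j \<and> ?I (Suc j) (\<mu>'(addr 0 6 := Suc j)) (a' + 1)) \<mu>1 a1"
      proof (unfold col_op_def, rule wp_cond_update[OF c, where l = ?l1 and b = ?b2])
        show "ops c = ?l1 @ map Update (if ?b2 then [(k + j, 4 * k + t)] else []) @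
          map Update (concat (map (pass_step c t b) [Suc j..<k])) @ suf"
          unfolding ops split by (simp add: gstep_def)
        show "arr \<mu>1 0 10 = c * S" "inv \<mu>1 (adv prog c ?l1)" using I base fr1 inv1 by auto
        have "of_bool ?b2 = (of_bool ((of_bool (vec_bit c t j) :: nat) = of_bool (\<not> b)) :: nat)" by simp
        also have "evb inp \<mu>1 (col_test b) \<dots> 1"
          unfolding col_test_def by (rule evb_rules | use vars[of \<mu>1] le j I fr1 vec in \<open>simp add: K_def\<close>)+
        finally show "evb inp \<mu>1 (col_test b) (of_bool ?b2) 1" .
        show "evb inp \<mu>1 (kE \<oplus> var 6) (k + j) (1 + 1 + 1)"
          by (rule evb_rules | use vars[of \<mu>1] fr1 le in \<open>simp add: K_def\<close>)+
        show "evb inp \<mu>' (Const 4 \<otimes> kE \<oplus> var 8) (4 * k + t) (5 + 1 + 1 + 1)"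
          if "\<And>t. t < 8 \<Longrightarrow> t \<noteq> 4 \<Longrightarrow> arr \<mu>' t = arr \<mu>1 t" for \<mu>'
          by (rule evb_rules | use that vars[of \<mu>'] fr1 le in \<open>simp add: K_def\<close>)+
        fix \<mu>2 a2 assume inv2: "inv \<mu>2 (adv prog c (?l1 @ map Update (if ?b2 then [(k + j, 4 * k + t)] else [])))" and
          fr2: "\<And>t. t < 8 \<Longrightarrow> t \<noteq> 4 \<Longrightarrow> t \<noteq> 5 \<Longrightarrow> t \<noteq> 7 \<Longrightarrow> arr \<mu>2 t = arr \<mu>1 t" and
          a2: "a2 + pot (adv prog c ?l1) \<le> a1 + 3 + pot (adv prog c (?l1 @ map Update (if ?b2 then [(k + j, 4 * k + t)] else [])))"
        have l2: "?l1 @ map Update (if ?b2 then [(k + j, 4 * k + t)] else []) = ?l (Suc j)"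
          by (simp add: gstep_def)
        have "a2 + pot (adv prog c l) + 1 \<le> a0 + 8 * Suc j + 1 + pot (adv prog c (?l (Suc j)))"
          by (rule sum_le[OF aI a1 a2[unfolded l2]])
        moreover have "inv (\<mu>2(addr 0 6 := Suc j)) (adv prog c (?l (Suc j)))"
          using inv2[unfolded l2] by (simp add: inv_def)
        ultimately show "arr \<mu>2 0 6 = j \<and> ?I (Suc j) (\<mu>2(addr 0 6 := Suc j)) (a2 + 1)"
          using I fr1 fr2 v6 by simp
      qed
    qed
  qed (use k_le_D in auto)
qed

end

lemma of_bool_nonzeroD: "of_bool b \<noteq> (0 :: nat) \<Longrightarrow> b"
  by (cases b) auto

lemma of_bool_zeroD: "of_bool b = (0 :: nat) \<Longrightarrow> \<not> b"
  by (cases b) auto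

section \<open>Partial results, exhaustive search and the treatment of one block\<close>

context reduction_runs
begin

definition hit :: "nat \<Rightarrow> nat \<Rightarrow> nat \<Rightarrow> bool" where
  "hit r i m \<longleftrightarrow> (\<exists>j<m. Mpad i j \<and> vpad r j)"

definition resf :: "memory \<Rightarrow> nat \<Rightarrow> (nat \<Rightarrow> nat) \<Rightarrow> bool" where
  "resf \<mu> r f \<longleftrightarrow> (\<forall>i<D. arr \<mu> 3 i = of_bool (hit r i (f i)))"

text \<open>The potential that pays for the searches: each search makes it grow, and it never
  exceeds \<open>D\<close> for one vector.\<close>

definition ones :: "nat \<Rightarrow> (nat \<Rightarrow> nat) \<Rightarrow> nat" where
  "ones r f = card {i. i < D \<and> hit r i (f i)}"

text \<open>The frontier of the row-by-row traversal: for each matrix row, the number of columns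
  accounted for on arrival at the given block.\<close>

definition limf :: "nat \<Rightarrow> nat \<Rightarrow> nat \<Rightarrow> nat" where
  "limf bi bj y = (if y div k < bi then D else if y div k = bi then bj * k else 0)"

lemma block_index: "bi < B \<Longrightarrow> i < k \<Longrightarrow> bi * k + i < D"
  unfolding D_def by (rule grid_index)

lemma hit_mono: "hit r i m \<Longrightarrow> m \<le> m' \<Longrightarrow> hit r i m'"
  unfolding hit_def by (meson less_le_trans)

lemma ones_le: "ones r f \<le> D"
proof -
  have "ones r f \<le> card {..<D}" unfolding ones_def by (rule card_mono) auto
  then show ?thesis by simp
qed

lemma ones_mono: "(\<And>i. f i \<le> g i) \<Longrightarrow> ones r f \<le> ones r g"
  unfolding ones_def by (rule card_mono) (auto intro: hit_mono)

lemma ones_strict: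
  assumes "\<And>i. f i \<le> g i" "i < D" "\<not> hit r i (f i)" "hit r i (g i)"
  shows "ones r f < ones r g"
  unfolding ones_def by (rule psubset_card_mono) (use assms in \<open>auto intro: hit_mono\<close>)

lemma mat_of_at: "y < D \<Longrightarrow> mat_of (x * D + y) = of_bool (Mpad x y)"
  by (simp add: mat_of_def)

lemma evb_matE:
  assumes "arr \<mu> 6 = par" "arr \<mu> 1 = mat_of" "arr \<mu> 0 3 = bi" "arr \<mu> 0 4 = bj" "arr \<mu> 0 5 = i" "arr \<mu> 0 6 = j"
    "bi < B" "bj < B" "i < k" "j < k"
  shows "evb inp \<mu> matE (of_bool (Mpad (bi * k + i) (bj * k + j))) 1"
proof -
  have le: "k \<le> Suc n" "B \<le> Suc n" "i \<le> Suc n" "j \<le> Suc n" "bi \<le> Suc n" "bj \<le> Suc n"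
    using k_le_n B_le assms by auto
  show ?thesis unfolding matE_def
    by (rule evb_rules | use assms le mat_of_at[OF block_index[of bj j]] in \<open>simp add: K_def\<close>)+
qed

lemma wp_Brute:
  assumes bi: "bi < B" and bj: "bj < B" and inv: "inv \<mu>0 prog" and ab: "at_block \<mu>0 q t bi bj"
    and vec: "\<And>j. j < D \<Longrightarrow> arr \<mu>0 2 j = of_bool (vpad r j)" and res: "resf \<mu>0 r (limf bi bj)"
    and post: "\<And>\<mu> a. inv \<mu> prog \<Longrightarrow> arr \<mu> 2 = arr \<mu>0 2 \<Longrightarrow>
      (\<And>v. v \<noteq> 5 \<Longrightarrow> v \<noteq> 6 \<Longrightarrow> arr \<mu> 0 v = arr \<mu>0 0 v) \<Longrightarrow> resf \<mu> r (limf bi (Suc bj)) \<Longrightarrow>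
      a \<le> a0 + 10 * k * k \<Longrightarrow> \<Phi> \<mu> a"
  shows "wp W inp Brute \<Phi> \<mu>0 a0"
proof -
  \<comment> \<open>Column limits after the first \<open>i\<close> rows of the block. They
    interpolate between the limits before and after the block, so the result array is described
    exactly at every moment of the search.\<close>
  define f where "f i y = (if y div k = bi \<and> y mod k < i then Suc bj * k else limf bi bj y)" for i y
  have f0: "f 0 = limf bi bj" by (auto simp: f_def)
  have fk: "f k = limf bi (Suc bj)" using k1 by (auto simp: f_def limf_def)
  have fi: "f i (bi * k + i) = bj * k" if "i < k" for i using that by (simp add: f_def limf_def)
  have fSuc: "f (Suc i) = (f i)(bi * k + i := bj * k + k)" if "i < k" for i
  proof
    fix y
    show "f (Suc i) y = ((f i)(bi * k + i := bj * k + k)) y"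
    proof (cases "y = bi * k + i")
      case True
      then show ?thesis using that by (simp add: f_def)
    next
      case False
      then have "y div k \<noteq> bi \<or> y mod k \<noteq> i" by (metis div_mult_mod_eq)
      then show ?thesis using False by (auto simp: f_def)
    qed
  qed
  let ?fr = "\<lambda>\<mu>. inv \<mu> prog \<and> arr \<mu> 2 = arr \<mu>0 2 \<and> (\<forall>v. v \<noteq> 5 \<and> v \<noteq> 6 \<longrightarrow> arr \<mu> 0 v = arr \<mu>0 0 v)"
  let ?I = "\<lambda>i \<mu> a. ?fr \<mu> \<and> resf \<mu> r (f i) \<and> a \<le> a0 + 1 + i * (4 * k + 4)"
  show ?thesis
    unfolding Brute_def
  proof (rule wp_For'[where I = ?I and m = k])
    show "?I 0 (\<mu>0(addr 0 5 := 0)) (a0 + 1)" using inv res by (auto simp: inv_def f0 resf_def)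
    show "arr \<mu> 6 1 = k" if "?I j \<mu> a" for j \<mu> a using that by (simp add: inv_def)
    show "\<Phi> \<mu> (a + 1)" if "?I k \<mu> a" for \<mu> a
    proof (rule post)
      \<comment> \<open>Each entry costs 4 steps and each row 4 more; \<open>1 \<le> k\<close>
        absorbs the lower terms.\<close>
      have "k * (4 * k + 4) + 2 \<le> 10 * k * k" using k1 by (cases k) (auto simp: algebra_simps)
      moreover have "a \<le> a0 + 1 + k * (4 * k + 4)" using that by blast
      ultimately show "a + 1 \<le> a0 + 10 * k * k" by linarith
    qed (use that fk in auto)
  next
    fix i \<mu> a assume i: "i < k" and I: "?I i \<mu> a" and v5: "arr \<mu> 0 5 = i"
    let ?J = "\<lambda>j \<mu> a. ?fr \<mu> \<and> arr \<mu> 0 5 = i \<and> resf \<mu> r ((f i)(bi * k + i := bj * k + j)) \<and>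
       a \<le> a0 + 1 + i * (4 * k + 4) + 2 + 4 * j"
    show "wp W inp (For 6 1 brute_step)
      (\<lambda>\<mu>' a'. arr \<mu>' 0 5 = i \<and> ?I (Suc i) (\<mu>'(addr 0 5 := Suc i)) (a' + 1)) \<mu> (a + 1)"
    proof (rule wp_For'[where I = ?J and m = k])
      have "(f i)(bi * k + i := bj * k + 0) = f i" using fi[OF i] by auto
      then show "?J 0 (\<mu>(addr 0 6 := 0)) (a + 1 + 1)" using I v5 by (auto simp: inv_def resf_def)
      show "arr \<mu> 6 1 = k" if "?J j \<mu> a" for j \<mu> a using that by (simp add: inv_def)
      show "arr \<mu>' 0 5 = i \<and> ?I (Suc i) (\<mu>'(addr 0 5 := Suc i)) (a' + 1 + 1)" if "?J k \<mu>' a'" for \<mu>' a'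
        using that fSuc[OF i] by (auto simp: inv_def resf_def)
    next
      fix j \<mu> a assume j: "j < k" and J: "?J j \<mu> a" and v6: "arr \<mu> 0 6 = j"
      have v: "arr \<mu> 0 3 = bi" "arr \<mu> 0 4 = bj" "arr \<mu> 0 5 = i" "arr \<mu> 0 6 = j" "arr \<mu> 6 = par" "arr \<mu> 1 = mat_of"
        "arr \<mu> 2 = arr \<mu>0 2"
        using J v6 ab by (auto simp: at_block_def inv_def)
      have le: "k \<le> Suc n" "B \<le> Suc n" "i \<le> Suc n" "j \<le> Suc n" "bi \<le> Suc n" "bj \<le> Suc n"
        using k_le_n B_le i j bi bj by auto
      let ?f = "(f i)(bi * k + i := bj * k + j)" and ?f' = "(f i)(bi * k + i := bj * k + Suc j)"
      let ?x = "bi * k + i" and ?y = "bj * k + j"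
      have hit_eq: "hit r z (?f' z) \<longleftrightarrow> hit r z (?f z) \<or> (z = ?x \<and> Mpad ?x ?y \<and> vpad r ?y)" for z
        by (auto simp: hit_def less_Suc_eq)
      have "of_bool (Mpad ?x ?y \<and> vpad r ?y) = (of_bool (Mpad ?x ?y) * of_bool (vpad r ?y) :: nat)" by simp
      also have "evb inp \<mu> hit_test \<dots> (1 + 1)"
        unfolding hit_test_def by (rule evb_Mul evb_matE[OF v(5,6,1,2,3,4) bi bj i j] evb_rules |
            use v le vec block_index[OF bj j] in \<open>simp add: K_def\<close>)+
      finally have e: "evb inp \<mu> hit_test (of_bool (Mpad ?x ?y \<and> vpad r ?y)) (1 + 1)" .
      show "wp W inp brute_step
        (\<lambda>\<mu>' a'. arr \<mu>' 0 6 = j \<and> ?J (Suc j) (\<mu>'(addr 0 6 := Suc j)) (a' + 1)) \<mu> (a + 1)"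
      proof (unfold brute_step_def, rule wp_Cond'[OF e])
        assume "of_bool (Mpad ?x ?y \<and> vpad r ?y) \<noteq> (0 :: nat)"
        then have h: "Mpad ?x ?y \<and> vpad r ?y" by (simp split: if_splits)
        have ix: "evb inp \<mu> (var 3 \<otimes> kE \<oplus> var 5) ?x (1 + 1 + 1 + 1)"
          by (rule evb_rules | use v le in \<open>simp add: K_def\<close>)+
        have res': "resf (\<mu>(addr 3 ?x := 1, addr 0 6 := Suc j)) r ?f'"
          unfolding resf_def hit_eq
        proof (intro allI impI)
          fix z assume "z < D"
          then have "arr \<mu> 3 z = of_bool (hit r z (?f z))" using J by (simp add: resf_def)
          moreover have "arr (\<mu>(addr 3 ?x := 1, addr 0 6 := Suc j)) 3 = (arr \<mu> 3)(?x := 1)" by simp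
          ultimately show "arr (\<mu>(addr 3 ?x := 1, addr 0 6 := Suc j)) 3 z =
              of_bool (hit r z (?f z) \<or> (z = ?x \<and> Mpad ?x ?y \<and> vpad r ?y))"
            using h by (cases "z = ?x") simp_all
        qed
        show "wp W inp (SetX 3 (var 3 \<otimes> kE \<oplus> var 5) (Const 1))
          (\<lambda>\<mu>' a'. arr \<mu>' 0 6 = j \<and> ?J (Suc j) (\<mu>'(addr 0 6 := Suc j)) (a' + 1)) \<mu> (a + 1 + 1)"
        proof (rule wp_SetX'[OF ix _ _ evb_Const[of 1]])
          show "arr (\<mu>(addr 3 ?x := 1)) 0 6 = j \<and> ?J (Suc j) (\<mu>(addr 3 ?x := 1, addr 0 6 := Suc j)) (a + 1 + 1 + 1 + 1)"
            using J v6 res' by (auto simp: inv_def)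
        qed (auto simp: K_def)
      next
        assume "of_bool (Mpad ?x ?y \<and> vpad r ?y) = (0 :: nat)"
        then have h: "\<not> (Mpad ?x ?y \<and> vpad r ?y)" by (simp split: if_splits)
        have res': "resf (\<mu>(addr 0 6 := Suc j)) r ?f'"
          using J h unfolding resf_def hit_eq by (auto simp del: fun_upd_apply)
        show "wp W inp Skip
          (\<lambda>\<mu>' a'. arr \<mu>' 0 6 = j \<and> ?J (Suc j) (\<mu>'(addr 0 6 := Suc j)) (a' + 1)) \<mu> (a + 1 + 1)"
          by (rule wp_Skip) (use J v6 res' in \<open>auto simp: inv_def\<close>)
      qed
    qed (use k_le_D in auto)
  qed (use k_le_D in auto)
qed

lemma evb_baseE:
  assumes "arr \<mu> 6 = par" "arr \<mu> 0 2 = q" "arr \<mu> 0 3 = bi" "arr \<mu> 0 4 = bj" "q < B" "bi < B" "bj < B"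
  shows "\<exists>p. evb inp \<mu> baseE (((q * B + bi) * B + bj) * S) p"
proof -
  have le: "B \<le> Suc n" "q \<le> Suc n" "bi \<le> Suc n" "bj \<le> Suc n" using B_le assms by auto
  have "evb inp \<mu> baseE (((q * B + bi) * B + bj) * S) ((1 + 1 + 1 + 1) + 1 + 1 + 1 + (3 * \<kappa> + 1))"
    unfolding baseE_def by (rule evb_rules | use assms le in \<open>simp add: K_def\<close>)+
  then show ?thesis by blast
qed

text \<open>A positive answer exhibits a row that becomes known in this block, so
  \<open>ones\<close> grows and releases the \<open>10 * k * k\<close> steps of the search. A
  negative answer means that no row changes its status, so the untouched result array is already
  correct for the next column limit.\<close>

lemma wp_Block:
  fixes q t bi bj
  defines "c \<equiv> (q * B + bi) * B + bj" and "r \<equiv> q * k + t"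
  assumes q: "q < B" and t: "t < k" and bi: "bi < B" and bj: "bj < B"
    and inv: "inv \<mu>0 (adv prog c (served c t))" and ab: "at_block \<mu>0 q t bi bj"
    and vec: "\<And>j. j < D \<Longrightarrow> arr \<mu>0 2 j = of_bool (vpad r j)" and res: "resf \<mu>0 r (limf bi bj)"
    and post: "\<And>\<mu> a. inv \<mu> (adv prog c (served c (Suc t))) \<Longrightarrow> arr \<mu> 2 = arr \<mu>0 2 \<Longrightarrow>
      (\<And>v. v \<notin> {5, 6, 10, 11} \<Longrightarrow> arr \<mu> 0 v = arr \<mu>0 0 v) \<Longrightarrow> resf \<mu> r (limf bi (Suc bj)) \<Longrightarrow>
      a + pot (adv prog c (served c t)) + 10 * k * k * ones r (limf bi bj) \<le>
      a0 + (16 * k + 20) + pot (adv prog c (served c (Suc t))) + 10 * k * k * ones r (limf bi (Suc bj)) \<Longrightarrow> \<Phi> \<mu> a"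
  shows "wp W inp (Block inc U Q) \<Phi> \<mu>0 a0"
proof -
  have c: "c < B * B * B" unfolding c_def using q bi bj by (rule copy_lt)
  have cid: "cq c = q" "ci c = bi" "cj c = bj" unfolding c_def using copy_id[OF bi bj] by auto
  have x_eq: "row_known c t i \<longleftrightarrow> hit r (bi * k + i) (bj * k)" for i
    by (simp add: row_known_def hit_def cid r_def)
  have w_eq: "vec_bit c t j \<longleftrightarrow> vpad r (bj * k + j)" for j
    by (simp add: vec_bit_def cid r_def)
  have lim: "limf bi bj (bi * k + i) = bj * k" if "i < k" for i using that by (simp add: limf_def)
  let ?p1 = "map Update (pass_edges c t (\<not> inc))" and ?p2 = "map Update (pass_edges c t inc)"
  let ?q = "Query (3 * k + t) (4 * k + t)"
  let ?l0 = "served c t" let ?l1 = "?l0 @ ?p1" let ?l2 = "?l1 @ [?q]" let ?l3 = "?l2 @ ?p2"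
  have l3: "served c (Suc t) = ?l3" by (simp add: served_def gprefix_Suc ground_def)
  obtain suf where "ops c = ?l0 @ ground inc k (row_known c) (vec_bit c) t @ suf"
    using gops_split[OF t] unfolding ops_def served_def by blast
  then have ops: "ops c = ?l0 @ ?p1 @ ?q # ?p2 @ suf" by (simp add: ground_def)
  let ?ans = "\<exists>i<k. \<exists>j<k. \<not> row_known c t i \<and> mb c i j \<and> vec_bit c t j"
  have ans: "(3 * k + t, 4 * k + t) \<in> (tc_graph inc (ehat c) ?l1)\<^sup>* \<longleftrightarrow> ?ans"
    unfolding ehat_def served_def by (rule gadget_graph[OF t])
  have lim_le: "limf bi bj y \<le> limf bi (Suc bj) y" for y by (auto simp: limf_def)
  obtain pb where be: "evb inp \<mu>0 baseE (c * S) pb"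
    using evb_baseE[OF _ _ _ _ q bi bj] inv ab unfolding c_def by (auto simp: inv_def at_block_def)
  have le: "k \<le> Suc n" "t \<le> Suc n" using k_le_n t by auto
  \<comment> \<open>Stated for fresh variables, to keep the large clock and potential terms away
    from linear arithmetic. The constants add up to \<open>16 * k + 10\<close>; the rest is
    slack.\<close>
  have arith: "a5 + p0 + z \<le> a0 + (16 * k + 20) + p3 + y"
    if "a1 + p0 \<le> a0 + 1 + 8 * k + 2 + p1" "a3 + p2 \<le> a1 + 2 + d + 1 + 8 * k + 2 + p3" "p2 = p1 + d"
      "a5 + z \<le> a3 + 2 + y" for a1 a3 a5 p0 p1 p2 p3 d y z :: nat
    using that by simp
  show ?thesis
    unfolding Block_def
  proof (rule wp_Seq, rule wp_SetL'[OF be], simp, simp, rule wp_Seq, rule wp_Pass[OF q t bi bj, folded c_def])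
    let ?\<mu> = "\<mu>0(addr 0 10 := c * S)"
    show "ops c = ?l0 @ ?p1 @ (?q # ?p2 @ suf)" by (rule ops)
    show "arr ?\<mu> 0 10 = c * S" "inv ?\<mu> (adv prog c ?l0)" "at_block ?\<mu> q t bi bj"
      using inv ab by (auto simp: inv_def at_block_def)
    show "arr ?\<mu> 3 (bi * k + i) = of_bool (row_known c t i)" if "i < k" for i
      using res block_index[OF bi that] lim[OF that] by (simp add: resf_def x_eq)
    show "arr ?\<mu> 2 (bj * k + i) = of_bool (vec_bit c t i)" if "i < k" for i
      using vec[OF block_index[OF bj that]] by (simp add: w_eq)
    fix \<mu>1 a1 assume inv1: "inv \<mu>1 (adv prog c ?l1)" and fr1: "arr \<mu>1 2 = arr ?\<mu> 2" "arr \<mu>1 3 = arr ?\<mu> 3"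
      "\<And>v. v \<noteq> 6 \<Longrightarrow> arr \<mu>1 0 v = arr ?\<mu> 0 v" and a1: "a1 + pot (adv prog c ?l0) \<le> a0 + 1 + 8 * k + 2 + pot (adv prog c ?l1)"
    have v1: "arr \<mu>1 0 8 = t" using fr1(3)[of 8] ab by (simp add: at_block_def)
    have p1: "arr \<mu>1 6 = par" using inv1 by (simp add: inv_def)
    show "wp W inp (Seq (DoOp Q (Const 3 \<otimes> kE \<oplus> var 8) (Const 4 \<otimes> kE \<oplus> var 8)) (Seq (SetL 0 11 (LoadL 7 0))
       (Seq (Pass U inc) (Cond (var 11) Brute Skip)))) \<Phi> \<mu>1 a1"
    proof (rule wp_Seq, rule wp_DoOp[OF c _ _ inv1, of ?q])
      show "ops c = ?l1 @ ?q # ?p2 @ suf" using ops by simp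
      show "arr \<mu>1 0 10 = c * S" using fr1(3)[of 10] by simp
      show "request U Q ?q = (Q, [3 * k + t, 4 * k + t])" by simp
      show "evb inp \<mu>1 (Const 3 \<otimes> kE \<oplus> var 8) (3 * k + t) (5 + 1 + 1 + 1)"
        by (rule evb_rules | use p1 v1 le in \<open>simp add: K_def\<close>)+
      show "evb inp \<mu>' (Const 4 \<otimes> kE \<oplus> var 8) (4 * k + t) (5 + 1 + 1 + 1)"
        if "\<And>t. t < 8 \<Longrightarrow> t \<noteq> 4 \<Longrightarrow> arr \<mu>' t = arr \<mu>1 t" for \<mu>'
        by (rule evb_rules | use that p1 v1 le in \<open>simp add: K_def\<close>)+
      fix \<mu>2 assume inv2: "inv \<mu>2 (adv prog c ?l2)"
        and fr2: "\<And>t. t < 8 \<Longrightarrow> t \<noteq> 4 \<Longrightarrow> t \<noteq> 5 \<Longrightarrow> t \<noteq> 7 \<Longrightarrow> arr \<mu>2 t = arr \<mu>1 t"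
        and out2: "\<And>s u. ?q = Query s u \<Longrightarrow> arr \<mu>2 7 0 = of_bool ((s, u) \<in> (tc_graph inc (ehat c) ?l1)\<^sup>*)"
      have out2: "arr \<mu>2 7 0 = of_bool ?ans" using out2[OF refl] unfolding ans .
      let ?d = "ts c (length ?l1)"
      let ?\<mu>2 = "\<mu>2(addr 0 11 := of_bool ?ans)"
      have e: "evb inp \<mu>2 (LoadL 7 0) (of_bool ?ans) 1"
        by (rule evb_rules | use out2 in simp)+
      show "wp W inp (Seq (SetL 0 11 (LoadL 7 0)) (Seq (Pass U inc) (Cond (var 11) Brute Skip))) \<Phi> \<mu>2 (a1 + 2 + ?d)"
      proof (rule wp_Seq, rule wp_SetL'[OF e], simp, simp, rule wp_Seq, rule wp_Pass[OF q t bi bj, folded c_def])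
        show "ops c = ?l2 @ ?p2 @ suf" using ops by simp
        show "arr ?\<mu>2 0 10 = c * S" "inv ?\<mu>2 (adv prog c ?l2)" "at_block ?\<mu>2 q t bi bj"
          using inv2 fr2 fr1(3) ab by (auto simp: inv_def at_block_def)
        show "arr ?\<mu>2 3 (bi * k + i) = of_bool (row_known c t i)" if "i < k" for i
          using res block_index[OF bi that] lim[OF that] fr1 fr2 by (simp add: resf_def x_eq)
        show "arr ?\<mu>2 2 (bj * k + i) = of_bool (vec_bit c t i)" if "i < k" for i
          using vec[OF block_index[OF bj that]] fr1 fr2 by (simp add: w_eq)
        fix \<mu>3 a3 assume inv3: "inv \<mu>3 (adv prog c ?l3)" and fr3: "arr \<mu>3 2 = arr ?\<mu>2 2" "arr \<mu>3 3 = arr ?\<mu>2 3"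
          "\<And>v. v \<noteq> 6 \<Longrightarrow> arr \<mu>3 0 v = arr ?\<mu>2 0 v"
          and a3: "a3 + pot (adv prog c ?l2) \<le> a1 + 2 + ?d + 1 + 8 * k + 2 + pot (adv prog c ?l3)"
        have pl2: "pot (adv prog c ?l2) = pot (adv prog c ?l1) + ?d" by (rule pot_adv[OF c])
        note total = arith[OF a1 a3 pl2]
        have v11: "evb inp \<mu>3 (var 11) (of_bool ?ans) 1"
          by (rule evb_rules | use fr3(3)[of 11] in simp)+
        have fr: "arr \<mu>3 2 = arr \<mu>0 2" "arr \<mu>3 3 = arr \<mu>0 3"
          "\<And>v. v \<notin> {6, 10, 11} \<Longrightarrow> arr \<mu>3 0 v = arr \<mu>0 0 v"
          using fr1 fr2 fr3 by auto
        show "wp W inp (Cond (var 11) Brute Skip) \<Phi> \<mu>3 a3"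
        proof (rule wp_Cond'[OF v11])
          assume "of_bool ?ans \<noteq> (0 :: nat)"
          then have ?ans by (rule of_bool_nonzeroD)
          then obtain i j where ij: "i < k" "j < k" "\<not> row_known c t i" "mb c i j" "vec_bit c t j" by blast
          have "hit r (bi * k + i) (Suc bj * k)"
            unfolding hit_def using ij by (intro exI[of _ "bj * k + j"]) (auto simp: mb_def cid w_eq)
          then have one: "ones r (limf bi bj) + 1 \<le> ones r (limf bi (Suc bj))"
            using ones_strict[of "limf bi bj" "limf bi (Suc bj)", OF lim_le block_index[OF bi ij(1)], of r] ij lim[OF ij(1)]
            by (simp add: x_eq limf_def)
          show "wp W inp Brute \<Phi> \<mu>3 (a3 + 1)"
          proof (rule wp_Brute[OF bi bj inv3])
            show "at_block \<mu>3 q t bi bj" using ab fr by (simp add: at_block_def)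
            show "resf \<mu>3 r (limf bi bj)" using res fr by (simp add: resf_def)
            show "arr \<mu>3 2 j = of_bool (vpad r j)" if "j < D" for j using vec[OF that] fr by simp
            fix \<mu>4 a4 assume h: "inv \<mu>4 (adv prog c ?l3)" "arr \<mu>4 2 = arr \<mu>3 2"
              "\<And>v. v \<noteq> 5 \<Longrightarrow> v \<noteq> 6 \<Longrightarrow> arr \<mu>4 0 v = arr \<mu>3 0 v" "resf \<mu>4 r (limf bi (Suc bj))"
              "a4 \<le> a3 + 1 + 10 * k * k"
            have "10 * k * k * ones r (limf bi bj) + 10 * k * k \<le> 10 * k * k * ones r (limf bi (Suc bj))"
              using mult_le_mono2[OF one, of "10 * k * k"] by (simp only: distrib_left mult_1_right)
            then have "a4 + 10 * k * k * ones r (limf bi bj) \<le> a3 + 2 + 10 * k * k * ones r (limf bi (Suc bj))"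
              using h(5) by linarith
            from total[OF this] show "\<Phi> \<mu>4 a4"
              by (intro post) (use h fr l3 in auto)
          qed
        next
          assume "of_bool ?ans = (0 :: nat)"
          then have na: "\<not> ?ans" by (rule of_bool_zeroD)
          have "hit r y (limf bi (Suc bj) y) = hit r y (limf bi bj y)" if "y < D" for y
          proof (cases "y div k = bi")
            case True
            then have y: "y = bi * k + y mod k" "y mod k < k" using k1 by auto
            have "hit r y (bj * k)" if h: "hit r y (Suc bj * k)"
            proof (rule ccontr)
              assume nh: "\<not> hit r y (bj * k)"
              obtain z where z: "z < Suc bj * k" "Mpad y z" "vpad r z" using h unfolding hit_def by blast
              \<comment> \<open>So the first hit of this row falls into the current block, which
                contradicts the negative answer.\<close>
              then have "\<not> z < bj * k" using nh unfolding hit_def by blast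
              then have "z = bj * k + (z - bj * k)" "z - bj * k < k" using z(1) by auto
              then have "mb c (y mod k) (z - bj * k)" "vec_bit c t (z - bj * k)" "\<not> row_known c t (y mod k)"
                using z y nh by (simp_all add: mb_def cid w_eq x_eq)
              then show False using na y(2) \<open>z - bj * k < k\<close> by blast
            qed
            then show ?thesis using True hit_mono[of r y "bj * k" "Suc bj * k"] by (auto simp: limf_def)
          qed (simp add: limf_def)
          then have res': "resf \<mu>3 r (limf bi (Suc bj))" using res fr by (simp add: resf_def)
          have "ones r (limf bi bj) \<le> ones r (limf bi (Suc bj))" by (rule ones_mono[OF lim_le])
          then have "a3 + 1 + 1 + 10 * k * k * ones r (limf bi bj) \<le> a3 + 2 + 10 * k * k * ones r (limf bi (Suc bj))"
            using mult_le_mono2 by simp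
          from total[OF this] show "wp W inp Skip \<Phi> \<mu>3 (a3 + 1)"
            by (intro wp_Skip post) (use inv3 fr l3 res' in auto)
        qed
      qed
    qed
  qed
qed

end

section \<open>Processing a vector and the whole query phase\<close>

context reduction_runs
begin

text \<open>Progress after \<open>r\<close> vectors and the first \<open>m\<close> blocks of the next one.\<close>

definition progress :: "nat \<Rightarrow> nat \<Rightarrow> nat \<Rightarrow> nat" where
  "progress r m c = (if c < B * B * B
     then Suc (length (served c (min k ((r + of_bool (c mod (B * B) < m)) - cq c * k)))) else 0)"

lemma progress_next: "progress r (B * B) = progress (Suc r) 0"
  using B1 by (auto simp: progress_def fun_eq_iff)

text \<open>In \<open>progress\<close>, truncated subtraction gives 0 for later groups of vectors
  and the minimum with \<open>k\<close> caps earlier ones. Hence treating a block affects only the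
  copy of the current group for that block.\<close>

lemma progress_step:
  fixes q t bi bj
  defines "c \<equiv> (q * B + bi) * B + bj" and "r \<equiv> q * k + t"
  assumes q: "q < B" and t: "t < k" and bi: "bi < B" and bj: "bj < B"
  shows "progress r (bi * B + bj) = adv (progress r (bi * B + bj)) c (served c t)"
    and "progress r (Suc (bi * B + bj)) = adv (progress r (bi * B + bj)) c (served c (Suc t))"
proof -
  let ?m = "bi * B + bj"
  have c: "c < B * B * B" unfolding c_def using q bi bj by (rule copy_lt)
  have cid: "cq c = q" unfolding c_def using copy_id[OF bi bj] by auto
  have "?m < B * B" using bi bj by (rule grid_index)
  moreover have c_eq: "c = q * (B * B) + ?m" by (simp add: c_def algebra_simps)
  ultimately have cm: "c mod (B * B) = ?m" by simp
  show "progress r ?m = adv (progress r ?m) c (served c t)"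
    using c cm cid t by (auto simp: progress_def adv_def fun_eq_iff r_def)
  show "progress r (Suc ?m) = adv (progress r ?m) c (served c (Suc t))"
  proof
    fix d
    show "progress r (Suc ?m) d = adv (progress r ?m) c (served c (Suc t)) d"
    proof (cases "d = c")
      case True
      then show ?thesis using c cm cid t by (simp add: progress_def adv_def r_def)
    next
      case False
      show ?thesis
      proof (cases "d mod (B * B) = ?m")
        case True
        then have "cq d \<noteq> q" using False c_eq div_mult_mod_eq[of d "B * B"] unfolding cq_def by metis
        then consider "cq d < q" | "q < cq d" by linarith
        then have "min k (Suc r - cq d * k) = min k (r - cq d * k)"
        proof cases
          case 1
          then have "Suc (cq d) * k \<le> q * k" by (intro mult_le_mono) auto
          then show ?thesis by (simp add: r_def)
        next
          case 2
          then have "Suc q * k \<le> cq d * k" by (intro mult_le_mono) auto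
          then show ?thesis using t by (simp add: r_def)
        qed
        then show ?thesis using False True by (simp add: progress_def adv_def)
      next
        case neq: False
        then have "(d mod (B * B) < Suc ?m) = (d mod (B * B) < ?m)" by auto
        then show ?thesis using False by (simp add: progress_def adv_def)
      qed
    qed
  qed
qed

text \<open>Finishing a block row reaches column \<open>B * k\<close>, which is the full width
  \<open>D\<close>.\<close>

lemma limf_wrap: "limf bi B = limf (Suc bi) 0"
  by (auto simp: limf_def D_def fun_eq_iff)

definition block_cost :: nat where "block_cost = 16 * k + 23"

text \<open>The search potential is summed over all blocks of the vector and telescopes, so all
  searches together contribute \<open>10 * k * k * D\<close> once, not once per block.\<close>

lemma wp_blocks:
  fixes q t
  defines "r \<equiv> q * k + t"
  assumes q: "q < B" and t: "t < k"
    and inv: "inv \<mu>0 (progress r 0)" and v2: "arr \<mu>0 0 2 = q" and v8: "arr \<mu>0 0 8 = t"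
    and vec: "\<And>j. j < D \<Longrightarrow> arr \<mu>0 2 j = of_bool (vpad r j)" and res: "\<And>i. i < D \<Longrightarrow> arr \<mu>0 3 i = 0"
    and post: "\<And>\<mu> a. inv \<mu> (progress (Suc r) 0) \<Longrightarrow> arr \<mu> 2 = arr \<mu>0 2 \<Longrightarrow> arr \<mu> 0 9 = arr \<mu>0 0 9 \<Longrightarrow>
      (\<And>i. i < D \<Longrightarrow> arr \<mu> 3 i = of_bool (hit r i D)) \<Longrightarrow>
      a + pot (progress r 0) \<le> a0 + (B * (B * block_cost + 4) + 2 + 10 * k * k * D) + pot (progress (Suc r) 0) \<Longrightarrow> \<Phi> \<mu> a"
  shows "wp W inp (For 3 2 (For 4 2 (Block inc U Q))) \<Phi> \<mu>0 a0"
proof -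
  let ?fr = "\<lambda>\<mu>. arr \<mu> 2 = arr \<mu>0 2 \<and> arr \<mu> 0 2 = q \<and> arr \<mu> 0 8 = t \<and> arr \<mu> 0 9 = arr \<mu>0 0 9"
  let ?o = "\<lambda>bi bj. 10 * k * k * ones r (limf bi bj)"
  let ?I = "\<lambda>bi \<mu> a. inv \<mu> (progress r (bi * B)) \<and> ?fr \<mu> \<and> resf \<mu> r (limf bi 0) \<and>
    a + pot (progress r 0) \<le> a0 + 1 + bi * (B * block_cost + 4) + pot (progress r (bi * B)) + ?o bi 0"
  show ?thesis
  proof (rule wp_For'[where I = ?I and m = B])
    have "limf 0 0 y = 0" for y by (simp add: limf_def)
    then show "?I 0 (\<mu>0(addr 0 3 := 0)) (a0 + 1)"
      using inv v2 v8 res by (auto simp: inv_def resf_def hit_def)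
    show "arr \<mu> 6 2 = B" if "?I j \<mu> a" for j \<mu> a using that by (simp add: inv_def)
    show "\<Phi> \<mu> (a + 1)" if I: "?I B \<mu> a" for \<mu> a
    proof (rule post)
      have "limf B 0 y = D" if "y < D" for y
        using that by (simp add: limf_def D_def less_mult_imp_div_less)
      then show "arr \<mu> 3 i = of_bool (hit r i D)" if "i < D" for i using that I by (simp add: resf_def)
      have "?o B 0 \<le> 10 * k * k * D" using ones_le[of r "limf B 0"] by simp
      moreover have "a + pot (progress r 0) \<le> a0 + 1 + B * (B * block_cost + 4) + pot (progress (Suc r) 0) + ?o B 0"
        using I unfolding progress_next by blast
      ultimately show "a + 1 + pot (progress r 0) \<le> a0 + (B * (B * block_cost + 4) + 2 + 10 * k * k * D) + pot (progress (Suc r) 0)"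
        by linarith
    qed (use I progress_next in auto)
  next
    fix bi \<mu> a assume bi: "bi < B" and I: "?I bi \<mu> a" and v3: "arr \<mu> 0 3 = bi"
    let ?J = "\<lambda>bj \<mu> a. inv \<mu> (progress r (bi * B + bj)) \<and> ?fr \<mu> \<and> arr \<mu> 0 3 = bi \<and> resf \<mu> r (limf bi bj) \<and>
      a + pot (progress r 0) \<le> a0 + 1 + bi * (B * block_cost + 4) + 2 + bj * block_cost + pot (progress r (bi * B + bj)) + ?o bi bj"
    show "wp W inp (For 4 2 (Block inc U Q))
        (\<lambda>\<mu>' a'. arr \<mu>' 0 3 = bi \<and> ?I (Suc bi) (\<mu>'(addr 0 3 := Suc bi)) (a' + 1)) \<mu> (a + 1)"
    proof (rule wp_For'[where I = ?J and m = B])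
      show "?J 0 (\<mu>(addr 0 4 := 0)) (a + 1 + 1)"
        using I v3 by (auto simp: inv_def resf_def)
      show "arr \<mu> 6 2 = B" if "?J j \<mu> a" for j \<mu> a using that by (simp add: inv_def)
      show "arr \<mu>' 0 3 = bi \<and> ?I (Suc bi) (\<mu>'(addr 0 3 := Suc bi)) (a' + 1 + 1)" if J: "?J B \<mu>' a'" for \<mu>' a'
      proof -
        have "bi * B + B = Suc bi * B" by simp
        then have "a' + pot (progress r 0) \<le> a0 + 1 + bi * (B * block_cost + 4) + 2 + B * block_cost + pot (progress r (Suc bi * B)) + ?o (Suc bi) 0"
          using J unfolding limf_wrap by metis
        then have "a' + 1 + 1 + pot (progress r 0) \<le> a0 + 1 + Suc bi * (B * block_cost + 4) + pot (progress r (Suc bi * B)) + ?o (Suc bi) 0"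
          by simp
        then show ?thesis using J unfolding limf_wrap by (auto simp: inv_def resf_def add.commute)
      qed
    next
      fix bj \<mu> a assume bj: "bj < B" and J: "?J bj \<mu> a" and v4: "arr \<mu> 0 4 = bj"
      let ?c = "(q * B + bi) * B + bj"
      note s1 = progress_step(1)[OF q t bi bj, folded r_def] and s2 = progress_step(2)[OF q t bi bj, folded r_def]
      show "wp W inp (Block inc U Q)
        (\<lambda>\<mu>' a'. arr \<mu>' 0 4 = bj \<and> ?J (Suc bj) (\<mu>'(addr 0 4 := Suc bj)) (a' + 1)) \<mu> (a + 1)"
      proof (rule wp_Block[OF q t bi bj, folded r_def])
        show "inv \<mu> (adv (progress r (bi * B + bj)) ?c (served ?c t))" using J s1 by metis
        show "at_block \<mu> q t bi bj" using J v4 by (simp add: at_block_def)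
        show "arr \<mu> 2 j = of_bool (vpad r j)" if "j < D" for j using J vec[OF that] by simp
        show "resf \<mu> r (limf bi bj)" using J by blast
        fix \<mu>' a' assume h: "inv \<mu>' (adv (progress r (bi * B + bj)) ?c (served ?c (Suc t)))" "arr \<mu>' 2 = arr \<mu> 2"
          "\<And>v. v \<notin> {5, 6, 10, 11} \<Longrightarrow> arr \<mu>' 0 v = arr \<mu> 0 v" "resf \<mu>' r (limf bi (Suc bj))"
          and a': "a' + pot (adv (progress r (bi * B + bj)) ?c (served ?c t)) + ?o bi bj \<le> a + 1 + (16 * k + 20) +
            pot (adv (progress r (bi * B + bj)) ?c (served ?c (Suc t))) + ?o bi (Suc bj)"
        have "a' + pot (progress r (bi * B + bj)) + ?o bi bj \<le> a + 1 + (16 * k + 20) + pot (progress r (bi * B + Suc bj)) + ?o bi (Suc bj)"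
          using a' s1 s2 by simp
        moreover have "a + pot (progress r 0) \<le> a0 + 1 + bi * (B * block_cost + 4) + 2 + bj * block_cost + pot (progress r (bi * B + bj)) + ?o bi bj"
          using J by blast
        ultimately have "a' + 1 + pot (progress r 0) \<le> a0 + 1 + bi * (B * block_cost + 4) + 2 + Suc bj * block_cost + pot (progress r (bi * B + Suc bj)) + ?o bi (Suc bj)"
          by (simp add: block_cost_def)
        moreover have "inv (\<mu>'(addr 0 4 := Suc bj)) (progress r (bi * B + Suc bj))" using h(1) s2 by (simp add: inv_def)
        ultimately show "arr \<mu>' 0 4 = bj \<and> ?J (Suc bj) (\<mu>'(addr 0 4 := Suc bj)) (a' + 1)"
          using J v4 h by (simp add: resf_def)
      qed
    qed (use k_le_D in auto)
  qed (use k_le_D in auto)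
qed

text \<open>Argued on \<open>exec\<close> directly, since this loop produces output.\<close>

lemma exec_emit_loop:
  assumes "arr \<mu> 6 0 = n" "\<And>i. i < n \<Longrightarrow> arr \<mu> 3 i \<le> 1"
  shows "\<exists>\<mu>'. exec W inp (For 0 0 (Emit (LoadX 3 (var 0)))) \<mu> (3 * n + 2) \<mu>' (map (arr \<mu> 3) [0..<n]) \<and>
    (\<forall>t<8. t \<noteq> 0 \<longrightarrow> arr \<mu>' t = arr \<mu> t) \<and> (\<forall>v. v \<noteq> 0 \<longrightarrow> arr \<mu>' 0 v = arr \<mu> 0 v)"
proof -
  let ?w = "While (Bin Lt (var 0) nE) (Seq (Emit (LoadX 3 (var 0))) (SetL 0 0 (var 0 \<oplus> Const 1)))"
  have loop: "\<exists>\<mu>'. exec W inp ?w \<nu> (3 * (n - i) + 1) \<mu>' (map (arr \<mu> 3) [i..<n]) \<and>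
    (\<forall>t<8. t \<noteq> 0 \<longrightarrow> arr \<mu>' t = arr \<mu> t) \<and> (\<forall>v. v \<noteq> 0 \<longrightarrow> arr \<mu>' 0 v = arr \<mu> 0 v)"
    if "i \<le> n" "arr \<nu> 0 0 = i" "\<forall>t<8. t \<noteq> 0 \<longrightarrow> arr \<nu> t = arr \<mu> t" "\<forall>v. v \<noteq> 0 \<longrightarrow> arr \<nu> 0 v = arr \<mu> 0 v" for i \<nu>
    using that
  proof (induction "n - i" arbitrary: i \<nu>)
    case 0
    have "evb inp \<nu> (Bin Lt (var 0) nE) (of_bool (i < n)) 1"
      by (rule evb_rules | use 0 assms in simp)+
    then have "eval W inp \<nu> (Bin Lt (var 0) nE) = Some (of_bool (i < n))" by (rule evalI)
    then have "eval W inp \<nu> (Bin Lt (var 0) nE) = Some 0" using "0.hyps" by (simp del: eval.simps)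
    then have "exec W inp ?w \<nu> 1 \<nu> []" by (rule exec.While_False)
    then show ?case using 0 by (intro exI[of _ \<nu>]) auto
  next
    case (Suc d)
    then have i: "i < n" by simp
    have "evb inp \<nu> (Bin Lt (var 0) nE) (of_bool (i < n)) 1"
      by (rule evb_rules | use Suc.prems assms in simp)+
    then have "eval W inp \<nu> (Bin Lt (var 0) nE) = Some (of_bool (i < n))" by (rule evalI)
    then have e1: "eval W inp \<nu> (Bin Lt (var 0) nE) = Some 1" using i by (simp del: eval.simps)
    have "evb inp \<nu> (LoadX 3 (var 0)) (arr \<mu> 3 i) 1"
      by (rule evb_rules | use Suc.prems assms i in \<open>simp add: K_def\<close>)+
    then have e2: "exec W inp (Emit (LoadX 3 (var 0))) \<nu> 1 \<nu> [arr \<mu> 3 i]" by (intro exec.Emit evalI)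
    have "evb inp \<nu> (var 0 \<oplus> Const 1) (i + 1) (1 + 5 + 1)"
      by (rule evb_rules | use Suc.prems assms i in \<open>simp add: K_def\<close>)+
    then have e3: "exec W inp (SetL 0 0 (var 0 \<oplus> Const 1)) \<nu> 1 (\<nu>(addr 0 0 := i + 1)) []"
      unfolding SetL_def using addr_const[of 0 0] by (intro exec.Store eval_Const evalI) auto
    have "\<exists>\<mu>'. exec W inp ?w (\<nu>(addr 0 0 := i + 1)) (3 * (n - (i + 1)) + 1) \<mu>' (map (arr \<mu> 3) [i + 1..<n]) \<and>
      (\<forall>t<8. t \<noteq> 0 \<longrightarrow> arr \<mu>' t = arr \<mu> t) \<and> (\<forall>v. v \<noteq> 0 \<longrightarrow> arr \<mu>' 0 v = arr \<mu> 0 v)"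
      by (rule Suc.hyps(1)) (use Suc i in auto)
    then obtain \<mu>' where m: "exec W inp ?w (\<nu>(addr 0 0 := i + 1)) (3 * (n - (i + 1)) + 1) \<mu>' (map (arr \<mu> 3) [i + 1..<n])"
      "\<forall>t<8. t \<noteq> 0 \<longrightarrow> arr \<mu>' t = arr \<mu> t" "\<forall>v. v \<noteq> 0 \<longrightarrow> arr \<mu>' 0 v = arr \<mu> 0 v" by blast
    have x: "exec W inp ?w \<nu> (1 + (1 + 1) + (3 * (n - (i + 1)) + 1)) \<mu>' (([arr \<mu> 3 i] @ []) @ map (arr \<mu> 3) [i + 1..<n])"
      by (rule exec.While_True[OF e1 _ exec.Seq[OF e2 e3] m(1)]) simp
    have "1 + (1 + 1) + (3 * (n - (i + 1)) + 1) = 3 * (n - i) + 1" using i by simp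
    moreover have "([arr \<mu> 3 i] @ []) @ map (arr \<mu> 3) [i + 1..<n] = map (arr \<mu> 3) [i..<n]"
      using i by (simp add: upt_conv_Cons)
    ultimately show ?case using x m by metis
  qed
  obtain \<mu>' where m: "exec W inp ?w (\<mu>(addr 0 0 := 0)) (3 * (n - 0) + 1) \<mu>' (map (arr \<mu> 3) [0..<n])"
      "\<forall>t<8. t \<noteq> 0 \<longrightarrow> arr \<mu>' t = arr \<mu> t" "\<forall>v. v \<noteq> 0 \<longrightarrow> arr \<mu>' 0 v = arr \<mu> 0 v"
    using loop[of 0 "\<mu>(addr 0 0 := 0)"] by auto
  have "exec W inp (SetL 0 0 (Const 0)) \<mu> 1 (\<mu>(addr 0 0 := 0)) []"
    unfolding SetL_def using addr_const[of 0 0] const_W[of 0] by (intro exec.Store eval_Const) auto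
  from exec.Seq[OF this m(1)] have "exec W inp (For 0 0 (Emit (LoadX 3 (var 0)))) \<mu> (3 * n + 2) \<mu>' (map (arr \<mu> 3) [0..<n])"
    by (simp add: For_def)
  then show ?thesis using m by blast
qed

text \<open>The last conjunct is the zero padding of the vector: it holds initially and persists
  because queries write only below \<open>n\<close>.\<close>

definition query_inv :: "nat \<Rightarrow> memory \<Rightarrow> bool" where
  "query_inv r \<mu> \<longleftrightarrow> inv \<mu> (progress r 0) \<and> arr \<mu> 0 9 = r \<and> (\<forall>j\<ge>n. arr \<mu> 2 j = 0)"

definition query_overhead :: nat where
  "query_overhead = 6 * n + 3 * D + 11 + B * (B * block_cost + 4) + 10 * k * k * D"

text \<open>The summand \<open>3 * n + 2\<close> reserves the time of the output loop within
  \<open>query_overhead\<close>.\<close>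

lemma wp_body:
  assumes r: "r < n" and Q: "query_inv r \<mu>0"
    and post: "\<And>\<mu> a. query_inv (Suc r) \<mu> \<Longrightarrow> (\<And>i. i < D \<Longrightarrow> arr \<mu> 3 i = of_bool (hit r i D)) \<Longrightarrow>
      a + pot (progress r 0) + 3 * n + 2 \<le> a0 + query_overhead + pot (progress (Suc r) 0) \<Longrightarrow> \<Phi> \<mu> a"
  shows "wp W (encode_vec n (vs ! r)) (OMv_body inc U Q) \<Phi> \<mu>0 a0"
proof -
  let ?inp = "encode_vec n (vs ! r)"
  have inp: "length ?inp = n" "\<And>i. i < n \<Longrightarrow> ?inp ! i = of_bool (vpad r i)"
    using r by (auto simp: encode_vec_def vpad_def)
  let ?q = "r div k" and ?t = "r mod k"
  have q: "?q < B" using r by (simp add: B_def div_le_mono less_Suc_eq_le)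
  have t: "?t < k" using k1 by simp
  have r_eq: "?q * k + ?t = r" by simp
  have inv0: "inv \<mu>0 (progress r 0)" "arr \<mu>0 0 9 = r" "\<And>j. n \<le> j \<Longrightarrow> arr \<mu>0 2 j = 0" using Q by (auto simp: query_inv_def)
  let ?I1 = "\<lambda>i \<mu> a. inv \<mu> (progress r 0) \<and> arr \<mu> 0 9 = r \<and> (\<forall>j<i. arr \<mu> 2 j = of_bool (vpad r j)) \<and>
    (\<forall>j\<ge>n. arr \<mu> 2 j = 0) \<and> a \<le> a0 + 1 + 3 * i"
  let ?V = "\<lambda>\<mu>. inv \<mu> (progress r 0) \<and> arr \<mu> 0 9 = r \<and> arr \<mu> 2 = (\<lambda>j. of_bool (vpad r j))"
  let ?I2 = "\<lambda>i \<mu> a. ?V \<mu> \<and> (\<forall>j<i. arr \<mu> 3 j = 0) \<and> a \<le> a0 + 3 + 3 * n + 3 * i"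
  have le: "r \<le> Suc n" "k \<le> Suc n" using r k_le_n by auto
  show ?thesis
    unfolding OMv_body_def
  proof (rule wp_Seq'[where \<Psi> = "\<lambda>\<mu> a. ?V \<mu> \<and> a \<le> a0 + 2 + 3 * n"], rule wp_For'[where I = ?I1 and m = n])
    show "?I1 0 (\<mu>0(addr 0 0 := 0)) (a0 + 1)" using inv0 by (auto simp: inv_def)
    show "arr \<mu> 6 0 = n" if "?I1 j \<mu> a" for j \<mu> a using that by (simp add: inv_def)
    show "?V \<mu> \<and> a + 1 \<le> a0 + 2 + 3 * n" if "?I1 n \<mu> a" for \<mu> a
    proof -
      have "arr \<mu> 2 j = of_bool (vpad r j)" for j
        using that by (cases "j < n") (auto simp: vpad_def)
      then show ?thesis using that by auto
    qed
  next
    fix i \<mu> a assume i: "i < n" and I: "?I1 i \<mu> a" and v0: "arr \<mu> 0 0 = i"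
    have e1: "evb ?inp \<mu> (var 0) i 1" by (rule evb_rules | use v0 i in simp)+
    have e2: "evb ?inp \<mu> (Input (var 0)) (of_bool (vpad r i)) 1"
      using evalI[OF e1] inp i const_W[of 1] const_W[of 0] H3 by (simp add: evb_def word_def)
    show "wp W ?inp (SetX 2 (var 0) (Input (var 0)))
      (\<lambda>\<mu>' a'. arr \<mu>' 0 0 = i \<and> ?I1 (Suc i) (\<mu>'(addr 0 0 := Suc i)) (a' + 1)) \<mu> (a + 1)"
      by (rule wp_SetX'[OF e1 _ _ e2]) (use I v0 i in \<open>auto simp: K_def inv_def less_Suc_eq\<close>)
  next
    fix \<mu>1 a1 assume V1: "?V \<mu>1 \<and> a1 \<le> a0 + 2 + 3 * n"
    let ?c = "Seq (SetL 0 2 (Bin Quot (var 9) kE)) (Seq (SetL 0 8 (Bin Rem (var 9) kE)) (Seq (SetL 0 9 (var 9 \<oplus> Const 1))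
     (For 3 2 (For 4 2 (Block inc U Q)))))"
    show "wp W ?inp (Seq (For 0 3 (SetX 3 (var 0) (Const 0))) ?c) \<Phi> \<mu>1 a1"
    proof (rule wp_Seq'[where \<Psi> = "\<lambda>\<mu> a. ?V \<mu> \<and> (\<forall>j<D. arr \<mu> 3 j = 0) \<and> a \<le> a0 + 4 + 3 * n + 3 * D"],
        rule wp_For'[where I = ?I2 and m = D])
      show "?I2 0 (\<mu>1(addr 0 0 := 0)) (a1 + 1)" using V1 by (auto simp: inv_def)
      show "arr \<mu> 6 3 = D" if "?I2 j \<mu> a" for j \<mu> a using that by (simp add: inv_def)
      show "?V \<mu> \<and> (\<forall>j<D. arr \<mu> 3 j = 0) \<and> a + 1 \<le> a0 + 4 + 3 * n + 3 * D" if "?I2 D \<mu> a" for \<mu> a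
        using that by auto
    next
      fix i \<mu> a assume i: "i < D" and I: "?I2 i \<mu> a" and v0: "arr \<mu> 0 0 = i"
      have e1: "evb ?inp \<mu> (var 0) i 2"
        using i D_lt v0 less_W[of i 2] addr_const[of 0 0] by (auto simp: evb_def K_def intro!: eval_LoadL)
      show "wp W ?inp (SetX 3 (var 0) (Const 0))
        (\<lambda>\<mu>' a'. arr \<mu>' 0 0 = i \<and> ?I2 (Suc i) (\<mu>'(addr 0 0 := Suc i)) (a' + 1)) \<mu> (a + 1)"
        by (rule wp_SetX'[OF e1 _ _ evb_Const[of 0]]) (use I v0 i in \<open>auto simp: K_def inv_def less_Suc_eq\<close>)
    next
      fix \<mu>2 a2 assume V2: "?V \<mu>2 \<and> (\<forall>j<D. arr \<mu>2 3 j = 0) \<and> a2 \<le> a0 + 4 + 3 * n + 3 * D"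
      have p2: "arr \<mu>2 6 = par" using V2 by (simp add: inv_def)
      have e1: "evb ?inp \<mu>2 (Bin Quot (var 9) kE) ?q 1"
        by (rule evb_rules | use V2 p2 le in \<open>simp add: K_def\<close>)+
      have e2: "evb ?inp (\<mu>2(addr 0 2 := ?q)) (Bin Rem (var 9) kE) ?t 1"
        by (rule evb_rules | use V2 p2 le in \<open>simp add: K_def\<close>)+
      have e3: "evb ?inp (\<mu>2(addr 0 2 := ?q, addr 0 8 := ?t)) (var 9 \<oplus> Const 1) (r + 1) (1 + 5 + 1)"
        by (rule evb_rules | use V2 p2 le in \<open>simp add: K_def\<close>)+
      let ?\<mu> = "\<mu>2(addr 0 2 := ?q, addr 0 8 := ?t, addr 0 9 := r + 1)"
      have "wp W ?inp (For 3 2 (For 4 2 (Block inc U Q))) \<Phi> ?\<mu> (a2 + 1 + 1 + 1)"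
      proof (rule wp_blocks[OF q t, unfolded r_eq])
        show "inv ?\<mu> (progress r 0)" using V2 by (simp add: inv_def)
        fix \<mu> a assume h: "inv \<mu> (progress (Suc r) 0)" "arr \<mu> 2 = arr ?\<mu> 2" "arr \<mu> 0 9 = arr ?\<mu> 0 9"
          "\<And>i. i < D \<Longrightarrow> arr \<mu> 3 i = of_bool (hit r i D)"
          "a + pot (progress r 0) \<le> a2 + 1 + 1 + 1 + (B * (B * block_cost + 4) + 2 + 10 * k * k * D) + pot (progress (Suc r) 0)"
        show "\<Phi> \<mu> a"
        proof (rule post)
          show "query_inv (Suc r) \<mu>" unfolding query_inv_def using h V2 by (auto simp: vpad_def)
          have "a2 \<le> a0 + 4 + 3 * n + 3 * D" using V2 by blast
          then show "a + pot (progress r 0) + 3 * n + 2 \<le> a0 + query_overhead + pot (progress (Suc r) 0)"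
            using h(5) unfolding query_overhead_def by linarith
        qed (use h in auto)
      qed (use V2 in auto)
      then show "wp W ?inp ?c \<Phi> \<mu>2 a2"
        by (intro wp_Seq wp_SetL'[OF e1] wp_SetL'[OF e2] wp_SetL'[OF e3]) auto
    qed (use k_le_D in auto)
  qed (use k_le_D in auto)
qed

lemma exec_query:
  assumes r: "r < n" and Q: "query_inv r \<mu>0"
  shows "\<exists>\<tau> \<mu>. exec W (encode_vec n (vs ! r)) (OMv_query inc U Q) \<mu>0 \<tau> \<mu> (encode_vec n (bool_mult_vec n M (vs ! r))) \<and>
    query_inv (Suc r) \<mu> \<and> \<tau> + pot (progress r 0) \<le> query_overhead + pot (progress (Suc r) 0)"
proof -
  have "wp W (encode_vec n (vs ! r)) (OMv_body inc U Q) (\<lambda>\<mu> a. query_inv (Suc r) \<mu> \<and> (\<forall>i<D. arr \<mu> 3 i = of_bool (hit r i D)) \<and>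
      a + pot (progress r 0) + 3 * n + 2 \<le> 0 + query_overhead + pot (progress (Suc r) 0)) \<mu>0 0"
    by (rule wp_body[OF r Q]) auto
  then obtain \<tau> \<mu> where 1: "exec W (encode_vec n (vs ! r)) (OMv_body inc U Q) \<mu>0 \<tau> \<mu> []" "query_inv (Suc r) \<mu>"
    "\<forall>i<D. arr \<mu> 3 i = of_bool (hit r i D)" "\<tau> + pot (progress r 0) + 3 * n + 2 \<le> query_overhead + pot (progress (Suc r) 0)"
    unfolding wp_def by auto
  have res: "arr \<mu> 3 i = of_bool (bool_mult_vec n M (vs ! r) i)" if "i < n" for i
  proof -
    have "hit r i D \<longleftrightarrow> bool_mult_vec n M (vs ! r) i"
      using that r n_lt_D by (auto simp: hit_def bool_mult_vec_def Mpad_def vpad_def intro: less_trans)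
    then show ?thesis using 1(3) that n_lt_D by simp
  qed
  then have out: "map (arr \<mu> 3) [0..<n] = encode_vec n (bool_mult_vec n M (vs ! r))"
    by (simp add: encode_vec_def)
  have p6: "arr \<mu> 6 0 = n" using 1(2) by (simp add: query_inv_def inv_def)
  have res1: "arr \<mu> 3 i \<le> 1" if "i < n" for i using res[OF that] by simp
  obtain \<mu>' where 2: "exec W (encode_vec n (vs ! r)) (For 0 0 (Emit (LoadX 3 (var 0)))) \<mu> (3 * n + 2) \<mu>' (map (arr \<mu> 3) [0..<n])"
    "\<forall>t<8. t \<noteq> 0 \<longrightarrow> arr \<mu>' t = arr \<mu> t" "\<forall>v. v \<noteq> 0 \<longrightarrow> arr \<mu>' 0 v = arr \<mu> 0 v"
    using exec_emit_loop[of \<mu> "encode_vec n (vs ! r)", OF p6 res1] by blast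
  have "exec W (encode_vec n (vs ! r)) (OMv_query inc U Q) \<mu>0 (\<tau> + (3 * n + 2)) \<mu>' (encode_vec n (bool_mult_vec n M (vs ! r)))"
    using exec.Seq[OF 1(1) 2(1)] by (simp add: OMv_query_def out)
  moreover have "query_inv (Suc r) \<mu>'" using 1(2) 2 by (auto simp: query_inv_def inv_def)
  ultimately show ?thesis using 1(4) by (intro exI conjI) auto
qed

lemma serve_queries:
  assumes len: "length vs = n" and "r \<le> n" and "query_inv r \<mu>"
  shows "\<exists>res. serve W \<mu> (map (\<lambda>v. (OMv_query inc U Q, encode_vec n v)) (drop r vs)) res \<and>
    map snd res = map (\<lambda>v. encode_vec n (bool_mult_vec n M v)) (drop r vs) \<and>
    sum_list (map fst res) + pot (progress r 0) \<le> (n - r) * query_overhead + pot (progress n 0)"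
  using assms(2,3)
proof (induction "n - r" arbitrary: r \<mu>)
  case 0
  then have "r = n" by simp
  then show ?case using len by (auto intro: serve.Nil)
next
  case (Suc d)
  then have r: "r < n" by simp
  obtain \<tau> \<mu>' where 1: "exec W (encode_vec n (vs ! r)) (OMv_query inc U Q) \<mu> \<tau> \<mu>' (encode_vec n (bool_mult_vec n M (vs ! r)))"
    "query_inv (Suc r) \<mu>'" "\<tau> + pot (progress r 0) \<le> query_overhead + pot (progress (Suc r) 0)"
    using exec_query[OF r Suc.prems(2)] by blast
  have d': "d = n - Suc r" using Suc.hyps(2) by simp
  obtain res where 2: "serve W \<mu>' (map (\<lambda>v. (OMv_query inc U Q, encode_vec n v)) (drop (Suc r) vs)) res"
    "map snd res = map (\<lambda>v. encode_vec n (bool_mult_vec n M v)) (drop (Suc r) vs)"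
    "sum_list (map fst res) + pot (progress (Suc r) 0) \<le> (n - Suc r) * query_overhead + pot (progress n 0)"
    using Suc.hyps(1)[OF d' Suc_leI[OF r] 1(2)] by blast
  have d: "drop r vs = vs ! r # drop (Suc r) vs" using r len by (simp add: Cons_nth_drop_Suc)
  have "(n - r) * query_overhead = query_overhead + (n - Suc r) * query_overhead" using r by (metis Suc_diff_Suc mult_Suc)
  then show ?case
    using 1 2 unfolding d by (intro exI[of _ "(\<tau>, encode_vec n (bool_mult_vec n M (vs ! r))) # res"])
      (auto intro!: serve.Cons)
qed

end

section \<open>Writing the input of a copy and running its preprocessing\<close>

lemma concat_grid:
  "concat (map (\<lambda>i. concat (map (f i) [0..<k])) [0..<a]) = concat (map (\<lambda>m. f (m div k) (m mod k)) [0..<a * k])"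
proof (induction a)
  case (Suc a)
  have "map (\<lambda>m. f (m div k) (m mod k)) [a * k..<a * k + k] = map (f a) [0..<k]"
  proof -
    have "[a * k..<a * k + k] = map (\<lambda>j. j + a * k) [0..<k]" by (simp add: map_add_upt add.commute)
    then show ?thesis by (simp add: comp_def cong: map_cong)
  qed
  moreover have "[0..<Suc a * k] = [0..<a * k] @ [a * k..<a * k + k]"
    using upt_add_eq_append[of 0 "a * k" k] by (simp add: add.commute)
  ultimately show ?case using Suc by simp
qed simp

definition enc :: "edge list \<Rightarrow> nat list" where
  "enc es = concat (map (\<lambda>(u, v). [u, v]) es)"

lemma enc_simps [simp]: "enc [] = []" "enc ((u, v) # es) = u # v # enc es" "enc (es @ es') = enc es @ enc es'"
  by (auto simp: enc_def)

lemma length_enc [simp]: "length (enc es) = 2 * length es"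
  by (induction es) auto

context params
begin

lemma kk1: "1 \<le> k * k" using k1 by simp

lemma loop_overhead: "2 + k * (4 + 2 * k) \<le> 6 * k * k + 2"
  by (cases k) (auto simp: algebra_simps)

text \<open>The predicate \<open>J\<close> sees a virtual clock that does not count the loop overhead.\<close>

lemma wp_For2:
  assumes init: "J 0 \<mu> a"
    and J5: "\<And>m \<mu> a x. J m \<mu> a \<Longrightarrow> J m (\<mu>(addr 0 5 := x)) a"
    and J6: "\<And>m \<mu> a x. J m \<mu> a \<Longrightarrow> J m (\<mu>(addr 0 6 := x)) a"
    and par: "\<And>m \<mu> a. J m \<mu> a \<Longrightarrow> arr \<mu> 6 1 = k"
    and step: "\<And>i j \<mu> a. i < k \<Longrightarrow> j < k \<Longrightarrow> J (i * k + j) \<mu> a \<Longrightarrow> arr \<mu> 0 5 = i \<Longrightarrow> arr \<mu> 0 6 = j \<Longrightarrow>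
      wp W inp c (\<lambda>\<mu>' a'. arr \<mu>' 0 5 = i \<and> arr \<mu>' 0 6 = j \<and> J (Suc (i * k + j)) \<mu>' a') \<mu> a"
    and post: "\<And>\<mu> a a'. J (k * k) \<mu> a' \<Longrightarrow> a \<le> a' + (2 + k * (4 + 2 * k)) \<Longrightarrow> \<Phi> \<mu> a"
  shows "wp W inp (For 5 1 (For 6 1 c)) \<Phi> \<mu> a"
proof -
  let ?I = "\<lambda>i \<mu> a. \<exists>a'. J (i * k) \<mu> a' \<and> a \<le> a' + 1 + i * (4 + 2 * k)"
  show ?thesis
  proof (rule wp_For'[where I = ?I and m = k])
    show "?I 0 (\<mu>(addr 0 5 := 0)) (a + 1)" using J5[OF init] by auto
    show "arr \<mu> 6 1 = k" if "?I i \<mu> a" for i \<mu> a using that par by blast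
    show "\<Phi> \<mu> (a + 1)" if "?I k \<mu> a" for \<mu> a
      using that post[of \<mu> _ "a + 1"] by fastforce
  next
    fix i \<mu> a assume i: "i < k" and I: "?I i \<mu> a" and v5: "arr \<mu> 0 5 = i"
    let ?K = "\<lambda>j \<mu> a. arr \<mu> 0 5 = i \<and> (\<exists>a'. J (i * k + j) \<mu> a' \<and> a \<le> a' + 1 + i * (4 + 2 * k) + 2 + 2 * j)"
    show "wp W inp (For 6 1 c) (\<lambda>\<mu>' a'. arr \<mu>' 0 5 = i \<and> ?I (Suc i) (\<mu>'(addr 0 5 := Suc i)) (a' + 1)) \<mu> (a + 1)"
    proof (rule wp_For'[where I = ?K and m = k])
      from I obtain a' where a': "J (i * k) \<mu> a'" "a \<le> a' + 1 + i * (4 + 2 * k)" by blast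
      then have "J (i * k + 0) (\<mu>(addr 0 6 := 0)) a'" using J6 by simp
      then show "?K 0 (\<mu>(addr 0 6 := 0)) (a + 1 + 1)" using a' v5 by (auto intro!: exI[of _ a'])
      show "arr \<mu> 6 1 = k" if "?K i \<mu> a" for i \<mu> a using that par by blast
      show "arr \<mu>' 0 5 = i \<and> ?I (Suc i) (\<mu>'(addr 0 5 := Suc i)) (a' + 1 + 1)" if K: "?K k \<mu>' a'" for \<mu>' a'
      proof -
        from K obtain a'' where a'': "J (i * k + k) \<mu>' a''" "a' \<le> a'' + 1 + i * (4 + 2 * k) + 2 + 2 * k" by blast
        have "J (Suc i * k) (\<mu>'(addr 0 5 := Suc i)) a''" using J5[OF a''(1)] by (simp add: add.commute)
        moreover have "a' + 1 + 1 \<le> a'' + 1 + Suc i * (4 + 2 * k)" using a''(2) by simp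
        ultimately show ?thesis using K by blast
      qed
    next
      fix j \<mu> a assume j: "j < k" and K: "?K j \<mu> a" and v6: "arr \<mu> 0 6 = j"
      from K obtain a' where a': "J (i * k + j) \<mu> a'" "a \<le> a' + 1 + i * (4 + 2 * k) + 2 + 2 * j" by blast
      \<comment> \<open>The hypothesis is used at the virtual clock; the execution it provides does
        not depend on the clock and is replayed at the real one.\<close>
      from step[OF i j a'(1) _ v6] K obtain \<tau> \<mu>' where x: "exec W inp c \<mu> \<tau> \<mu>' []" "arr \<mu>' 0 5 = i" "arr \<mu>' 0 6 = j"
        "J (Suc (i * k + j)) \<mu>' (a' + \<tau>)" unfolding wp_def by blast
      have "J (i * k + Suc j) (\<mu>'(addr 0 6 := Suc j)) (a' + \<tau>)" using J6[OF x(4)] by simp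
      then have "?K (Suc j) (\<mu>'(addr 0 6 := Suc j)) (a + 1 + \<tau> + 1)"
        using x a'(2) by (auto intro!: exI[of _ "a' + \<tau>"])
      then show "wp W inp c (\<lambda>\<mu>' a'. arr \<mu>' 0 6 = j \<and> ?K (Suc j) (\<mu>'(addr 0 6 := Suc j)) (a' + 1)) \<mu> (a + 1)"
        unfolding wp_def using x by blast
    qed (use k_le_D in auto)
  qed (use k_le_D in auto)
qed

text \<open>As the base is at least 1, every intermediate power is at most the final one, so a
  single overflow hypothesis suffices.\<close>

lemma eval_powE: "eval W inp \<mu> e = Some x \<Longrightarrow> 1 \<le> x \<Longrightarrow> x ^ j < W \<Longrightarrow> eval W inp \<mu> (powE e j) = Some (x ^ j)"
proof (induction j)
  case 0
  then show ?case by (simp add: word_def)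
next
  case (Suc j)
  have "x ^ j \<le> x ^ Suc j" using Suc.prems by (intro power_increasing) auto
  then have "eval W inp \<mu> (powE e j) = Some (x ^ j)" using Suc by linarith
  then show ?case using Suc.prems by (simp add: word_def)
qed

definition buf :: "memory \<Rightarrow> nat list \<Rightarrow> bool" where
  "buf \<mu> xs \<longleftrightarrow> arr \<mu> 0 7 = length xs \<and> (\<forall>i<length xs. arr \<mu> 4 i = xs ! i)"

abbreviation pushed :: "memory \<Rightarrow> nat list \<Rightarrow> nat \<Rightarrow> memory" where
  "pushed \<mu> xs y \<equiv> \<mu>(addr 4 (length xs) := y, addr 0 7 := Suc (length xs))"

lemma buf_pushed: "buf \<mu> xs \<Longrightarrow> buf (pushed \<mu> xs y) (xs @ [y])"
  by (auto simp: buf_def nth_append less_Suc_eq)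

text \<open>A prediction has \<open>6 * k * k + 2\<close> words. The larger capacity lets
  \<open>PushM\<close> and \<open>PushR\<close> assume the same bound on what is already in the
  buffer, in either order.\<close>

lemma buf_bound: "8 * k * k + 10 < H ^ 6"
proof -
  have "8 * k * k + 10 \<le> 18 * (H * H)"
  proof -
    have "k * k \<le> H * H" using k_le_n by (intro mult_le_mono) (auto simp: H_def)
    moreover have "0 < H * H" using H3 by simp
    ultimately show ?thesis by linarith
  qed
  also have "\<dots> < 3 ^ 4 * (H * H)" using H3 by simp
  also have "\<dots> \<le> H ^ 4 * (H * H)" using H_pow_ge[of 4] by (intro mult_le_mono) auto
  also have "\<dots> = H ^ 6" by (simp add: power_numeral_reduce)
  finally show ?thesis .
qed

lemma wp_Push:
  assumes b: "buf \<mu> xs" and l: "length xs \<le> 8 * k * k + 9" and e: "evb inp \<mu> e y p"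
    and post: "\<Phi> (pushed \<mu> xs y) (a + 2)"
  shows "wp W inp (Push e) \<Phi> \<mu> a"
proof -
  have v: "evb inp \<nu> (var 7) (length xs) 6" if "arr \<nu> 0 7 = length xs" for \<nu>
    unfolding evb_def using l buf_bound that less_W[of "length xs" 6] addr_const[of 0 7]
    by (auto intro!: eval_LoadL simp: K_def)
  have v7: "arr \<mu> 0 7 = length xs" using b by (simp add: buf_def)
  have "evb inp (\<mu>(addr 4 (length xs) := y)) (var 7 \<oplus> Const 1) (length xs + 1) (6 + 5 + 1)"
    by (rule evb_Add[OF v evb_Const]) (use v7 in \<open>auto simp: K_def\<close>)
  from wp_SetL'[OF this, of 0 7 \<Phi> "a + 1"] post
  show ?thesis unfolding Push_def
    by (intro wp_Seq wp_SetX'[OF v[OF v7] _ _ e]) (auto simp: K_def)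
qed

end

context reduction_runs
begin

definition pinv :: "memory \<Rightarrow> memory \<Rightarrow> (nat \<Rightarrow> nat) \<Rightarrow> bool" where
  "pinv \<mu>0 \<mu> prog \<longleftrightarrow> inv \<mu> prog \<and> arr \<mu> 2 = arr \<mu>0 2 \<and> (\<forall>v. v \<notin> {5, 6, 7} \<longrightarrow> arr \<mu> 0 v = arr \<mu>0 0 v)"

lemma pinv_upd [simp]: "pinv \<mu>0 (\<mu>(addr 0 5 := x)) prog = pinv \<mu>0 \<mu> prog" "pinv \<mu>0 (\<mu>(addr 0 6 := x)) prog = pinv \<mu>0 \<mu> prog"
  "pinv \<mu>0 (\<mu>(addr 0 7 := x)) prog = pinv \<mu>0 \<mu> prog" "pinv \<mu>0 (\<mu>(addr 4 i := x)) prog = pinv \<mu>0 \<mu> prog"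
  by (auto simp: pinv_def inv_def)

lemma buf_upd [simp]: "buf (\<mu>(addr 0 5 := x)) xs = buf \<mu> xs" "buf (\<mu>(addr 0 6 := x)) xs = buf \<mu> xs"
  by (auto simp: buf_def)

text \<open>\<open>q\<close> is arbitrary: the block belonging to a copy is the same for every group
  of vectors.\<close>

lemma evb_tgtE:
  assumes "arr \<mu> 6 = par" "arr \<mu> 1 = mat_of" "arr \<mu> 0 3 = bi" "arr \<mu> 0 4 = bj" "arr \<mu> 0 5 = i" "arr \<mu> 0 6 = j"
    "bi < B" "bj < B" "i < k" "j < k"
  shows "evb inp \<mu> tgtE (snd (medge k (mb ((q * B + bi) * B + bj)) i j)) 8"
proof -
  have le: "k \<le> Suc n" "j \<le> Suc n" using k_le_n assms by auto
  have "evb inp \<mu> tgtE (2 * k + j - of_bool (Mpad (bi * k + i) (bj * k + j)) * k) (5 + 1 + 1 + 1)"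
    unfolding tgtE_def
    by (rule evb_Sub evb_Mul evb_matE[OF assms] evb_rules | use assms le in \<open>simp add: K_def\<close>)+
  moreover have "2 * k + j - of_bool (Mpad (bi * k + i) (bj * k + j)) * k = snd (medge k (mb ((q * B + bi) * B + bj)) i j)"
    using copy_id[OF assms(7,8)] by (simp add: medge_def mb_def)
  ultimately show ?thesis by simp
qed

lemma wp_PushM:
  fixes q bi bj
  defines "c \<equiv> (q * B + bi) * B + bj"
  assumes bi: "bi < B" and bj: "bj < B" and v: "arr \<mu>0 0 3 = bi" "arr \<mu>0 0 4 = bj"
    and I: "pinv \<mu>0 \<mu> prog" "buf \<mu> xs" and l: "length xs \<le> 4 * k * k + 2"
    and post: "\<And>\<mu> a. pinv \<mu>0 \<mu> prog \<Longrightarrow> buf \<mu> (xs @ enc (medges k (mb c))) \<Longrightarrow> a \<le> a0 + 10 * k * k + 2 \<Longrightarrow> \<Phi> \<mu> a"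
  shows "wp W inp PushM \<Phi> \<mu> a0"
proof -
  \<comment> \<open>The double loop is flattened to a single index through
    \<open>concat_grid\<close>, so that the invariant speaks of a prefix of the edge list.\<close>
  let ?e = "\<lambda>m. concat (map (\<lambda>m. [medge k (mb c) (m div k) (m mod k)]) [0..<m])"
  let ?J = "\<lambda>m \<mu> a. pinv \<mu>0 \<mu> prog \<and> buf \<mu> (xs @ enc (?e m)) \<and> a \<le> a0 + 4 * m"
  show ?thesis unfolding PushM_def
  proof (rule wp_For2[where J = ?J])
    show "?J 0 \<mu> a0" using I by simp
    show "arr \<mu> 6 1 = k" if "?J m \<mu> a" for m \<mu> a using that by (simp add: pinv_def inv_def)
    show "\<Phi> \<mu> a" if J: "?J (k * k) \<mu> a'" and a: "a \<le> a' + (2 + k * (4 + 2 * k))" for \<mu> a a'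
    proof (rule post)
      show "buf \<mu> (xs @ enc (medges k (mb c)))"
        using J unfolding medges_def concat_grid by blast
      have "a' \<le> a0 + 4 * (k * k)" using J by blast
      then show "a \<le> a0 + 10 * k * k + 2" using a loop_overhead by linarith
    qed (use J in blast)
  next
    fix i j \<mu> a assume i: "i < k" and j: "j < k" and J: "?J (i * k + j) \<mu> a" and v5: "arr \<mu> 0 5 = i" and v6: "arr \<mu> 0 6 = j"
    let ?m = "i * k + j"
    have "?m < k * k" by (rule grid_index[OF i j])
    then have l': "length (xs @ enc (?e ?m)) + 2 \<le> 8 * k * k + 9" using l by (simp add: length_concat comp_def sum_list_triv)
    let ?xs = "xs @ enc (?e ?m)"
    let ?\<mu> = "pushed \<mu> ?xs i"
    have st: "arr \<mu> 6 = par" "arr \<mu> 1 = mat_of" "arr \<mu> 0 3 = bi" "arr \<mu> 0 4 = bj"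
      using J v by (auto simp: pinv_def inv_def)
    have e1: "evb inp \<mu> (var 5) i 1" by (rule evb_rules | use v5 i k_le_n in simp)+
    have e2: "evb inp ?\<mu> tgtE (snd (medge k (mb c) i j)) 8"
      using evb_tgtE[of ?\<mu> bi bj i j inp q, folded c_def] st v5 v6 bi bj i j by auto
    have b: "buf \<mu> ?xs" "pinv \<mu>0 \<mu> prog" "a \<le> a0 + 4 * ?m" using J by auto
    have "?xs @ [i] @ [snd (medge k (mb c) i j)] = xs @ enc (?e (Suc ?m))"
      using j by (simp add: medge_def)
    then have b3: "buf (pushed ?\<mu> (?xs @ [i]) (snd (medge k (mb c) i j))) (xs @ enc (?e (Suc ?m)))"
      using buf_pushed[OF buf_pushed[OF b(1)], of i "snd (medge k (mb c) i j)"] by simp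
    show "wp W inp (Seq (Push (var 5)) (Push tgtE))
       (\<lambda>\<mu>' a'. arr \<mu>' 0 5 = i \<and> arr \<mu>' 0 6 = j \<and> ?J (Suc ?m) \<mu>' a') \<mu> a"
    proof (rule wp_Seq, rule wp_Push[OF b(1) _ e1], use l' in simp, rule wp_Push[OF buf_pushed[OF b(1)] _ e2], use l' in simp, intro conjI)
      show "buf (pushed ?\<mu> (?xs @ [i]) (snd (medge k (mb c) i j))) (xs @ enc (?e (Suc ?m)))" by (rule b3)
    qed (use v5 v6 b in simp_all)
  qed simp_all
qed

lemma wp_PushR:
  assumes I: "pinv \<mu>0 \<mu> prog" "buf \<mu> xs" and l: "length xs \<le> 4 * k * k + 2"
    and post: "\<And>\<mu> a. pinv \<mu>0 \<mu> prog \<Longrightarrow> buf \<mu> (xs @ enc (redges k)) \<Longrightarrow> a \<le> a0 + 14 * k * k + 2 \<Longrightarrow> \<Phi> \<mu> a"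
  shows "wp W inp PushR \<Phi> \<mu> a0"
proof -
  let ?e = "\<lambda>m. concat (map (\<lambda>m. redge k (m div k) (m mod k)) [0..<m])"
  let ?J = "\<lambda>m \<mu> a. pinv \<mu>0 \<mu> prog \<and> buf \<mu> (xs @ enc (?e m)) \<and> a \<le> a0 + 8 * m"
  show ?thesis unfolding PushR_def
  proof (rule wp_For2[where J = ?J])
    show "?J 0 \<mu> a0" using I by simp
    show "arr \<mu> 6 1 = k" if "?J m \<mu> a" for m \<mu> a using that by (simp add: pinv_def inv_def)
    show "\<Phi> \<mu> a" if J: "?J (k * k) \<mu> a'" and a: "a \<le> a' + (2 + k * (4 + 2 * k))" for \<mu> a a'
    proof (rule post)
      show "buf \<mu> (xs @ enc (redges k))"
        using J unfolding redges_def concat_grid by blast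
      have "a' \<le> a0 + 8 * (k * k)" using J by blast
      then show "a \<le> a0 + 14 * k * k + 2" using a loop_overhead by linarith
    qed (use J in blast)
  next
    fix i j \<mu> a assume i: "i < k" and j: "j < k" and J: "?J (i * k + j) \<mu> a" and v5: "arr \<mu> 0 5 = i" and v6: "arr \<mu> 0 6 = j"
    let ?m = "i * k + j"
    have "?m < k * k" by (rule grid_index[OF i j])
    then have l': "length (xs @ enc (?e ?m)) + 4 \<le> 8 * k * k + 9" using l by (simp add: length_concat comp_def redge_def sum_list_triv)
    let ?xs = "xs @ enc (?e ?m)"
    let ?\<mu>1 = "pushed \<mu> ?xs (3 * k + i)"
    let ?\<mu>2 = "pushed ?\<mu>1 (?xs @ [3 * k + i]) j"
    let ?\<mu>3 = "pushed ?\<mu>2 (?xs @ [3 * k + i, j]) (k + j)"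
    let ?\<mu>4 = "pushed ?\<mu>3 (?xs @ [3 * k + i, j, k + j]) (4 * k + i)"
    have st: "arr \<mu> 6 = par" using J by (auto simp: pinv_def inv_def)
    have le: "k \<le> Suc n" "i \<le> Suc n" "j \<le> Suc n" using k_le_n i j by auto
    have e1: "evb inp \<mu> (Const 3 \<otimes> kE \<oplus> var 5) (3 * k + i) (5 + 1 + 1 + 1)"
      by (rule evb_rules | use v5 v6 st le in \<open>simp add: K_def\<close>)+
    have e2: "evb inp ?\<mu>1 (var 6) j 1"
      by (rule evb_rules | use v5 v6 st le in \<open>simp add: K_def\<close>)+
    have e3: "evb inp ?\<mu>2 (kE \<oplus> var 6) (k + j) (1 + 1 + 1)"
      by (rule evb_rules | use v5 v6 st le in \<open>simp add: K_def\<close>)+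
    have e4: "evb inp ?\<mu>3 (Const 4 \<otimes> kE \<oplus> var 5) (4 * k + i) (5 + 1 + 1 + 1)"
      by (rule evb_rules | use v5 v6 st le in \<open>simp add: K_def\<close>)+
    have b: "buf \<mu> ?xs" "pinv \<mu>0 \<mu> prog" "a \<le> a0 + 8 * ?m" using J by auto
    have b1: "buf ?\<mu>1 (?xs @ [3 * k + i])" by (rule buf_pushed[OF b(1)])
    have b2: "buf ?\<mu>2 (?xs @ [3 * k + i, j])" using buf_pushed[OF b1] by simp
    have b3: "buf ?\<mu>3 (?xs @ [3 * k + i, j, k + j])" using buf_pushed[OF b2] by simp
    have b4: "buf ?\<mu>4 (xs @ enc (?e (Suc ?m)))" using buf_pushed[OF b3, of "4 * k + i"] j by (simp add: redge_def)
    show "wp W inp (Seq (Push (Const 3 \<otimes> kE \<oplus> var 5)) (Seq (Push (var 6))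
       (Seq (Push (kE \<oplus> var 6)) (Push (Const 4 \<otimes> kE \<oplus> var 5)))))
       (\<lambda>\<mu>' a'. arr \<mu>' 0 5 = i \<and> arr \<mu>' 0 6 = j \<and> ?J (Suc ?m) \<mu>' a') \<mu> a"
    proof (rule wp_Seq, rule wp_Push[OF b(1) _ e1], use l' in simp,
        rule wp_Seq, rule wp_Push[OF b1 _ e2], use l' in simp,
        rule wp_Seq, rule wp_Push[OF b2 _ e3], use l' in simp,
        rule wp_Push[OF b3 _ e4], use l' in simp, intro conjI)
      show "buf ?\<mu>4 (xs @ enc (?e (Suc ?m)))" by (rule b4)
    qed (use v5 v6 b in simp_all)
  qed simp_all
qed

text \<open>Writing the input takes at most \<open>24 * k * k + 10\<close> steps and the overhead of
  the initial insertions is quadratic in \<open>k\<close> too; with \<open>1 \<le> k\<close>,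
  \<open>60 * k * k\<close> covers both.\<close>

lemma wp_InitCopy:
  fixes q bi bj
  defines "c \<equiv> (q * B + bi) * B + bj"
  assumes q: "q < B" and bi: "bi < B" and bj: "bj < B" and v: "arr \<mu>0 0 2 = q" "arr \<mu>0 0 3 = bi" "arr \<mu>0 0 4 = bj"
    and I: "inv \<mu>0 prog" and p0: "prog c = 0"
    and post: "\<And>\<mu> a. inv \<mu> (adv prog c (served c 0)) \<Longrightarrow> arr \<mu> 2 = arr \<mu>0 2 \<Longrightarrow>
      (\<And>v. v \<notin> {5, 6, 7, 10} \<Longrightarrow> arr \<mu> 0 v = arr \<mu>0 0 v) \<Longrightarrow>
      a + pot prog \<le> a0 + 60 * k * k + pot (adv prog c (served c 0)) \<Longrightarrow> \<Phi> \<mu> a"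
  shows "wp W inp (InitCopy inc P U) \<Phi> \<mu>0 a0"
proof -
  have c: "c < B * B * B" unfolding c_def using q bi bj by (rule copy_lt)
  obtain pb where be: "evb inp \<mu>0 baseE (c * S) pb"
    using evb_baseE[OF _ _ _ _ q bi bj] I v unfolding c_def by (auto simp: inv_def)
  have kn: "k \<le> Suc n" using k_le_n by simp
  have par0: "arr \<mu>0 6 = par" using I by (simp add: inv_def)
  let ?\<mu>1 = "\<mu>0(addr 0 10 := c * S)"
  let ?\<mu>2 = "?\<mu>1(addr 0 7 := 0)"
  let ?\<mu>3 = "pushed ?\<mu>2 [] (5 * k)"
  let ?\<mu>4 = "pushed ?\<mu>3 [5 * k] (3 * k * k)"
  have b2: "buf ?\<mu>2 []" by (simp add: buf_def)
  have b3: "buf ?\<mu>3 [5 * k]" using buf_pushed[OF b2] by simp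
  have b4: "buf ?\<mu>4 [5 * k, 3 * k * k]" using buf_pushed[OF b3] by simp
  have e3: "evb inp ?\<mu>2 (Const 5 \<otimes> kE) (5 * k) (5 + 1)"
    by (rule evb_rules | use par0 kn in \<open>simp add: K_def\<close>)+
  have e4: "evb inp ?\<mu>3 (Const 3 \<otimes> kE \<otimes> kE) (3 * k * k) (5 + 1 + 1)"
    by (rule evb_rules | use par0 kn in \<open>simp add: K_def\<close>)+
  have pi: "pinv ?\<mu>1 ?\<mu>4 prog" using I by (simp add: pinv_def inv_def)
  let ?inp = "encode_prediction (5 * k) (ehat c)"
  have inp_eq: "?inp = [5 * k, 3 * k * k] @ enc (ehat c)"
    unfolding encode_prediction_def ehat_def length_gehat enc_def by simp
  have v1: "arr ?\<mu>1 0 3 = bi" "arr ?\<mu>1 0 4 = bj" using v by auto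
  let ?es = "medges k (mb c)"
  have wl: "wp W inp (if inc then For 5 1 (For 6 1 (DoOp U (var 5) tgtE)) else Skip) \<Phi> \<mu> a"
    if pm: "pinv ?\<mu>1 \<mu> (adv prog c [])" and am: "a + pot prog \<le> a0 + 24 * k * k + 10 + pot (adv prog c [])" for \<mu> a
  proof (cases inc)
    case False
    have d0: "served c 0 = []" unfolding served_def gprefix_def ginit_def using False by simp
    have "wp W inp Skip \<Phi> \<mu> a"
    proof (rule wp_Skip, rule post)
      have "a + 1 + pot prog \<le> a0 + 60 * k * k + pot (adv prog c [])" using am kk1 by linarith
      then show "a + 1 + pot prog \<le> a0 + 60 * k * k + pot (adv prog c (served c 0))"
        by (simp only: d0)
    qed (use pm in \<open>auto simp: pinv_def d0\<close>)
    then show ?thesis using False by simp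
  next
    case True
    let ?l = "\<lambda>m. map Update (concat (map (\<lambda>m. [medge k (mb c) (m div k) (m mod k)]) [0..<m]))"
    let ?J = "\<lambda>m \<mu> a. pinv ?\<mu>1 \<mu> (adv prog c (?l m)) \<and> a + pot prog \<le> a0 + 24 * k * k + 10 + 2 * m + pot (adv prog c (?l m))"
    have lk: "?l (k * k) = served c 0" using True unfolding served_def gprefix_def ginit_def medges_def concat_grid by simp
    have "wp W inp (For 5 1 (For 6 1 (DoOp U (var 5) tgtE))) \<Phi> \<mu> a"
    proof (rule wp_For2[where J = ?J])
      show "?J 0 \<mu> a" using pm am by simp
      show "arr \<mu> 6 1 = k" if "?J m \<mu> a" for m \<mu> a using that by (simp add: pinv_def inv_def)
      show "\<Phi> \<mu> a" if J: "?J (k * k) \<mu> a'" and a: "a \<le> a' + (2 + k * (4 + 2 * k))" for \<mu> a a'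
      proof (rule post)
        have "a' + pot prog \<le> a0 + 24 * k * k + 10 + 2 * (k * k) + pot (adv prog c (served c 0))"
          using J unfolding lk by blast
        then show "a + pot prog \<le> a0 + 60 * k * k + pot (adv prog c (served c 0))"
          using a loop_overhead kk1 by linarith
      qed (use J lk in \<open>auto simp: pinv_def\<close>)
    next
      fix i j \<mu> a assume i: "i < k" and j: "j < k" and J: "?J (i * k + j) \<mu> a" and v5: "arr \<mu> 0 5 = i" and v6: "arr \<mu> 0 6 = j"
      let ?m = "i * k + j"
      have mk: "?m < k * k" by (rule grid_index[OF i j])
      let ?x = "Update (medge k (mb c) i j)"
      have lS: "?l (Suc ?m) = ?l ?m @ [?x]" using j by simp
      have "\<exists>suf. ops c = ?l ?m @ ?x # suf"
      proof -
        have "medges k (mb c) = concat (map (\<lambda>m. [medge k (mb c) (m div k) (m mod k)]) [0..<k * k])"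
          unfolding medges_def concat_grid ..
        also have "\<dots> = concat (map (\<lambda>m. [medge k (mb c) (m div k) (m mod k)]) [0..<?m]) @ [medge k (mb c) i j] @
            concat (map (\<lambda>m. [medge k (mb c) (m div k) (m mod k)]) [Suc ?m..<k * k])"
          using concat_map_upt_split[OF mk, of "\<lambda>m. [medge k (mb c) (m div k) (m mod k)]"] j by simp
        finally show ?thesis unfolding ops_def gops_def ginit_def using True by simp
      qed
      then obtain suf where suf: "ops c = ?l ?m @ ?x # suf" by blast
      have J': "pinv ?\<mu>1 \<mu> (adv prog c (?l ?m))" using J by blast
      have st: "arr \<mu> 6 = par" "arr \<mu> 1 = mat_of" "arr \<mu> 0 3 = bi" "arr \<mu> 0 4 = bj" "arr \<mu> 0 10 = c * S"
        "inv \<mu> (adv prog c (?l ?m))"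
        using J' v by (auto simp: pinv_def inv_def)
      have e1: "evb inp \<mu> (var 5) i 1" by (rule evb_rules | use v5 i k_le_n in simp)+
      show "wp W inp (DoOp U (var 5) tgtE)
         (\<lambda>\<mu>' a'. arr \<mu>' 0 5 = i \<and> arr \<mu>' 0 6 = j \<and> ?J (Suc ?m) \<mu>' a') \<mu> a"
      proof (rule wp_DoOp[OF c suf st(5,6) _ e1])
        show "request U Q ?x = (U, [i, snd (medge k (mb c) i j)])" by (simp add: medge_def)
        show "evb inp \<mu>' tgtE (snd (medge k (mb c) i j)) 8" if "\<And>t. t < 8 \<Longrightarrow> t \<noteq> 4 \<Longrightarrow> arr \<mu>' t = arr \<mu> t" for \<mu>'
          using evb_tgtE[of \<mu>' bi bj i j inp q, folded c_def] st v5 v6 bi bj i j that by auto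
        fix \<mu>' assume h: "inv \<mu>' (adv prog c (?l ?m @ [?x]))" "\<And>t. t < 8 \<Longrightarrow> t \<noteq> 4 \<Longrightarrow> t \<noteq> 5 \<Longrightarrow> t \<noteq> 7 \<Longrightarrow> arr \<mu>' t = arr \<mu> t"
        have "pinv ?\<mu>1 \<mu>' (adv prog c (?l (Suc ?m)))" using h J' unfolding lS by (simp add: pinv_def)
        moreover have "a + pot prog \<le> a0 + 24 * k * k + 10 + 2 * ?m + pot (adv prog c (?l ?m))" using J by blast
        then have "a + 2 + ts c (length (?l ?m)) + pot prog \<le> a0 + 24 * k * k + 10 + 2 * Suc ?m + pot (adv prog c (?l (Suc ?m)))"
          unfolding lS pot_adv[OF c] by simp
        ultimately show "arr \<mu>' 0 5 = i \<and> arr \<mu>' 0 6 = j \<and> ?J (Suc ?m) \<mu>' (a + 2 + ts c (length (?l ?m)))"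
          using v5 v6 h by simp
      qed
    qed simp_all
    then show ?thesis using True by simp
  qed
  have ws: "wp W inp (Seq (sim P) (if inc then For 5 1 (For 6 1 (DoOp U (var 5) tgtE)) else Skip)) \<Phi> \<mu> a"
    if pm: "pinv ?\<mu>1 \<mu> prog" and bm: "buf \<mu> ?inp" and am: "a \<le> a0 + 24 * k * k + 10" for \<mu> a
  proof -
    obtain out where ex: "exec S ?inp P (\<lambda>_. 0) (tp c) (ms c 0) out" using runs[OF c] unfolding copy_run_def by blast
    show ?thesis
    proof (rule wp_Seq, rule wp_sim[OF ex])
      show "arr \<mu> 0 10 = c * S" using pm by (simp add: pinv_def)
      show "arr \<mu> 4 i = ?inp ! i" if "i < length ?inp" for i using bm that by (simp add: buf_def)
      show "8 * ((c + 1) * S) + 100 \<le> W" by (rule region_W[OF c])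
      \<comment> \<open>The region of a copy that has not been started is still zero, as required by
        the recorded run of \<open>P\<close>, which begins with zero memory.\<close>
      have "prog(c := 0) = prog" using p0 by auto
      then show "arr \<mu> 5 = region S c (\<lambda>_. 0) (reg_of prog)"
        using pm region_reg_of[of c 0 prog] by (simp add: pinv_def inv_def copy_mem_def)
    next
      fix \<mu>' assume h: "arr \<mu>' 5 = region S c (ms c 0) (reg_of prog)"
        "\<And>t. t < 8 \<Longrightarrow> t \<noteq> 5 \<Longrightarrow> t \<noteq> 7 \<Longrightarrow> arr \<mu>' t = arr \<mu> t"
      have "arr \<mu>' 5 = reg_of (adv prog c [])" using h(1) region_reg_of[of c 1 prog] by (simp add: copy_mem_def adv_def)
      then have pi': "pinv ?\<mu>1 \<mu>' (adv prog c [])" using pm h(2) by (simp add: pinv_def inv_def)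
      have "prog(c := 0) = prog" using p0 by auto
      then have "pot (adv prog c []) = pot prog + tp c"
        using pot_upd[OF c, of prog 1 0] by (simp add: copy_time_def adv_def)
      then show "wp W inp (if inc then For 5 1 (For 6 1 (DoOp U (var 5) tgtE)) else Skip) \<Phi> \<mu>' (a + tp c)"
        using am by (intro wl pi') simp
    qed
  qed
  have push1: "wp W inp (if inc then Seq PushM PushR else Seq PushR PushM)
      (\<lambda>\<mu> a. pinv ?\<mu>1 \<mu> prog \<and> buf \<mu> ?inp \<and> a \<le> a0 + 24 * k * k + 10) ?\<mu>4 (a0 + 6)"
  proof (cases inc)
    case True
    have eh: "?inp = [5 * k, 3 * k * k] @ enc ?es @ enc (redges k)"
      unfolding inp_eq unfolding ehat_def gehat_def using True by simp
    have "wp W inp (Seq PushM PushR) (\<lambda>\<mu> a. pinv ?\<mu>1 \<mu> prog \<and> buf \<mu> ?inp \<and> a \<le> a0 + 24 * k * k + 10) ?\<mu>4 (a0 + 6)"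
    proof (rule wp_Seq, rule wp_PushM[OF bi bj v1 pi b4, where q = q, folded c_def])
      fix \<mu> a assume h: "pinv ?\<mu>1 \<mu> prog" "buf \<mu> ([5 * k, 3 * k * k] @ enc ?es)" "a \<le> a0 + 6 + 10 * k * k + 2"
      show "wp W inp PushR (\<lambda>\<mu> a. pinv ?\<mu>1 \<mu> prog \<and> buf \<mu> ?inp \<and> a \<le> a0 + 24 * k * k + 10) \<mu> a"
        by (rule wp_PushR[OF h(1,2)]) (use h in \<open>auto simp: eh length_medges\<close>)
    qed simp
    then show ?thesis by (subst if_P[OF True])
  next
    case False
    have eh: "?inp = [5 * k, 3 * k * k] @ enc (redges k) @ enc ?es"
      unfolding inp_eq unfolding ehat_def gehat_def using False by simp
    have "wp W inp (Seq PushR PushM) (\<lambda>\<mu> a. pinv ?\<mu>1 \<mu> prog \<and> buf \<mu> ?inp \<and> a \<le> a0 + 24 * k * k + 10) ?\<mu>4 (a0 + 6)"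
    proof (rule wp_Seq, rule wp_PushR[OF pi b4])
      fix \<mu> a assume h: "pinv ?\<mu>1 \<mu> prog" "buf \<mu> ([5 * k, 3 * k * k] @ enc (redges k))" "a \<le> a0 + 6 + 14 * k * k + 2"
      show "wp W inp PushM (\<lambda>\<mu> a. pinv ?\<mu>1 \<mu> prog \<and> buf \<mu> ?inp \<and> a \<le> a0 + 24 * k * k + 10) \<mu> a"
        by (rule wp_PushM[OF bi bj v1 h(1,2), where q = q, folded c_def])
           (use h in \<open>auto simp: eh length_redges\<close>)
    qed simp
    then show ?thesis by (subst if_not_P[OF False])
  qed
  have push: "wp W inp (Seq (if inc then Seq PushM PushR else Seq PushR PushM)
      (Seq (sim P) (if inc then For 5 1 (For 6 1 (DoOp U (var 5) tgtE)) else Skip))) \<Phi> ?\<mu>4 (a0 + 6)"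
    by (rule wp_Seq'[OF push1]) (rule ws, auto)
  show ?thesis
    unfolding InitCopy_def
  proof (rule wp_Seq, rule wp_SetL'[OF be], simp, simp, rule wp_Seq, rule wp_SetL'[OF evb_Const[of 0]], simp, simp, simp,
      rule wp_Seq, rule wp_Push[OF b2 _ e3], simp, rule wp_Seq, rule wp_Push[OF b3 _ e4], simp)
    have "a0 + 1 + 1 + 2 + 2 = a0 + 6" by simp
    then show "wp W inp (Seq (if inc then Seq PushM PushR else Seq PushR PushM)
      (Seq (sim P) (if inc then For 5 1 (For 6 1 (DoOp U (var 5) tgtE)) else Skip))) \<Phi> ?\<mu>4 (a0 + 1 + 1 + 2 + 2)"
      using push by metis
  qed
qed

end

section \<open>Preprocessing of the matrix\<close>

lemma encode_mat_nth:
  "length (encode_mat n M) = 1 + n * n" "encode_mat n M ! 0 = n"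
  "i < n \<Longrightarrow> j < n \<Longrightarrow> encode_mat n M ! (1 + (i * n + j)) = of_bool (M i j)"
proof -
  have eq: "encode_mat n M = n # map (\<lambda>m. of_bool (M (m div n) (m mod n))) [0..<n * n]"
    using concat_grid[of "\<lambda>i j. [of_bool (M i j)]" n n]
    by (simp add: encode_mat_def encode_vec_def)
  show "length (encode_mat n M) = 1 + n * n" "encode_mat n M ! 0 = n" by (simp_all add: eq)
  assume ij: "i < n" "j < n"
  have "i * n + j < n * n" using ij by (rule grid_index)
  then show "encode_mat n M ! (1 + (i * n + j)) = of_bool (M i j)" using ij by (simp add: eq)
qed

context reduction_runs
begin

definition prep_progress :: "nat \<Rightarrow> nat \<Rightarrow> nat" where
  "prep_progress m c = (if c < m then Suc (length (served c 0)) else 0)"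

lemma prep_progress_Suc: "prep_progress (Suc c) = adv (prep_progress c) c (served c 0)"
  by (auto simp: prep_progress_def adv_def fun_eq_iff)

lemma prep_progress_final: "prep_progress (B * B * B) = progress 0 0"
  by (auto simp: prep_progress_def progress_def fun_eq_iff)

lemma prep_progress_0: "prep_progress 0 = (\<lambda>_. 0)"
  by (auto simp: prep_progress_def)

lemma reg_of_0: "reg_of (\<lambda>_. 0) = (\<lambda>_. 0)"
  by (auto simp: reg_of_def copy_mem_def)

definition "copy_cost = 60 * k * k + 2"
definition "row_cost = B * copy_cost + 4"
definition "layer_cost = B * row_cost + 4"

lemma wp_copies:
  assumes I: "inv \<mu>0 (prep_progress 0)" and v: "arr \<mu>0 2 = (\<lambda>_. 0)" "arr \<mu>0 0 9 = 0"
    and post: "\<And>\<mu> a. query_inv 0 \<mu> \<Longrightarrow> a \<le> a0 + B * layer_cost + 2 + pot (progress 0 0) \<Longrightarrow> \<Phi> \<mu> a"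
  shows "wp W inp (For 2 2 (For 3 2 (For 4 2 (InitCopy inc P U)))) \<Phi> \<mu>0 a0"
proof -
  let ?fr = "\<lambda>\<mu>. arr \<mu> 2 = (\<lambda>_. 0) \<and> arr \<mu> 0 9 = 0"
  let ?I1 = "\<lambda>q \<mu> a. inv \<mu> (prep_progress (q * B * B)) \<and> ?fr \<mu> \<and> a \<le> a0 + 1 + q * layer_cost + pot (prep_progress (q * B * B))"
  show ?thesis
  proof (rule wp_For'[where I = ?I1 and m = B])
    show "?I1 0 (\<mu>0(addr 0 2 := 0)) (a0 + 1)" using I v by (auto simp: inv_def)
    show "arr \<mu> 6 2 = B" if "?I1 j \<mu> a" for j \<mu> a using that by (simp add: inv_def)
    show "\<Phi> \<mu> (a + 1)" if "?I1 B \<mu> a" for \<mu> a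
      using that unfolding prep_progress_final by (intro post) (auto simp: query_inv_def)
  next
    fix q \<mu> a assume q: "q < B" and I1: "?I1 q \<mu> a" and v2: "arr \<mu> 0 2 = q"
    let ?I2 = "\<lambda>bi \<mu> a. inv \<mu> (prep_progress ((q * B + bi) * B)) \<and> ?fr \<mu> \<and> arr \<mu> 0 2 = q \<and>
      a \<le> a0 + 1 + q * layer_cost + 2 + bi * row_cost + pot (prep_progress ((q * B + bi) * B))"
    show "wp W inp (For 3 2 (For 4 2 (InitCopy inc P U)))
      (\<lambda>\<mu>' a'. arr \<mu>' 0 2 = q \<and> ?I1 (Suc q) (\<mu>'(addr 0 2 := Suc q)) (a' + 1)) \<mu> (a + 1)"
    proof (rule wp_For'[where I = ?I2 and m = B])
      show "?I2 0 (\<mu>(addr 0 3 := 0)) (a + 1 + 1)" using I1 v2 by (auto simp: inv_def)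
      show "arr \<mu> 6 2 = B" if "?I2 j \<mu> a" for j \<mu> a using that by (simp add: inv_def)
      show "arr \<mu>' 0 2 = q \<and> ?I1 (Suc q) (\<mu>'(addr 0 2 := Suc q)) (a' + 1 + 1)" if h: "?I2 B \<mu>' a'" for \<mu>' a'
      proof -
        have e: "(q * B + B) * B = Suc q * B * B" by (simp add: algebra_simps)
        have "a' \<le> a0 + 1 + q * layer_cost + 2 + B * row_cost + pot (prep_progress (Suc q * B * B))" using h unfolding e by blast
        then have "a' + 1 + 1 \<le> a0 + 1 + Suc q * layer_cost + pot (prep_progress (Suc q * B * B))" by (simp add: layer_cost_def)
        then show ?thesis using h unfolding e by (auto simp: inv_def)
      qed
    next
      fix bi \<mu> a assume bi: "bi < B" and I2: "?I2 bi \<mu> a" and v3: "arr \<mu> 0 3 = bi"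
      let ?I3 = "\<lambda>bj \<mu> a. inv \<mu> (prep_progress ((q * B + bi) * B + bj)) \<and> ?fr \<mu> \<and> arr \<mu> 0 2 = q \<and> arr \<mu> 0 3 = bi \<and>
        a \<le> a0 + 1 + q * layer_cost + 2 + bi * row_cost + 2 + bj * copy_cost + pot (prep_progress ((q * B + bi) * B + bj))"
      show "wp W inp (For 4 2 (InitCopy inc P U))
        (\<lambda>\<mu>' a'. arr \<mu>' 0 3 = bi \<and> ?I2 (Suc bi) (\<mu>'(addr 0 3 := Suc bi)) (a' + 1)) \<mu> (a + 1)"
      proof (rule wp_For'[where I = ?I3 and m = B])
        show "?I3 0 (\<mu>(addr 0 4 := 0)) (a + 1 + 1)" using I2 v3 by (auto simp: inv_def)
        show "arr \<mu> 6 2 = B" if "?I3 j \<mu> a" for j \<mu> a using that by (simp add: inv_def)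
        show "arr \<mu>' 0 3 = bi \<and> ?I2 (Suc bi) (\<mu>'(addr 0 3 := Suc bi)) (a' + 1 + 1)" if h: "?I3 B \<mu>' a'" for \<mu>' a'
        proof -
          have e: "(q * B + bi) * B + B = (q * B + Suc bi) * B" by (simp add: algebra_simps)
          have "a' \<le> a0 + 1 + q * layer_cost + 2 + bi * row_cost + 2 + B * copy_cost + pot (prep_progress ((q * B + Suc bi) * B))" using h unfolding e by blast
          then have "a' + 1 + 1 \<le> a0 + 1 + q * layer_cost + 2 + Suc bi * row_cost + pot (prep_progress ((q * B + Suc bi) * B))" by (simp add: row_cost_def)
          then show ?thesis using h unfolding e by (auto simp: inv_def)
        qed
      next
        fix bj \<mu> a assume bj: "bj < B" and I3: "?I3 bj \<mu> a" and v4: "arr \<mu> 0 4 = bj"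
        let ?c = "(q * B + bi) * B + bj"
        have a: "a \<le> a0 + 1 + q * layer_cost + 2 + bi * row_cost + 2 + bj * copy_cost + pot (prep_progress ?c)" using I3 by blast
        show "wp W inp (InitCopy inc P U)
          (\<lambda>\<mu>' a'. arr \<mu>' 0 4 = bj \<and> ?I3 (Suc bj) (\<mu>'(addr 0 4 := Suc bj)) (a' + 1)) \<mu> (a + 1)"
        proof (rule wp_InitCopy[OF q bi bj, where prog = "prep_progress ?c"])
          show "prep_progress ?c ?c = 0" by (simp add: prep_progress_def)
          fix \<mu>' a' assume h: "inv \<mu>' (adv (prep_progress ?c) ?c (served ?c 0))" "arr \<mu>' 2 = arr \<mu> 2"
            "\<And>v. v \<notin> {5, 6, 7, 10} \<Longrightarrow> arr \<mu>' 0 v = arr \<mu> 0 v"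
            "a' + pot (prep_progress ?c) \<le> a + 1 + 60 * k * k + pot (adv (prep_progress ?c) ?c (served ?c 0))"
          have "a' + 1 \<le> a0 + 1 + q * layer_cost + 2 + bi * row_cost + 2 + Suc bj * copy_cost + pot (prep_progress (Suc ?c))"
            using h(4) a by (simp add: copy_cost_def prep_progress_Suc)
          then show "arr \<mu>' 0 4 = bj \<and> ?I3 (Suc bj) (\<mu>'(addr 0 4 := Suc bj)) (a' + 1)"
            using h I3 v4 by (simp add: inv_def prep_progress_Suc)
        qed (use I3 v4 in auto)
      qed (use k_le_D in auto)
    qed (use k_le_D in auto)
  qed (use k_le_D in auto)
qed

text \<open>The initial zeros on which later invariants rely: padding of matrix and vector, memories
  of unstarted copies, and the vector counter.\<close>

definition zeros :: "memory \<Rightarrow> bool" where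
  "zeros \<mu> \<longleftrightarrow> arr \<mu> 1 = (\<lambda>_. 0) \<and> arr \<mu> 2 = (\<lambda>_. 0) \<and> arr \<mu> 5 = (\<lambda>_. 0) \<and> arr \<mu> 0 9 = 0"

text \<open>The candidate either has grown in every iteration so far or has reached the integer cube
  root, where it stays. As the root is at most \<open>n\<close>, \<open>n\<close> iterations
  suffice.\<close>

lemma wp_FindK:
  assumes z: "zeros \<mu>0" "arr \<mu>0 6 = (\<lambda>_. 0)(0 := n)"
    and post: "\<And>\<mu> a. zeros \<mu> \<Longrightarrow> arr \<mu> 6 = (\<lambda>_. 0)(0 := n, 1 := k) \<Longrightarrow> a \<le> a0 + 4 * n + 2 \<Longrightarrow> \<Phi> \<mu> a"
  shows "wp W inp FindK \<Phi> \<mu>0 a0"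
proof -
  let ?I = "\<lambda>i \<mu> a. zeros \<mu> \<and> a \<le> a0 + 1 + 4 * i \<and>
    (\<exists>x. arr \<mu> 6 = (\<lambda>_. 0)(0 := n, 1 := x) \<and> x ^ 3 \<le> n \<and> x \<le> n \<and> (x = i \<or> n < (x + 1) ^ 3))"
  show ?thesis unfolding FindK_def
  proof (rule wp_For'[where I = ?I and m = n])
    show "?I 0 (\<mu>0(addr 0 0 := 0)) (a0 + 1)" using z by (auto simp: zeros_def fun_eq_iff intro!: exI[of _ 0])
    show "arr \<mu> 6 0 = n" if "?I i \<mu> a" for i \<mu> a using that by auto
    show "\<Phi> \<mu> (a + 1)" if I: "?I n \<mu> a" for \<mu> a
    proof -
      obtain x where x: "arr \<mu> 6 = (\<lambda>_. 0)(0 := n, 1 := x)" "x ^ 3 \<le> n" "x = n \<or> n < (x + 1) ^ 3" using I by blast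
      have "n < (x + 1) ^ 3"
      proof (cases "x = n")
        case True
        then show ?thesis using self_le_power[of "n + 1" 3] by simp
      qed (use x in simp)
      then have "k < x + 1" using k_le by (metis le_less_trans power_less_imp_less_base zero_le)
      moreover have "x < k + 1" using x(2) k_gt by (metis le_less_trans power_less_imp_less_base zero_le)
      ultimately have "x = k" by simp
      then show ?thesis using I x by (intro post) auto
    qed
  next
    fix i \<mu> a assume i: "i < n" and I: "?I i \<mu> a" and v0: "arr \<mu> 0 0 = i"
    obtain x where x: "arr \<mu> 6 = (\<lambda>_. 0)(0 := n, 1 := x)" "x ^ 3 \<le> n" "x \<le> n" "x = i \<or> n < (x + 1) ^ 3" using I by blast
    have e: "evb inp \<mu> cube_test
        (of_bool ((x + 1) * (x + 1) * (x + 1) < n + 1)) 1"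
      unfolding cube_test_def by (rule evb_rules | use x in \<open>simp add: K_def\<close>)+
    have e2: "evb inp \<mu> (kE \<oplus> Const 1) (x + 1) (1 + 5 + 1)"
      by (rule evb_rules | use x in \<open>simp add: K_def\<close>)+
    have cube: "(x + 1) * (x + 1) * (x + 1) = (x + 1) ^ 3" by (simp add: power3_eq_cube)
    have a: "a \<le> a0 + 1 + 4 * i" and zz: "zeros \<mu>" using I by auto
    show "wp W inp FindK_step (\<lambda>\<mu>' a'. arr \<mu>' 0 0 = i \<and> ?I (Suc i) (\<mu>'(addr 0 0 := Suc i)) (a' + 1)) \<mu> (a + 1)"
    proof (unfold FindK_step_def, rule wp_Cond'[OF e])
      assume "of_bool ((x + 1) * (x + 1) * (x + 1) < n + 1) \<noteq> (0 :: nat)"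
      then have h: "(x + 1) ^ 3 \<le> n" unfolding cube by (simp split: if_splits)
      then have xi: "x = i" using x(4) by simp
      let ?\<mu> = "\<mu>(addr 6 1 := x + 1, addr 0 0 := Suc i)"
      have "arr ?\<mu> 6 = (\<lambda>_. 0)(0 := n, 1 := x + 1)" using x(1) by auto
      moreover have "zeros ?\<mu>" using zz by (simp add: zeros_def)
      moreover have "x + 1 \<le> n" using xi i by simp
      ultimately have "?I (Suc i) ?\<mu> (a + 1 + 1 + 1 + 1)" using h xi a by auto
      then show "wp W inp (SetL 6 1 (kE \<oplus> Const 1)) (\<lambda>\<mu>' a'. arr \<mu>' 0 0 = i \<and> ?I (Suc i) (\<mu>'(addr 0 0 := Suc i)) (a' + 1)) \<mu> (a + 1 + 1)"
        using v0 by (intro wp_SetL'[OF e2]) auto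
    next
      assume "of_bool ((x + 1) * (x + 1) * (x + 1) < n + 1) = (0 :: nat)"
      then have h: "n < (x + 1) ^ 3" unfolding cube by (simp split: if_splits)
      have "arr (\<mu>(addr 0 0 := Suc i)) 6 = (\<lambda>_. 0)(0 := n, 1 := x)" using x(1) by simp
      moreover have "zeros (\<mu>(addr 0 0 := Suc i))" using zz by (simp add: zeros_def)
      ultimately have "?I (Suc i) (\<mu>(addr 0 0 := Suc i)) (a + 1 + 1 + 1 + 1)" using h x a by auto
      then show "wp W inp Skip (\<lambda>\<mu>' a'. arr \<mu>' 0 0 = i \<and> ?I (Suc i) (\<mu>'(addr 0 0 := Suc i)) (a' + 1)) \<mu> (a + 1 + 1)"
        using v0 by (intro wp_Skip) auto
    qed
  qed (use k_le_D in auto)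
qed

text \<open>Copies the matrix from row length \<open>n\<close> to row length \<open>D\<close>; the
  padding is never written and keeps its initial zeros.\<close>

lemma wp_matrix:
  assumes z: "zeros \<mu>0" "arr \<mu>0 6 = par"
    and post: "\<And>\<mu> a. inv \<mu> (prep_progress 0) \<Longrightarrow> arr \<mu> 2 = (\<lambda>_. 0) \<Longrightarrow> arr \<mu> 0 9 = 0 \<Longrightarrow> a \<le> a0 + n * (3 * n + 4) + 2 \<Longrightarrow> \<Phi> \<mu> a"
  shows "wp W (encode_mat n M) (For 0 0 (For 1 0 copy_entry)) \<Phi> \<mu>0 a0"
proof -
  let ?inp = "encode_mat n M"
  let ?fr = "\<lambda>\<mu>. arr \<mu> 6 = par \<and> arr \<mu> 2 = (\<lambda>_. 0) \<and> arr \<mu> 5 = (\<lambda>_. 0) \<and> arr \<mu> 0 9 = 0"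
  let ?m = "\<lambda>i j z. of_bool (Mpad (z div D) (z mod D) \<and> (z div D < i \<or> z div D = i \<and> z mod D < j)) :: nat"
  let ?I = "\<lambda>i \<mu> a. ?fr \<mu> \<and> arr \<mu> 1 = ?m i 0 \<and> a \<le> a0 + 1 + i * (3 * n + 4)"
  show ?thesis
  proof (rule wp_For'[where I = ?I and m = n])
    show "?I 0 (\<mu>0(addr 0 0 := 0)) (a0 + 1)" using z by (auto simp: zeros_def)
    show "arr \<mu> 6 0 = n" if "?I i \<mu> a" for i \<mu> a using that by simp
    show "\<Phi> \<mu> (a + 1)" if I: "?I n \<mu> a" for \<mu> a
    proof (rule post)
      have "?m n 0 = mat_of" by (auto simp: mat_of_def Mpad_def fun_eq_iff)
      then show "inv \<mu> (prep_progress 0)" using I unfolding inv_def prep_progress_0 reg_of_0 by simp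
    qed (use I in auto)
  next
    fix i \<mu> a assume i: "i < n" and I: "?I i \<mu> a" and v0: "arr \<mu> 0 0 = i"
    let ?J = "\<lambda>j \<mu> a. ?fr \<mu> \<and> arr \<mu> 0 0 = i \<and> arr \<mu> 1 = ?m i j \<and> a \<le> a0 + 1 + i * (3 * n + 4) + 2 + 3 * j"
    show "wp W ?inp (For 1 0 copy_entry)
      (\<lambda>\<mu>' a'. arr \<mu>' 0 0 = i \<and> ?I (Suc i) (\<mu>'(addr 0 0 := Suc i)) (a' + 1)) \<mu> (a + 1)"
    proof (rule wp_For'[where I = ?J and m = n])
      show "?J 0 (\<mu>(addr 0 1 := 0)) (a + 1 + 1)" using I v0 by auto
      show "arr \<mu> 6 0 = n" if "?J i \<mu> a" for i \<mu> a using that by simp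
      show "arr \<mu>' 0 0 = i \<and> ?I (Suc i) (\<mu>'(addr 0 0 := Suc i)) (a' + 1 + 1)" if J: "?J n \<mu>' a'" for \<mu>' a'
      proof -
        have "?m i n = ?m (Suc i) 0" by (auto simp: Mpad_def fun_eq_iff less_Suc_eq)
        then show ?thesis using J by simp
      qed
    next
      fix j \<mu> a assume j: "j < n" and J: "?J j \<mu> a" and v1: "arr \<mu> 0 1 = j"
      have le: "i \<le> Suc n" "j \<le> Suc n" using i j by auto
      have p: "arr \<mu> 6 = par" "arr \<mu> 0 0 = i" using J by auto
      have e1: "evb ?inp \<mu> (var 0 \<otimes> DE \<oplus> var 1) (i * D + j) (1 + 2 + 1 + 1)"
        by (rule evb_rules | use p v1 le in \<open>simp add: K_def\<close>)+
      have e2: "evb ?inp \<mu> (Const 1 \<oplus> (var 0 \<otimes> nE \<oplus> var 1)) (1 + (i * n + j)) (5 + (1 + 1 + 1 + 1) + 1)"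
        by (rule evb_rules | use p v1 le in \<open>simp add: K_def\<close>)+
      have "i * n + j < n * n" by (rule grid_index[OF i j])
      then have "1 + (i * n + j) < length ?inp" by (simp add: encode_mat_nth)
      then have e3: "evb ?inp \<mu> (Input (Const 1 \<oplus> (var 0 \<otimes> nE \<oplus> var 1))) (of_bool (M i j)) 1"
        using evalI[OF e2] encode_mat_nth(3)[OF i j, of M] const_W[of 1] const_W[of 0] H3
        by (simp add: evb_def word_def del: eval.simps(4))
      have jD: "j < D" using j n_lt_D by simp
      have upd: "(?m i j)(i * D + j := of_bool (M i j)) = ?m i (Suc j)"
      proof
        fix z
        show "((?m i j)(i * D + j := of_bool (M i j))) z = ?m i (Suc j) z"
        proof (cases "z = i * D + j")
          case True
          then show ?thesis using jD i j by (simp add: Mpad_def)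
        next
          case False
          then have "z div D \<noteq> i \<or> z mod D \<noteq> j" by (metis div_mult_mod_eq)
          then show ?thesis using False by (auto simp: less_Suc_eq)
        qed
      qed
      show "wp W ?inp copy_entry
        (\<lambda>\<mu>' a'. arr \<mu>' 0 1 = j \<and> ?J (Suc j) (\<mu>'(addr 0 1 := Suc j)) (a' + 1)) \<mu> (a + 1)"
      proof (unfold copy_entry_def, rule wp_SetX'[OF e1 _ _ e3])
        have "arr (\<mu>(addr 1 (i * D + j) := of_bool (M i j), addr 0 1 := Suc j)) 1 = ?m i (Suc j)"
          using J upd by simp
        then show "arr (\<mu>(addr 1 (i * D + j) := of_bool (M i j))) 0 1 = j \<and>
            ?J (Suc j) (\<mu>(addr 1 (i * D + j) := of_bool (M i j), addr 0 1 := Suc j)) (a + 1 + 1 + 1)"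
          using J v1 by simp
      qed (auto simp: K_def)
    qed (use k_le_D in auto)
  qed (use k_le_D in auto)
qed

definition "prep_bound = 4 * n + 6 + (n * (3 * n + 4) + 2) + (B * layer_cost + 2)"

lemma wp_prep:
  "wp W (encode_mat n M) (OMv_prep inc \<kappa> P U) (\<lambda>\<mu> a. query_inv 0 \<mu> \<and> a \<le> prep_bound + pot (progress 0 0)) (\<lambda>_. 0) 0"
proof -
  let ?inp = "encode_mat n M"
  let ?\<Phi> = "\<lambda>\<mu> a. query_inv 0 \<mu> \<and> a \<le> prep_bound + pot (progress 0 0)"
  let ?c7 = "For 2 2 (For 3 2 (For 4 2 (InitCopy inc P U)))"
  let ?c6 = "Seq (For 0 0 (For 1 0 copy_entry)) ?c7"
  let ?c3 = "Seq (SetL 6 2 (Bin Quot nE kE \<oplus> Const 1)) (Seq (SetL 6 3 (BE \<otimes> kE))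
     (Seq (SetL 6 4 (powE (Const 5 \<otimes> kE \<oplus> Const 2) \<kappa>)) ?c6))"
  let ?\<mu>1 = "(\<lambda>_. 0)(addr 6 0 := n)"
  have arr0: "arr (\<lambda>_. 0) t = (\<lambda>_. 0)" for t by (simp add: arr_def fun_eq_iff)
  have n_W: "n < W" by (rule less_W[of n 1]) (auto simp: H_def K_def)
  have e0: "eval W ?inp (\<lambda>_. 0) (Input (Const 0)) = Some n"
    using encode_mat_nth(1,2)[of n M] const_W[of 0] n_W by (simp add: word_def)
  have c6: "wp W ?inp ?c6 ?\<Phi> \<mu> a" if "zeros \<mu>" "arr \<mu> 6 = par" "a \<le> 4 * n + 6" for \<mu> a
  proof (rule wp_Seq, rule wp_matrix[OF that(1,2)])
    fix \<mu>' a' assume h: "inv \<mu>' (prep_progress 0)" "arr \<mu>' 2 = (\<lambda>_. 0)" "arr \<mu>' 0 9 = 0" "a' \<le> a + n * (3 * n + 4) + 2"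
    show "wp W ?inp ?c7 ?\<Phi> \<mu>' a'"
    proof (rule wp_copies[OF h(1-3)], rule conjI)
      fix \<mu>'' a'' assume "a'' \<le> a' + B * layer_cost + 2 + pot (progress 0 0)"
      then show "a'' \<le> prep_bound + pot (progress 0 0)" using h(4) that(3) unfolding prep_bound_def by linarith
    qed
  qed
  have c3: "wp W ?inp ?c3 ?\<Phi> \<mu> a" if h: "zeros \<mu>" "arr \<mu> 6 = (\<lambda>_. 0)(0 := n, 1 := k)" "a \<le> 1 + 4 * n + 2" for \<mu> a
  proof -
    let ?\<mu>2 = "\<mu>(addr 6 2 := B)"
    let ?\<mu>3 = "?\<mu>2(addr 6 3 := D)"
    let ?\<mu>4 = "?\<mu>3(addr 6 4 := S)"
    have kn: "k \<le> Suc n" "B \<le> Suc n" using k_le_n B_le by auto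
    have e1: "evb ?inp \<mu> (Bin Quot nE kE \<oplus> Const 1) B (1 + 5 + 1)"
      unfolding B_def by (rule evb_rules | use h kn in \<open>simp add: K_def\<close>)+
    have e2: "evb ?inp ?\<mu>2 (BE \<otimes> kE) D (1 + 1)"
      unfolding D_def by (rule evb_rules | use h kn in \<open>simp add: K_def\<close>)+
    have "evb ?inp ?\<mu>3 (Const 5 \<otimes> kE \<oplus> Const 2) (5 * k + 2) (5 + 1 + 5 + 1)"
      by (rule evb_rules | use h kn in \<open>simp add: K_def\<close>)+
    then have e3: "eval W ?inp ?\<mu>3 (powE (Const 5 \<otimes> kE \<oplus> Const 2) \<kappa>) = Some S"
      unfolding S_def using less_W[OF S_lt] by (intro eval_powE evalI) (auto simp: K_def S_def)
    have "wp W ?inp ?c6 ?\<Phi> ?\<mu>4 (a + 1 + 1 + 1)"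
    proof (rule c6)
      show "zeros ?\<mu>4" using h by (simp add: zeros_def)
      show "arr ?\<mu>4 6 = par" using h by (auto simp: par_def)
    qed (use h in simp)
    then show ?thesis
      by - (rule wp_Seq, rule wp_SetL'[OF e1], simp, simp, rule wp_Seq, rule wp_SetL'[OF e2], simp, simp,
          rule wp_Seq, rule wp_SetL[OF addr_const e3], simp, simp, assumption)
  qed
  have "wp W ?inp (Seq FindK ?c3) ?\<Phi> ?\<mu>1 (0 + 1)"
  proof (rule wp_Seq, rule wp_FindK)
    show "zeros ?\<mu>1" by (simp add: zeros_def arr0)
    show "arr ?\<mu>1 6 = (\<lambda>_. 0)(0 := n)" by (simp add: arr0)
  qed (use c3 in simp)
  then show ?thesis
    unfolding OMv_prep_def by - (rule wp_Seq, rule wp_SetL[OF addr_const e0], simp, simp, assumption)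
qed

section \<open>Total running times of both phases\<close>

definition "ops_time c = (\<Sum>i<length (ops c). ts c i)"

lemma length_served: "t \<le> k \<Longrightarrow> length (served c t) \<le> length (ops c)"
proof (cases t)
  case 0
  then show ?thesis by (simp add: served_def ops_def gops_def gprefix_def)
next
  case (Suc m)
  assume "t \<le> k"
  then have "m < k" using Suc by simp
  then obtain suf where "ops c = served c m @ ground inc k (row_known c) (vec_bit c) m @ suf"
    using gops_split unfolding ops_def served_def by blast
  then show ?thesis using Suc by (simp add: served_def gprefix_Suc)
qed

text \<open>Times are nonnegative, so a prefix costs at most its complete sequence. This matters
  because the last group of vectors may be incomplete and final deletions are not executed, while
  the amortised bound is available for complete sequences.\<close>

lemma pot_progress_le: "pot (progress r m) \<le> (\<Sum>c<B * B * B. tp c + ops_time c)"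
  unfolding pot_def
proof (rule sum_mono)
  fix c
  have "(\<Sum>j<length (served c t). ts c j) \<le> ops_time c" if "t \<le> k" for t
    unfolding ops_time_def by (rule sum_mono2) (use length_served[OF that, of c] in auto)
  then show "copy_time c (progress r m c) \<le> tp c + ops_time c" by (simp add: progress_def copy_time_def)
qed

text \<open>From the start of the query phase all preprocessing times are part of the potential.
  They cancel in the difference that bounds this phase.\<close>

lemma pot_progress_ge: "(\<Sum>c<B * B * B. tp c) \<le> pot (progress r m)"
  unfolding pot_def by (rule sum_mono) (simp add: progress_def copy_time_def)

lemma run:
  assumes "length vs = n"
  shows "\<exists>\<tau> \<mu> res. exec W (encode_mat n M) (OMv_prep inc \<kappa> P U) (\<lambda>_. 0) \<tau> \<mu> [] \<and>
    serve W \<mu> (map (\<lambda>v. (OMv_query inc U Q, encode_vec n v)) vs) res \<and>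
    map snd res = map (\<lambda>v. encode_vec n (bool_mult_vec n M v)) vs \<and>
    \<tau> \<le> prep_bound + (\<Sum>c<B * B * B. tp c + ops_time c) \<and>
    sum_list (map fst res) \<le> n * query_overhead + (\<Sum>c<B * B * B. ops_time c)"
proof -
  obtain \<tau> \<mu> where 1: "exec W (encode_mat n M) (OMv_prep inc \<kappa> P U) (\<lambda>_. 0) \<tau> \<mu> []" "query_inv 0 \<mu>" "\<tau> \<le> prep_bound + pot (progress 0 0)"
    using wp_prep unfolding wp_def by auto
  obtain res where 2: "serve W \<mu> (map (\<lambda>v. (OMv_query inc U Q, encode_vec n v)) vs) res"
    "map snd res = map (\<lambda>v. encode_vec n (bool_mult_vec n M v)) vs"
    "sum_list (map fst res) + pot (progress 0 0) \<le> n * query_overhead + pot (progress n 0)"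
    using serve_queries[OF assms, of 0 \<mu>] 1(2) by auto
  have "sum_list (map fst res) \<le> n * query_overhead + (\<Sum>c<B * B * B. ops_time c)"
    using 2(3) pot_progress_ge[of 0 0] pot_progress_le[of n 0] by (simp add: sum.distrib)
  moreover have "\<tau> \<le> prep_bound + (\<Sum>c<B * B * B. tp c + ops_time c)" using 1(3) pot_progress_le[of 0 0] by linarith
  ultimately show ?thesis using 1 2 by blast
qed

end

section \<open>Estimates\<close>

context params
begin

lemma B_le_2n: "B \<le> 2 * n" using B_le n1 by simp

text \<open>Only polynomiality is wanted here, so the crude bounds \<open>B \<le> 2 * n\<close> and
  \<open>k \<le> n\<close> are enough.\<close>

lemma prep_estimate:
  "4 * n + 6 + (n * (3 * n + 4) + 2) + (B * (B * (B * (60 * k * k + 2) + 4) + 4) + 2) \<le> 600 * n ^ 5"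
proof -
  have p: "1 \<le> n ^ j" for j using n1 by simp
  have up: "n ^ i \<le> n ^ j" if "i \<le> j" for i j using n1 that by (intro power_increasing) auto
  have "k * k \<le> n ^ 2" using k_le_n by (auto simp: power2_eq_square intro: mult_le_mono)
  then have 3: "60 * k * k + 2 \<le> 62 * n ^ 2" using p[of 2] by linarith
  have "B * (60 * k * k + 2) \<le> 2 * n * (62 * n ^ 2)" by (rule mult_le_mono[OF B_le_2n 3])
  also have "\<dots> = 124 * n ^ 3" by (simp add: power_numeral_reduce)
  finally have 2: "B * (60 * k * k + 2) + 4 \<le> 128 * n ^ 3" using p[of 3] by linarith
  have "B * (B * (60 * k * k + 2) + 4) \<le> 2 * n * (128 * n ^ 3)" by (rule mult_le_mono[OF B_le_2n 2])
  also have "\<dots> = 256 * n ^ 4" by (simp add: power_numeral_reduce)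
  finally have 1: "B * (B * (60 * k * k + 2) + 4) + 4 \<le> 260 * n ^ 4" using p[of 4] by linarith
  have "B * (B * (B * (60 * k * k + 2) + 4) + 4) \<le> 2 * n * (260 * n ^ 4)" by (rule mult_le_mono[OF B_le_2n 1])
  also have "\<dots> = 520 * n ^ 5" by (simp add: power_numeral_reduce)
  finally have 0: "B * (B * (B * (60 * k * k + 2) + 4) + 4) \<le> 520 * n ^ 5" .
  have "n * (3 * n + 4) = 3 * n ^ 2 + 4 * n ^ 1" by (simp add: power2_eq_square algebra_simps)
  then show ?thesis using 0 up[of 1 5] up[of 2 5] p[of 5] by simp
qed

text \<open>The real cube root turns the estimates into comparisons of monomials: \<open>n\<close>
  is s^3, \<open>k\<close> lies between s/2 and s, and \<open>B\<close> is at most 4 s^2.\<close>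

definition "s = real n powr (1 / 3)"

lemma s1: "1 \<le> s" unfolding s_def using n1 by (simp add: ge_one_powr_ge_zero)

lemma s3: "s ^ 3 = real n"
  unfolding s_def using n1 by (simp add: powr_power)

lemma k_le_s: "real k \<le> s"
proof (rule power_le_imp_le_base[of _ 2])
  show "real k ^ Suc 2 \<le> s ^ Suc 2" using k_le s3 by (simp add: numeral_3_eq_3[symmetric])
qed (use s1 in simp)

lemma s_le_k: "s \<le> 2 * real k"
proof -
  have "s \<le> real k + 1"
  proof (rule power_le_imp_le_base[of _ 2])
    have "real n \<le> (real k + 1) ^ 3" using k_gt by (metis of_nat_1 of_nat_add of_nat_le_iff of_nat_power order_less_imp_le)
    then show "s ^ Suc 2 \<le> (real k + 1) ^ Suc 2" using s3 by (simp add: numeral_3_eq_3[symmetric])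
  qed simp
  then show ?thesis using k1 by simp
qed

lemma Bk_real: "real B * real k \<le> 2 * real n"
  using Bk by (metis of_nat_le_iff of_nat_mult of_nat_numeral)

lemma B_le_s: "real B \<le> 4 * s ^ 2"
proof -
  have "real B * s \<le> real B * (2 * real k)" using s_le_k by (intro mult_left_mono) auto
  also have "\<dots> \<le> 4 * s ^ 3" using Bk_real s3 by (simp add: mult.commute)
  finally have "real B * s \<le> (4 * s ^ 2) * s" by (simp add: power3_eq_cube power2_eq_square)
  then show ?thesis using s1 by (simp add: mult_le_cancel_right)
qed

text \<open>The passes contribute B^2 k and the searches k^2 D, both of order s^5. This is the
  balance achieved by the choice of \<open>k\<close>.\<close>

lemma overhead_estimate:
  "real (6 * n + 3 * D + 11 + B * (B * (16 * k + 23) + 4) + 10 * k * k * D) \<le> 371 * s ^ 5"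
proof -
  have up: "s ^ i \<le> s ^ j" if "i \<le> j" for i j using s1 that by (intro power_increasing) auto
  have D: "real D \<le> 2 * s ^ 3" using Bk_real s3 by (simp add: D_def)
  have k0: "1 \<le> real k" using k1 by simp
  have "real B * (16 * real k + 23) \<le> real B * (39 * real k)" using k0 by (intro mult_left_mono) auto
  also have "\<dots> \<le> 78 * s ^ 3" using Bk_real s3 by (simp add: mult.commute)
  finally have "real B * (real B * (16 * real k + 23)) \<le> (4 * s ^ 2) * (78 * s ^ 3)"
    by (rule mult_mono[OF B_le_s]) auto
  also have "\<dots> = 312 * s ^ 5" by (simp add: power_add[symmetric])
  finally have 1: "real B * (real B * (16 * real k + 23)) \<le> 312 * s ^ 5" .
  have "real k * real k \<le> s * s" using k_le_s by (intro mult_mono) auto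
  then have "(real k * real k) * real D \<le> (s * s) * (2 * s ^ 3)" by (rule mult_mono[OF _ D]) auto
  also have "\<dots> = 2 * s ^ 5" by (simp add: power_numeral_reduce)
  finally have 2: "(real k * real k) * real D \<le> 2 * s ^ 5" .
  have "real (6 * n + 3 * D + 11 + B * (B * (16 * k + 23) + 4) + 10 * k * k * D) =
    6 * real n + 3 * real D + 11 + real B * (real B * (16 * real k + 23)) + 4 * real B + 10 * ((real k * real k) * real D)"
    by (simp add: algebra_simps)
  also have "\<dots> \<le> 6 * s ^ 3 + 3 * (2 * s ^ 3) + 11 * s ^ 0 + 312 * s ^ 5 + 4 * (4 * s ^ 2) + 10 * (2 * s ^ 5)"
    using D 1 2 B_le_s s3 by simp
  also have "\<dots> \<le> 371 * s ^ 5" using up[of 3 5] up[of 0 5] up[of 2 5] by simp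
  finally show ?thesis .
qed

text \<open>All vectors together cost s^8 = n^(8/3), which is below the target exactly because
  \<epsilon> is at most 1.\<close>

lemma total_overhead_estimate:
  assumes "\<epsilon> \<le> 1"
  shows "real n * (371 * s ^ 5) \<le> 371 * real n powr (3 - \<epsilon> / 3)"
proof -
  have "real n * s ^ 5 = s ^ 8" unfolding s3[symmetric] by (simp add: power_add[symmetric])
  also have "\<dots> = real n powr (8 / 3)" unfolding s_def using n1 by (simp add: powr_power)
  also have "\<dots> \<le> real n powr (3 - \<epsilon> / 3)" using assms n1 by (intro powr_mono) auto
  finally show ?thesis by simp
qed

text \<open>Group the product as (B k)^3 k^(-\<epsilon>): the first factor is at most 8 n^3, the
  second at most 2 n^(-\<epsilon>/3).\<close>

lemma operations_estimate:
  assumes "0 < \<epsilon>" "\<epsilon> \<le> 1"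
  shows "real (B * B * B) * real k powr (3 - \<epsilon>) \<le> 16 * real n powr (3 - \<epsilon> / 3)"
proof -
  have k0: "0 < real k" using k1 by simp
  have s0: "0 < s" using s1 by simp
  have n0: "0 < real n" using n1 by simp
  have "real k powr (- \<epsilon>) \<le> (s / 2) powr (- \<epsilon>)"
    using s_le_k s0 assms by (intro powr_mono2') auto
  also have "\<dots> = 2 powr \<epsilon> * s powr (- \<epsilon>)" using s0 by (simp add: powr_divide powr_minus field_simps)
  also have "\<dots> \<le> 2 powr 1 * s powr (- \<epsilon>)" using assms by (intro mult_right_mono powr_mono) auto
  also have "s powr (- \<epsilon>) = real n powr (- \<epsilon> / 3)" unfolding s_def by (simp add: powr_powr)
  finally have 1: "real k powr (- \<epsilon>) \<le> 2 * real n powr (- \<epsilon> / 3)" by simp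
  have "real (B * B * B) * real k powr (3 - \<epsilon>) = (real B * real k) ^ 3 * real k powr (- \<epsilon>)"
    using k0 by (simp add: powr_diff powr_minus powr_numeral power3_eq_cube field_simps)
  also have "\<dots> \<le> (2 * real n) ^ 3 * (2 * real n powr (- \<epsilon> / 3))"
    by (rule mult_mono[OF power_mono[OF Bk_real] 1]) auto
  also have "\<dots> = 16 * (real n powr 3 * real n powr (- \<epsilon> / 3))" using n0 by (simp add: powr_numeral power_mult_distrib)
  also have "\<dots> = 16 * real n powr (3 - \<epsilon> / 3)" by (simp only: powr_add[symmetric]) simp
  finally show ?thesis .
qed

end

section \<open>The reduction\<close>

lemma solves_OMv_if_solves_TC:
  assumes TC: "solves_TC (tc_graph inc) (amortized_bound \<epsilon>) P U Q" and e: "0 < \<epsilon>" "\<epsilon> \<le> 1"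
  shows "\<exists>P' Q'. solves_OMv (\<epsilon> / 3) P' Q'"
proof -
  from TC obtain \<kappa> d C where TC': "\<And>N ehat ops. 1 \<le> N \<Longrightarrow> tc_instance N ehat ops \<Longrightarrow>
      \<exists>\<tau> \<mu> out res.
         exec ((N + 2) ^ \<kappa>) (encode_prediction N ehat) P (\<lambda>_. 0) \<tau> \<mu> out \<and>
         serve ((N + 2) ^ \<kappa>) \<mu> (map (request U Q) ops) res \<and>
         correct_answers (tc_graph inc) ehat ops (map snd res) \<and>
         real \<tau> \<le> C * real N ^ d \<and>
         amortized_bound \<epsilon> N (eta_inf ehat (updates ops)) C ops (map fst res)"
    unfolding solves_TC_def by blast
  \<comment> \<open>The given constant might be negative; monotonicity of the later products needs a
    nonnegative one.\<close>
  define C0 where "C0 = max C 0"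
  \<comment> \<open>One constant for both bounds: preprocessing overhead, preprocessing of the
    copies, their operations, and the query phase. Here 152 = 8 * 19 and 304 = 16 * 19.\<close>
  define C1 where "C1 = 600 + 8 * 5 ^ d * C0 + 152 * C0 + (371 + 304 * C0)"
  have C0: "0 \<le> C0" "C \<le> C0" by (auto simp: C0_def)
  have "\<exists>\<tau> \<mu> out res.
         exec ((n + 2) ^ (3 * \<kappa> + 60)) (encode_mat n M) (OMv_prep inc \<kappa> P U) (\<lambda>_. 0) \<tau> \<mu> out \<and>
         serve ((n + 2) ^ (3 * \<kappa> + 60)) \<mu> (map (\<lambda>v. (OMv_query inc U Q, encode_vec n v)) vs) res \<and>
         map snd res = map (\<lambda>v. encode_vec n (bool_mult_vec n M v)) vs \<and>
         real \<tau> \<le> C1 * real n ^ (d + 6) \<and>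
         real (sum_list (map fst res)) \<le> C1 * real n powr (3 - \<epsilon> / 3)"
    if n1: "1 \<le> n" and len: "length vs = n" for n M and vs :: "(nat \<Rightarrow> bool) list"
  proof -
    obtain k where k: "k ^ 3 \<le> n" "n < (k + 1) ^ 3" using cube_root_exists by blast
    interpret params \<kappa> n k using n1 k by unfold_locales
    interpret reduction \<kappa> n k inc P U Q M vs by unfold_locales
    \<comment> \<open>A run of every copy on its complete sequence is fixed before the simulating
      program is considered; that program itself depends only on \<open>inc\<close>,
      \<open>\<kappa>\<close>, \<open>P\<close>, \<open>U\<close> and \<open>Q\<close>.\<close>
    have ex: "\<exists>\<tau> ms ts.
      copy_run c \<tau> ms ts \<and>
      real \<tau> \<le> C0 * real (5 * k) ^ d \<and> real (\<Sum>i<length (ops c). ts i) \<le> C0 * (19 * real k powr (3 - \<epsilon>))" for c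
    proof -
      have inst: "tc_instance (5 * k) (ehat c) (ops c)" unfolding ehat_def ops_def by (rule gops_instance)
      obtain \<tau> \<mu> out res where r: "exec S (encode_prediction (5 * k) (ehat c)) P (\<lambda>_. 0) \<tau> \<mu> out"
        "serve S \<mu> (map (request U Q) (ops c)) res" "correct_answers (tc_graph inc) (ehat c) (ops c) (map snd res)"
        "real \<tau> \<le> C * real (5 * k) ^ d" "amortized_bound \<epsilon> (5 * k) (eta_inf (ehat c) (updates (ops c))) C (ops c) (map fst res)"
        using TC'[OF _ inst] k1 unfolding S_def by auto
      from serve_trace[OF r(2)] obtain ms where lr: "length res = length (ops c)" and ms: "ms 0 = \<mu>"
        "\<forall>i<length (ops c). exec S (snd (request U Q (ops c ! i))) (fst (request U Q (ops c ! i))) (ms i) (fst (res ! i)) (ms (Suc i)) (snd (res ! i))"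
        by auto
      have "real \<tau> \<le> C0 * real (5 * k) ^ d"
        by (rule order_trans[OF r(4) mult_right_mono[OF C0(2)]]) simp
      moreover have "real (\<Sum>i<length (ops c). fst (res ! i)) \<le> C0 * (19 * real k powr (3 - \<epsilon>))"
      proof -
        let ?b = "sum_list (map (operation_bound \<epsilon> (5 * k) (eta_inf (ehat c) (updates (ops c)))) (ops c))"
        have "0 \<le> ?b"
        proof (rule sum_list_nonneg)
          fix x assume "x \<in> set (map (operation_bound \<epsilon> (5 * k) (eta_inf (ehat c) (updates (ops c)))) (ops c))"
          then obtain y where "x = operation_bound \<epsilon> (5 * k) (eta_inf (ehat c) (updates (ops c))) y" by auto
          then show "0 \<le> x" by (cases y) auto
        qed
        have "(\<Sum>i<length (ops c). fst (res ! i)) = sum_list (map fst res)"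
          using lr by (simp add: sum_list_sum_nth atLeast0LessThan)
        then have "real (\<Sum>i<length (ops c). fst (res ! i)) \<le> C * ?b"
          using r(5) unfolding amortized_bound_def by simp
        also have "\<dots> \<le> C0 * ?b" using C0(2) \<open>0 \<le> ?b\<close> by (rule mult_right_mono)
        also have "\<dots> \<le> C0 * (19 * real k powr (3 - \<epsilon>))"
          unfolding ehat_def ops_def using gops_bound[OF e k1] C0(1) by (intro mult_left_mono)
        finally show ?thesis .
      qed
      moreover have "\<forall>i<length (ops c). \<exists>out. exec S (snd (request U Q (ops c ! i))) (fst (request U Q (ops c ! i))) (ms i) (fst (res ! i)) (ms (Suc i)) out \<and>
        (\<forall>s t. ops c ! i = Query s t \<longrightarrow> out = [of_bool ((s, t) \<in> (tc_graph inc (ehat c) (take i (ops c)))\<^sup>*)])"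
      proof (intro allI impI exI conjI)
        fix i assume i: "i < length (ops c)"
        then show "exec S (snd (request U Q (ops c ! i))) (fst (request U Q (ops c ! i))) (ms i) (fst (res ! i)) (ms (Suc i)) (snd (res ! i))"
          using ms(2) by blast
        fix s t assume "ops c ! i = Query s t"
        then have "map snd res ! i = [of_bool ((s, t) \<in> (tc_graph inc (ehat c) (take i (ops c)))\<^sup>*)]"
          using r(3) i unfolding correct_answers_def by blast
        then show "snd (res ! i) = [of_bool ((s, t) \<in> (tc_graph inc (ehat c) (take i (ops c)))\<^sup>*)]"
          using i lr by (simp only: nth_map)
      qed
      ultimately show ?thesis using r(1) ms(1) unfolding copy_run_def
        by (intro exI[of _ \<tau>] exI[of _ ms] exI[of _ "\<lambda>i. fst (res ! i)"]) blast
    qed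
    then obtain tp ms ts where copies: "\<And>c.
      copy_run c (tp c) (ms c) (ts c) \<and>
      real (tp c) \<le> C0 * real (5 * k) ^ d \<and> real (\<Sum>i<length (ops c). ts c i) \<le> C0 * (19 * real k powr (3 - \<epsilon>))"
      by metis
    interpret reduction_runs \<kappa> n k inc P U Q M vs ms ts tp
      by unfold_locales (use copies in blast)
    obtain \<tau> \<mu> res where R: "exec W (encode_mat n M) (OMv_prep inc \<kappa> P U) (\<lambda>_. 0) \<tau> \<mu> []"
      "serve W \<mu> (map (\<lambda>v. (OMv_query inc U Q, encode_vec n v)) vs) res"
      "map snd res = map (\<lambda>v. encode_vec n (bool_mult_vec n M v)) vs"
      "\<tau> \<le> prep_bound + (\<Sum>c<B * B * B. tp c + ops_time c)"
      "sum_list (map fst res) \<le> n * query_overhead + (\<Sum>c<B * B * B. ops_time c)"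
      using run[OF len] by blast
    have W_eq: "W = (n + 2) ^ (3 * \<kappa> + 60)" by (simp add: W_def H_def K_def)
    let ?b = "real (B * B * B)" and ?pw = "real k powr (3 - \<epsilon>)"
    have T: "real (\<Sum>c<B * B * B. ops_time c) \<le> ?b * (C0 * (19 * ?pw))"
    proof -
      have "real (\<Sum>c<B * B * B. ops_time c) = (\<Sum>c<B * B * B. real (ops_time c))" by simp
      also have "\<dots> \<le> (\<Sum>c<B * B * B. C0 * (19 * ?pw))"
        by (rule sum_mono) (use copies in \<open>simp add: ops_time_def\<close>)
      finally show ?thesis by simp
    qed
    have Tp: "real (\<Sum>c<B * B * B. tp c) \<le> ?b * (C0 * real (5 * k) ^ d)"
    proof -
      have "real (\<Sum>c<B * B * B. tp c) = (\<Sum>c<B * B * B. real (tp c))" by simp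
      also have "\<dots> \<le> (\<Sum>c<B * B * B. C0 * real (5 * k) ^ d)"
        by (rule sum_mono) (use copies in simp)
      finally show ?thesis by simp
    qed
    have n1': "1 \<le> real n" using n1 by simp
    have "real (sum_list (map fst res)) \<le> real (n * query_overhead) + real (\<Sum>c<B * B * B. ops_time c)"
      using R(5) by (metis of_nat_add of_nat_le_iff)
    also have "real (n * query_overhead) \<le> 371 * real n powr (3 - \<epsilon> / 3)"
    proof -
      have "real (n * query_overhead) = real n * real query_overhead" by simp
      also have "\<dots> \<le> real n * (371 * s ^ 5)"
        unfolding query_overhead_def block_cost_def by (rule mult_left_mono[OF overhead_estimate]) simp
      also have "\<dots> \<le> 371 * real n powr (3 - \<epsilon> / 3)" by (rule total_overhead_estimate[OF e(2)])
      finally show ?thesis .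
    qed
    also have "real (\<Sum>c<B * B * B. ops_time c) \<le> 304 * C0 * real n powr (3 - \<epsilon> / 3)"
    proof -
      have "?b * (C0 * (19 * ?pw)) = 19 * C0 * (?b * ?pw)" by simp
      also have "\<dots> \<le> 19 * C0 * (16 * real n powr (3 - \<epsilon> / 3))"
        by (rule mult_left_mono[OF operations_estimate[OF e]]) (use C0 in simp)
      also have "\<dots> = 304 * C0 * real n powr (3 - \<epsilon> / 3)" by simp
      finally show ?thesis by (rule order_trans[OF T])
    qed
    finally have "real (sum_list (map fst res)) \<le> (371 + 304 * C0) * real n powr (3 - \<epsilon> / 3)"
      by (simp add: algebra_simps)
    also have "\<dots> \<le> C1 * real n powr (3 - \<epsilon> / 3)"
      using C0 by (intro mult_right_mono) (auto simp: C1_def)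
    finally have A: "real (sum_list (map fst res)) \<le> C1 * real n powr (3 - \<epsilon> / 3)" .
    have up: "real n ^ i \<le> real n ^ (d + 6)" if "i \<le> d + 6" for i
      using that n1' by (intro power_increasing) auto
    have b8: "?b \<le> 8 * real n ^ 3"
    proof -
      have "real B \<le> 2 * real n" using B_le_2n by (metis of_nat_le_iff of_nat_mult of_nat_numeral)
      then have "real B ^ 3 \<le> (2 * real n) ^ 3" by (intro power_mono) auto
      then show ?thesis by (simp add: power3_eq_cube mult.assoc)
    qed
    have kn: "real k \<le> real n" using k_le_n by simp
    have P1: "real prep_bound \<le> 600 * real n ^ (d + 6)"
    proof -
      have "prep_bound \<le> 600 * n ^ 5" unfolding prep_bound_def layer_cost_def row_cost_def copy_cost_def by (rule prep_estimate)
      then have "real prep_bound \<le> real (600 * n ^ 5)" by (simp only: of_nat_le_iff)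
      then show ?thesis using up[of 5] by simp
    qed
    have P2: "?b * (C0 * real (5 * k) ^ d) \<le> 8 * 5 ^ d * C0 * real n ^ (d + 6)"
    proof -
      have "real (5 * k) ^ d \<le> (5 * real n) ^ d" using kn by (intro power_mono) auto
      then have "?b * (C0 * real (5 * k) ^ d) \<le> (8 * real n ^ 3) * (C0 * (5 * real n) ^ d)"
        using b8 C0 by (intro mult_mono) auto
      also have "\<dots> = 8 * 5 ^ d * C0 * real n ^ (d + 3)" by (simp add: power_mult_distrib power_add)
      also have "\<dots> \<le> 8 * 5 ^ d * C0 * real n ^ (d + 6)" using C0 by (intro mult_left_mono up) auto
      finally show ?thesis .
    qed
    have P3: "?b * (C0 * (19 * ?pw)) \<le> 152 * C0 * real n ^ (d + 6)"
    proof -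
      have "?pw \<le> real k powr 3" using k1 e by (intro powr_mono) auto
      also have "\<dots> = real k ^ 3" using k1 by (simp add: powr_numeral)
      also have "\<dots> \<le> real n ^ 3" using kn by (intro power_mono) auto
      finally have "?b * (C0 * (19 * ?pw)) \<le> (8 * real n ^ 3) * (C0 * (19 * real n ^ 3))"
        using b8 C0 by (intro mult_mono) auto
      also have "\<dots> = 152 * C0 * real n ^ 6" by (simp add: power_add[symmetric])
      also have "\<dots> \<le> 152 * C0 * real n ^ (d + 6)" using C0 by (intro mult_left_mono up) auto
      finally show ?thesis .
    qed
    have "real \<tau> \<le> real prep_bound + (real (\<Sum>c<B * B * B. tp c) + real (\<Sum>c<B * B * B. ops_time c))"
      using R(4) unfolding sum.distrib by (metis of_nat_add of_nat_le_iff)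
    also have "\<dots> \<le> 600 * real n ^ (d + 6) + (8 * 5 ^ d * C0 * real n ^ (d + 6) + 152 * C0 * real n ^ (d + 6))"
      using T Tp P1 P2 P3 by linarith
    also have "\<dots> = (600 + 8 * 5 ^ d * C0 + 152 * C0) * real n ^ (d + 6)" by (simp only: distrib_right add.assoc)
    also have "\<dots> \<le> C1 * real n ^ (d + 6)" using C0 by (intro mult_right_mono) (auto simp: C1_def)
    finally show ?thesis using R(1-3) A unfolding W_eq by blast
  qed
  then have "solves_OMv (\<epsilon> / 3) (OMv_prep inc \<kappa> P U) (OMv_query inc U Q)"
    unfolding solves_OMv_def by (intro exI[of _ "3 * \<kappa> + 60"] exI[of _ "d + 6"] exI[of _ C1]) blast
  then show ?thesis by blast
qed

text \<open>\<open>serve\<close> yields exactly one time per operation, so the pointwise bounds can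
  be summed over the operations.\<close>

lemma amortized_if_worst_case:
  assumes "solves_TC G (worst_case_bound \<epsilon>) P U Q"
  shows "solves_TC G (amortized_bound \<epsilon>) P U Q"
proof -
  have le: "amortized_bound \<epsilon> n \<eta> C ops (map fst res)"
    if w: "worst_case_bound \<epsilon> n \<eta> C ops (map fst res)" and s: "serve W \<mu> (map (request U Q) ops) res" for n \<eta> C ops W \<mu> and res :: "(nat \<times> nat list) list"
  proof -
    have l: "length res = length ops" using serve_trace[OF s] by simp
    have "real (sum_list (map fst res)) = (\<Sum>i<length ops. real (fst (res ! i)))"
      using l by (simp add: sum_list_sum_nth atLeast0LessThan)
    also have "\<dots> \<le> (\<Sum>i<length ops. C * operation_bound \<epsilon> n \<eta> (ops ! i))"
      by (rule sum_mono) (use w l in \<open>simp add: worst_case_bound_def\<close>)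
    also have "\<dots> = C * sum_list (map (operation_bound \<epsilon> n \<eta>) ops)"
      by (simp add: sum_list_sum_nth atLeast0LessThan sum_distrib_left)
    finally show ?thesis unfolding amortized_bound_def .
  qed
  then show ?thesis using assms unfolding solves_TC_def by meson
qed

lemma operation_bound_antimono:
  assumes "\<epsilon>' \<le> \<epsilon>" "1 \<le> n"
  shows "operation_bound \<epsilon> n \<eta> x \<le> operation_bound \<epsilon>' n \<eta> x"
  using assms by (cases x) (auto intro!: powr_mono)

text \<open>All bounds are powers of bases at least 1, hence decrease in \<epsilon>. Enlarging the
  sum of bounds is sound only for a nonnegative constant, therefore \<open>max C 0\<close>.\<close>

lemma amortized_antimono:
  assumes TC: "solves_TC G (amortized_bound \<epsilon>) P U Q" and e: "\<epsilon>' \<le> \<epsilon>"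
  shows "solves_TC G (amortized_bound \<epsilon>') P U Q"
proof -
  have le: "amortized_bound \<epsilon>' n \<eta> (max C 0) ops ts" if a: "amortized_bound \<epsilon> n \<eta> C ops ts" and n: "1 \<le> n" for n \<eta> C ops ts
  proof -
    let ?b = "\<lambda>\<epsilon>. sum_list (map (operation_bound \<epsilon> n \<eta>) ops)"
    have nonneg: "0 \<le> operation_bound \<epsilon> n \<eta> x" for x by (cases x) auto
    have "real (sum_list ts) \<le> C * ?b \<epsilon>" using a unfolding amortized_bound_def .
    also have "\<dots> \<le> max C 0 * ?b \<epsilon>" using nonneg by (intro mult_right_mono sum_list_nonneg) auto
    also have "\<dots> \<le> max C 0 * ?b \<epsilon>'"
      using operation_bound_antimono[OF e n] by (intro mult_left_mono sum_list_mono) auto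
    finally show ?thesis unfolding amortized_bound_def .
  qed
  have le': "real \<tau> \<le> max C 0 * real n ^ d" if "real \<tau> \<le> C * real n ^ d" for \<tau> C n d
    using that mult_right_mono[of C "max C 0" "real n ^ d"] by simp
  from TC obtain \<kappa> d C where "\<forall>n\<ge>1. \<forall>ehat ops. tc_instance n ehat ops \<longrightarrow>
      (\<exists>\<tau> \<mu> out res. exec ((n + 2) ^ \<kappa>) (encode_prediction n ehat) P (\<lambda>_. 0) \<tau> \<mu> out \<and>
         serve ((n + 2) ^ \<kappa>) \<mu> (map (request U Q) ops) res \<and>
         correct_answers G ehat ops (map snd res) \<and> real \<tau> \<le> C * real n ^ d \<and>
         amortized_bound \<epsilon> n (eta_inf ehat (updates ops)) C ops (map fst res))"
    unfolding solves_TC_def by blast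
  then show ?thesis unfolding solves_TC_def
    by (intro exI[of _ \<kappa>] exI[of _ d] exI[of _ "max C 0"]) (meson le le')
qed

lemma no_solves_TC:
  assumes "OMv_hypothesis" "0 < \<epsilon>"
  shows "\<not> solves_TC (tc_graph inc) (amortized_bound \<epsilon>) P U Q"
proof
  assume "solves_TC (tc_graph inc) (amortized_bound \<epsilon>) P U Q"
  \<comment> \<open>A larger saving is weakened to 1, the range in which the overhead of the
    reduction stays below the target.\<close>
  then have "solves_TC (tc_graph inc) (amortized_bound (min \<epsilon> 1)) P U Q" by (rule amortized_antimono) simp
  then have "\<exists>P' Q'. solves_OMv (min \<epsilon> 1 / 3) P' Q'"
    by (rule solves_OMv_if_solves_TC) (use assms in auto)
  then show False using assms unfolding OMv_hypothesis_def by simp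
qed

theorem theorem1p3:
  assumes "OMv_hypothesis"
  shows "\<forall>\<epsilon>>0.
    \<not> (\<exists>P U Q. solves_TC incremental_graph (worst_case_bound \<epsilon>) P U Q) \<and>
    \<not> (\<exists>P U Q. solves_TC decremental_graph (worst_case_bound \<epsilon>) P U Q) \<and>
    \<not> (\<exists>P U Q. solves_TC incremental_graph (amortized_bound \<epsilon>) P U Q) \<and>
    \<not> (\<exists>P U Q. solves_TC decremental_graph (amortized_bound \<epsilon>) P U Q)"
  using no_solves_TC[OF assms, of _ True] no_solves_TC[OF assms, of _ False] amortized_if_worst_case
  unfolding tc_graph_def if_True if_False by blast

end
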